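(* Fix $\epsilon>0$. There is a deterministic algorithm which, on input a positive integer $k$, outputs a $2$-coloring of $\{1,\ldots,n\}$ with no monochromatic $k$-AP, where $n=\left\lfloor\frac{2^{(k-1)(1-\epsilon)}}{ek}\right\rfloor$, and runs in time polynomial in $\frac{2^{(k-1)(1-\epsilon)}}{ek}$ (the degree of the polynomial depending on $\epsilon$). In particular $W(k,2)\ge \frac{2^{(k-1)(1-\epsilon)}}{ek}$.
   Context: A $k$-AP is a set $\{a,a+d,\ldots,a+(k-1)d\}$ with $a,d$ positive integers. A $2$-coloring of $\{1,\ldots,n\}$ is proper if no $k$-AP contained in $\{1,\ldots,n\}$ is monochromatic. $W(k,2)$ is the least $W$ such that every $2$-coloring of $\{1,\ldots,W\}$ contains a monochromatic $k$-AP. (The paper calls such a proof "deterministic-constructive".)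
   Formalization: Coloring exactly {1,…,n} is claimed for rational ε, or real ε whose n is computable in time polynomial in the bound (also necessary; it fails for uncomputable ε); for every ε>0 the algorithm colors {1,…,m} for some m≥n, and the bound on W(k,2) holds. *)

theory Defs
  imports
    Complex_Main
    "HOL-Library.Log_Nat"
    "HOL-Computational_Algebra.Polynomial"
begin

definition is_AP :: "nat \<Rightarrow> nat set \<Rightarrow> bool" where
  "is_AP k S \<longleftrightarrow> (\<exists>a d. 0 < a \<and> 0 < d \<and> S = {a + i * d | i. i < k})"

text \<open>The two colors are 0 and 1; values outside \<open>{1..n}\<close> are irrelevant.\<close>

definition two_coloring :: "nat \<Rightarrow> (nat \<Rightarrow> nat) \<Rightarrow> bool" where
  "two_coloring n c \<longleftrightarrow> (\<forall>x\<in>{1..n}. c x \<in> {0, 1})"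

definition monochromatic :: "(nat \<Rightarrow> nat) \<Rightarrow> nat set \<Rightarrow> bool" where
  "monochromatic c S \<longleftrightarrow> (\<exists>v. \<forall>x\<in>S. c x = v)"

definition has_mono_AP :: "nat \<Rightarrow> nat \<Rightarrow> (nat \<Rightarrow> nat) \<Rightarrow> bool" where
  "has_mono_AP k n c \<longleftrightarrow> (\<exists>S \<subseteq> {1..n}. is_AP k S \<and> monochromatic c S)"

definition proper_coloring :: "nat \<Rightarrow> nat \<Rightarrow> (nat \<Rightarrow> nat) \<Rightarrow> bool" where
  "proper_coloring k n c \<longleftrightarrow> two_coloring n c \<and> \<not> has_mono_AP k n c"

text \<open>\<open>vdW k\<close> is $W(k,2)$.\<close>

definition vdW :: "nat \<Rightarrow> nat" where
  "vdW k = (LEAST W. \<forall>c. two_coloring W c \<longrightarrow> has_mono_AP k W c)"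

definition vdW_bound :: "real \<Rightarrow> nat \<Rightarrow> real" where
  "vdW_bound \<epsilon> k = 2 powr ((real k - 1) * (1 - \<epsilon>)) / (exp 1 * real k)"

definition vdW_length :: "real \<Rightarrow> nat \<Rightarrow> nat" where
  "vdW_length \<epsilon> k = nat \<lfloor>vdW_bound \<epsilon> k\<rfloor>"


text \<open>
  Programs act on an unbounded memory of registers, each of which holds a natural number.
  The instruction set (constants, addition, truncated subtraction, indirect addressing,
  output) and the logarithmic cost measure are those of Cook and Reckhow's RAM, which
  is equivalent to multitape Turing machines up to a polynomial in the running time; jumps are
  replaced by the usual structured control flow.  Arguments of
  type nat are register numbers, except for the literal \<open>x\<close> in \<open>Const r x\<close>.
\<close>

type_synonym memory = "nat \<Rightarrow> nat"

datatype com =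
    Skip
  | Const nat nat
  | Add nat nat nat
  | Sub nat nat nat
  | Load nat nat
  | Store nat nat
  | Print nat
  | Seq com com
  | Cond nat com com
  | While nat com

text \<open>\<open>floorlog 2 x\<close> is the number of binary digits of \<open>x\<close> (and 0 for \<open>x = 0\<close>).\<close>

abbreviation digits :: "nat \<Rightarrow> nat" where
  "digits x \<equiv> floorlog 2 x"

text \<open>
  \<open>exec P M t xs M'\<close>: started in memory \<open>M\<close>, the program \<open>P\<close> halts with cost \<open>t\<close>
  in memory \<open>M'\<close>, having printed the list \<open>xs\<close>.
\<close>

inductive exec :: "com \<Rightarrow> memory \<Rightarrow> nat \<Rightarrow> nat list \<Rightarrow> memory \<Rightarrow> bool" where
  Skip: "exec Skip M 1 [] M"
| Const: "exec (Const r x) M (1 + digits x) [] (M(r := x))"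
| Add: "exec (Add r i j) M (1 + digits (M i) + digits (M j)) [] (M(r := M i + M j))"
| Sub: "exec (Sub r i j) M (1 + digits (M i) + digits (M j)) [] (M(r := M i - M j))"
| Load: "exec (Load r i) M (1 + digits (M i) + digits (M (M i))) [] (M(r := M (M i)))"
| Store: "exec (Store r i) M (1 + digits (M r) + digits (M i)) [] (M(M r := M i))"
| Print: "exec (Print i) M (1 + digits (M i)) [M i] M"
| Seq: "exec P M s xs M' \<Longrightarrow> exec Q M' t ys M'' \<Longrightarrow> exec (Seq P Q) M (s + t) (xs @ ys) M''"
| CondTrue: "M i \<noteq> 0 \<Longrightarrow> exec P M t xs M' \<Longrightarrow> exec (Cond i P Q) M (1 + digits (M i) + t) xs M'"
| CondFalse: "M i = 0 \<Longrightarrow> exec Q M t xs M' \<Longrightarrow> exec (Cond i P Q) M (1 + t) xs M'"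
| WhileTrue: "M i \<noteq> 0 \<Longrightarrow> exec P M s xs M' \<Longrightarrow> exec (While i P) M' t ys M''
    \<Longrightarrow> exec (While i P) M (1 + digits (M i) + s + t) (xs @ ys) M''"
| WhileFalse: "M i = 0 \<Longrightarrow> exec (While i P) M 1 [] M"

inductive_cases exec_SkipE: "exec Skip M t xs M'"
inductive_cases exec_ConstE: "exec (Const r x) M t xs M'"
inductive_cases exec_AddE: "exec (Add r i j) M t xs M'"
inductive_cases exec_SubE: "exec (Sub r i j) M t xs M'"
inductive_cases exec_LoadE: "exec (Load r i) M t xs M'"
inductive_cases exec_StoreE: "exec (Store r i) M t xs M'"
inductive_cases exec_PrintE: "exec (Print i) M t xs M'"
inductive_cases exec_SeqE: "exec (Seq P Q) M t xs M'"
inductive_cases exec_CondE: "exec (Cond i P Q) M t xs M'"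
inductive_cases exec_WhileE: "exec (While i P) M t xs M'"

lemma exec_deterministic:
  "exec P M t xs M' \<Longrightarrow> exec P M u ys N' \<Longrightarrow> u = t \<and> ys = xs \<and> N' = M'"
proof (induction arbitrary: u ys N' rule: exec.induct)
  case (Seq P M s xs M' Q t ys' M'')
  show ?case
  proof (rule exec_SeqE[OF Seq.prems])
    fix s2 xs2 M2 t2 ys2
    assume *: "u = s2 + t2" "ys = xs2 @ ys2" "exec P M s2 xs2 M2" "exec Q M2 t2 ys2 N'"
    have "s2 = s \<and> xs2 = xs \<and> M2 = M'" by (rule Seq.IH(1)[OF *(3)])
    moreover from this *(4) have "t2 = t \<and> ys2 = ys' \<and> N' = M''" by (intro Seq.IH(2)) simp
    ultimately show ?case using * by simp
  qed
next
  case (CondTrue M i P t xs M' Q)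
  show ?case
  proof (rule exec_CondE[OF CondTrue.prems])
    fix t2
    assume *: "u = Suc (digits (M i) + t2)" "exec P M t2 ys N'"
    show ?case using CondTrue.IH[OF *(2)] *(1) by simp
  qed (use CondTrue.hyps(1) in simp)
next
  case (CondFalse M i Q t xs M' P)
  show ?case
  proof (rule exec_CondE[OF CondFalse.prems])
    fix t2
    assume *: "u = Suc t2" "exec Q M t2 ys N'"
    show ?case using CondFalse.IH[OF *(2)] *(1) by simp
  qed (use CondFalse.hyps(1) in simp)
next
  case (WhileTrue M i P s xs M' t ys' M'')
  show ?case
  proof (rule exec_WhileE[OF WhileTrue.prems])
    fix s2 xs2 M2 t2 ys2
    assume *: "u = Suc (digits (M i) + s2 + t2)" "ys = xs2 @ ys2"
      "exec P M s2 xs2 M2" "exec (While i P) M2 t2 ys2 N'"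
    have "s2 = s \<and> xs2 = xs \<and> M2 = M'" by (rule WhileTrue.IH(1)[OF *(3)])
    moreover from this *(4) have "t2 = t \<and> ys2 = ys' \<and> N' = M''"
      by (intro WhileTrue.IH(2)) simp
    ultimately show ?case using * by simp
  qed (use WhileTrue.hyps(1) in simp)
next
  case (WhileFalse M i P)
  show ?case
    by (rule exec_WhileE[OF WhileFalse.prems]) (use WhileFalse.hyps in linarith, simp)
qed (erule exec_SkipE exec_ConstE exec_AddE exec_SubE exec_LoadE exec_StoreE exec_PrintE, simp)+

text \<open>The input is held in register 0; all other registers are initially 0.\<close>

definition runs :: "com \<Rightarrow> nat \<Rightarrow> nat list \<Rightarrow> nat \<Rightarrow> bool" where
  "runs P k xs t \<longleftrightarrow> (\<exists>M. exec P ((\<lambda>_. 0)(0 := k)) t xs M)"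

text \<open>
  On every positive input \<open>k\<close> the program halts with an output related to \<open>k\<close> by \<open>R\<close>,
  in time polynomial in \<open>N k\<close>.
\<close>

definition solves_in_poly_time ::
    "com \<Rightarrow> (nat \<Rightarrow> real) \<Rightarrow> (nat \<Rightarrow> nat list \<Rightarrow> bool) \<Rightarrow> bool" where
  "solves_in_poly_time P N R \<longleftrightarrow>
     (\<exists>p :: real poly. \<forall>k\<ge>1. \<exists>xs t. runs P k xs t \<and> R k xs \<and> real t \<le> poly p (N k))"

text \<open>The output \<open>xs\<close> lists the colors of \<open>1, \<dots>, n\<close> in this order.\<close>

definition outputs_proper_coloring :: "nat \<Rightarrow> nat \<Rightarrow> nat list \<Rightarrow> bool" where
  "outputs_proper_coloring k n xs \<longleftrightarrow> (\<exists>c. proper_coloring k n c \<and> xs = map c [1..<Suc n])"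

text \<open>
  For an arbitrary real \<open>\<epsilon>\<close> the function \<open>vdW_length \<epsilon>\<close> may fail to be computable, and an
  algorithm that colors exactly \<open>{1..vdW_length \<epsilon> k}\<close> computes it, by counting its output.
\<close>

definition length_poly_time :: "real \<Rightarrow> bool" where
  "length_poly_time \<epsilon> \<longleftrightarrow>
     (\<exists>Q. solves_in_poly_time Q (vdW_bound \<epsilon>) (\<lambda>k xs. xs = [vdW_length \<epsilon> k]))"

end

theory Submission
  imports
    Defs
    "HOL-Library.Z2"
    "HOL-Algebra.Multiplicative_Group"
    "HOL-Algebra.Algebraic_Closure_Type"
begin

text \<open>
  The colorings generalise Berlekamp's. Let \<open>m < k\<close> have no proper divisor larger than
  \<open>\<epsilon> * m / 2\<close> (take $m \equiv 1$ modulo a suitable factorial), let \<open>x\<close> generate the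
  multiplicative group of $GF(2^m)$, and color \<open>v\<close> with the trace of $x^v y$. If a progression
  with difference \<open>d\<close> and more than \<open>m\<close> terms is monochromatic, a nonzero linear functional
  vanishes on the first \<open>m\<close> powers of $x^d$, hence $x^d$ lies in a proper subfield; this forces
  \<open>d\<close> to be larger than the number of points colored. Such a coloring satisfies a linear
  recurrence of order \<open>m\<close> over $GF(2)$, so a program finds it, or another proper one, by trying
  all recurrences. The finitely many small \<open>k\<close> only need the existence of a coloring, which
  follows from Rosenfeld's counting argument.

  To print exactly as many colors as required when \<open>\<epsilon>\<close> is rational, one has to compare an integer
  power of \<open>e\<close> with a fraction. An effective irrationality measure, from Pade approximation of the
  exponential series, bounds the number of terms of the series that decide the comparison.
\<close>

section \<open>Existence of colorings by counting\<close>

text \<open>If \<open>x ^ d\<close> lies in the subfield of degree \<open>g < m\<close>, then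
  \<open>2 ^ m - 1\<close> divides \<open>d * (2 ^ g - 1)\<close>, so \<open>d\<close> is at least
  about \<open>2 ^ (m - g)\<close>. The length that can be colored is thus governed by the largest
  proper divisor of \<open>m\<close>. This is why \<open>m\<close> is not simply
  \<open>k - 1\<close>: moving down to the residue 1 costs a constant in the exponent, which
  \<epsilon> absorbs once \<open>k\<close> is large.

  The program does no field arithmetic and does not know \<open>m\<close>. It counts
  \<open>z\<close> upwards, reads the binary digits of \<open>z\<close> as coefficients and tests
  the resulting sequence for progressions. Every 2-coloring that gives 1 the color 1 arises in this
  way, so one program serves small and large \<open>k\<close>; the existence results merely bound
  the first success by \<open>2 ^ (c * k)\<close>, which is polynomial in \<open>vdW_bound\<close>
  for fixed \<epsilon> < 1.

  The obstacle to printing exactly \<open>vdW_length\<close> colors is the decision whether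
  \<open>e * k * m\<close> is at most a power of 2 with rational exponent: without a lower bound for
  the gap, no number of digits of \<open>e\<close> is known to suffice. For irrational \<epsilon> a
  smaller rational one is used, at the price of possibly printing more colors.\<close>

text \<open>A coloring is represented by one of its two color classes.\<close>

definition proper_classes :: "'a set set \<Rightarrow> 'a set \<Rightarrow> 'a set set" where
  "proper_classes H U = {T. T \<subseteq> U \<and> (\<forall>e\<in>H. e \<subseteq> U \<longrightarrow> \<not> e \<subseteq> T \<and> e \<inter> T \<noteq> {})}"

lemma finite_proper_classes: "finite U \<Longrightarrow> finite (proper_classes H U)"
  by (rule finite_subset[of _ "Pow U"]) (auto simp: proper_classes_def)

lemma proper_classes_mono: "S \<in> proper_classes H U \<Longrightarrow> Y \<subseteq> U \<Longrightarrow> S \<inter> Y \<in> proper_classes H Y"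
proof -
  assume S: "S \<in> proper_classes H U" and Y: "Y \<subseteq> U"
  have "\<not> e \<subseteq> S \<inter> Y \<and> e \<inter> (S \<inter> Y) \<noteq> {}" if e: "e \<in> H" "e \<subseteq> Y" for e
  proof -
    have "e \<subseteq> U" using e Y by (rule_tac subset_trans)
    then have "\<not> e \<subseteq> S" "e \<inter> S \<noteq> {}" using S e(1) by (simp_all add: proper_classes_def)
    moreover have "e \<inter> (S \<inter> Y) = e \<inter> S" using e(2) by auto
    ultimately show ?thesis by simp
  qed
  then show ?thesis by (simp add: proper_classes_def)
qed

text \<open>Rosenfeld's argument. Giving \<open>v\<close> either color doubles the number of
  colorings of \<open>U\<close>, and a spoiled extension has a monochromatic edge \<open>e\<close>
  through \<open>v\<close>. It is determined by its restriction to \<open>U\<close> without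
  \<open>e - {v, w}\<close>, because \<open>w\<close> shows the color of \<open>e\<close>, and by
  induction removing these \<open>k - 2\<close> points divides the count by at least
  \<open>\<beta> ^ (k - 2)\<close>. So at most \<open>D / \<beta> ^ (k - 2) <= 2 - \<beta>\<close>
  times the old count is lost.\<close>

lemma proper_classes_growth:
  fixes H :: "'a set set" and \<beta> :: real
  assumes V: "finite V" and H: "\<And>e. e \<in> H \<Longrightarrow> e \<subseteq> V" "\<And>e. e \<in> H \<Longrightarrow> card e = k" and k: "k \<ge> 2"
    and deg: "\<And>v. v \<in> V \<Longrightarrow> card {e \<in> H. v \<in> e} \<le> D"
    and \<beta>: "\<beta> > 0" "real D \<le> (2 - \<beta>) * \<beta> ^ (k - 2)"
  shows "U \<subseteq> V \<Longrightarrow> v \<in> V - U \<Longrightarrow>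
    \<beta> * card (proper_classes H U) \<le> card (proper_classes H (insert v U))"
proof (induction "card U" arbitrary: U v rule: less_induct)
  case less
  let ?G = "proper_classes H"
  have finX: "finite U" using less.prems V finite_subset by blast
  have finH: "finite H" using H(1) V by (meson finite_Pow_iff finite_subset PowI subsetI)
  \<comment> \<open>The induction hypothesis, applied one vertex at a time inside
    \<open>U\<close>.\<close>
  have chain: "\<beta> ^ card (Z - Y) * card (?G Y) \<le> card (?G Z)" if "Y \<subseteq> Z" "Z \<subseteq> U" for Y Z
    using that
  proof (induction "card (Z - Y)" arbitrary: Z)
    case 0
    have "finite (Z - Y)" using 0 finX finite_subset by blast
    then have "Z = Y" using 0 by auto
    then show ?case by simp
  next
    case (Suc j)
    then obtain u where u: "u \<in> Z - Y" by (metis card.empty ex_in_conv nat.distinct(1))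
    let ?W = "Z - {u}"
    have finZ: "finite Z" using Suc finX finite_subset by blast
    have card: "card (?W - Y) = j"
    proof -
      have "?W - Y = (Z - Y) - {u}" by auto
      then show ?thesis using Suc(2) u finZ by simp
    qed
    have IH: "\<beta> ^ j * card (?G Y) \<le> card (?G ?W)"
    proof -
      have "Y \<subseteq> ?W" "?W \<subseteq> U" using Suc(3,4) u by auto
      from Suc(1)[OF card[symmetric] this] show ?thesis unfolding card .
    qed
    have "?W \<subset> U" using Suc(4) u by auto
    then have "card ?W < card U" using finX by (simp add: psubset_card_mono)
    moreover have "?W \<subseteq> V" "u \<in> V - ?W" using Suc(4) less.prems(1) u by auto
    ultimately have "\<beta> * card (?G ?W) \<le> card (?G (insert u ?W))"
      by (rule less.hyps)
    moreover have "insert u ?W = Z" using u by auto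
    ultimately have *: "\<beta> * card (?G ?W) \<le> card (?G Z)" by simp
    have "\<beta> * (\<beta> ^ j * card (?G Y)) \<le> \<beta> * card (?G ?W)"
      using IH \<beta>(1) by (simp add: mult_left_mono)
    then have "\<beta> ^ Suc j * card (?G Y) \<le> card (?G Z)" using * by (simp add: mult.assoc)
    then show ?case unfolding Suc(2)[symmetric] .
  qed
  \<comment> \<open>All extensions of proper colorings of \<open>U\<close> to \<open>v\<close>, good
    or bad.\<close>
  define E where "E = {S. S \<subseteq> insert v U \<and> S \<inter> U \<in> ?G U}"
  have vX: "v \<notin> U" "v \<in> V" using less.prems by auto
  have Eeq: "E = ?G U \<union> insert v ` ?G U"
  proof (intro equalityI subsetI)
    fix S assume S: "S \<in> E"
    show "S \<in> ?G U \<union> insert v ` ?G U"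
    proof (cases "v \<in> S")
      case True
      then have "S = insert v (S \<inter> U)" using S unfolding E_def by auto
      then show ?thesis using S unfolding E_def by blast
    next
      case False
      then have "S = S \<inter> U" using S unfolding E_def by auto
      then show ?thesis using S unfolding E_def by auto
    qed
  next
    fix S assume "S \<in> ?G U \<union> insert v ` ?G U"
    then obtain T where T: "T \<in> ?G U" "S = T \<or> S = insert v T" by auto
    then have "T \<subseteq> U" unfolding proper_classes_def by auto
    then have "S \<inter> U = T" "S \<subseteq> insert v U" using T vX by auto
    then show "S \<in> E" using T unfolding E_def by auto
  qed
  have sub: "T \<subseteq> U" if "T \<in> ?G U" for T using that unfolding proper_classes_def by auto
  have "inj_on (insert v) (?G U)"
    using vX sub by (metis (no_types, lifting) inj_onI insert_ident subsetD)
  moreover have "?G U \<inter> insert v ` ?G U = {}" using vX sub by auto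
  ultimately have cardE: "card E = 2 * card (?G U)"
    unfolding Eeq using finite_proper_classes[OF finX, of H]
    by (subst card_Un_disjoint) (auto simp: card_image)
  have finE: "finite E" unfolding Eeq using finite_proper_classes[OF finX, of H] by auto
  define I where "I = {e \<in> H. v \<in> e \<and> e \<subseteq> insert v U}"
  define Bad where "Bad e = {S \<in> E. e \<subseteq> S \<or> e \<inter> S = {}}" for e
  have finI: "finite I" unfolding I_def using finH by auto
  have cov: "E \<subseteq> ?G (insert v U) \<union> (\<Union>e\<in>I. Bad e)"
  proof
    fix S assume S: "S \<in> E"
    show "S \<in> ?G (insert v U) \<union> (\<Union>e\<in>I. Bad e)"
    proof (rule ccontr)
      assume n: "\<not> ?thesis"
      then obtain e where e: "e \<in> H" "e \<subseteq> insert v U" "e \<subseteq> S \<or> e \<inter> S = {}"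
        using S unfolding E_def proper_classes_def by auto
      have "v \<notin> e" using n e S unfolding I_def Bad_def by auto
      then have "e \<subseteq> U" using e by auto
      then show False using e S unfolding E_def proper_classes_def by auto
    qed
  qed
  have bad: "\<beta> ^ (k - 2) * card (Bad e) \<le> card (?G U)" if e: "e \<in> I" for e
  proof -
    have eH: "e \<in> H" "v \<in> e" "e \<subseteq> insert v U" using e unfolding I_def by auto
    have fe: "finite e" using H(1)[OF eH(1)] V finite_subset by blast
    have "card (e - {v}) = k - 1" using H(2)[OF eH(1)] eH(2) fe by simp
    then have "e - {v} \<noteq> {}" using k by (metis card.empty diff_is_0_eq not_numeral_le_zero
          numeral_le_one_iff order_trans semiring_norm(69) Suc_1 not_less_eq_eq One_nat_def le_zero_eq)
    then obtain w where w: "w \<in> e" "w \<noteq> v" by auto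
    define Y where "Y = U - (e - {v, w})"
    have XY: "U - Y = e - {v, w}" using eH unfolding Y_def by auto
    have "card (U - Y) = k - 2"
      unfolding XY using H(2)[OF eH(1)] eH(2) fe w by (simp add: card_Diff_subset)
    then have *: "\<beta> ^ (k - 2) * card (?G Y) \<le> card (?G U)"
      using chain[of Y U] unfolding Y_def by auto
    have wY: "w \<in> Y" using w eH unfolding Y_def by auto
    have "inj_on (\<lambda>S. S \<inter> Y) (Bad e)"
    proof (rule inj_onI)
      fix S T assume ST: "S \<in> Bad e" "T \<in> Bad e" "S \<inter> Y = T \<inter> Y"
      have "e \<subseteq> S \<longleftrightarrow> e \<subseteq> T" "e \<inter> S = {} \<longleftrightarrow> e \<inter> T = {}"
        using ST wY w unfolding Bad_def by blast+
      moreover have "S \<subseteq> Y \<union> e" "T \<subseteq> Y \<union> e"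
        using ST eH unfolding Bad_def E_def Y_def by auto
      ultimately show "S = T" using ST unfolding Bad_def by blast
    qed
    moreover have "(\<lambda>S. S \<inter> Y) ` Bad e \<subseteq> ?G Y"
    proof
      fix T assume "T \<in> (\<lambda>S. S \<inter> Y) ` Bad e"
      then obtain S where S: "S \<in> E" "T = S \<inter> Y" unfolding Bad_def by auto
      have "Y \<subseteq> U" unfolding Y_def by auto
      then have "T = (S \<inter> U) \<inter> Y" using S by auto
      then show "T \<in> ?G Y" using proper_classes_mono[of "S \<inter> U" H U Y] S \<open>Y \<subseteq> U\<close> unfolding E_def by auto
    qed
    moreover have "finite (?G Y)" using finX unfolding Y_def by (auto intro: finite_proper_classes)
    ultimately have "card (Bad e) \<le> card (?G Y)" by (rule card_inj_on_le)
    then show ?thesis using * \<beta>(1)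
      by (meson mult_left_mono of_nat_mono order_trans zero_le_power less_imp_le)
  qed
  have "card I \<le> D"
  proof -
    have "card I \<le> card {e \<in> H. v \<in> e}" unfolding I_def using finH by (intro card_mono) auto
    then show ?thesis using deg[OF vX(2)] by simp
  qed
  have fing: "finite (?G (insert v U))" using finX by (auto intro: finite_proper_classes)
  have finb: "finite (Bad e)" for e unfolding Bad_def using finE by auto
  have "card E \<le> card (?G (insert v U) \<union> (\<Union>e\<in>I. Bad e))"
    using cov fing finI finb by (intro card_mono) auto
  also have "\<dots> \<le> card (?G (insert v U)) + card (\<Union>e\<in>I. Bad e)" by (rule card_Un_le)
  also have "\<dots> \<le> card (?G (insert v U)) + (\<Sum>e\<in>I. card (Bad e))"
    using card_UN_le[OF finI] by auto
  finally have "real (2 * card (?G U)) \<le> real (card (?G (insert v U)) + (\<Sum>e\<in>I. card (Bad e)))"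
    unfolding cardE of_nat_le_iff .
  then have "2 * real (card (?G U)) \<le> card (?G (insert v U)) + (\<Sum>e\<in>I. real (card (Bad e)))"
    by simp
  moreover have "(\<Sum>e\<in>I. real (card (Bad e))) \<le> (2 - \<beta>) * card (?G U)"
  proof -
    let ?b = "\<beta> ^ (k - 2)"
    have b: "?b > 0" using \<beta> by simp
    have "?b * (\<Sum>e\<in>I. real (card (Bad e))) = (\<Sum>e\<in>I. ?b * card (Bad e))" by (simp add: sum_distrib_left)
    also have "\<dots> \<le> (\<Sum>e\<in>I. real (card (?G U)))" using bad by (intro sum_mono)
    also have "\<dots> = card I * card (?G U)" by simp
    also have "\<dots> \<le> D * real (card (?G U))" using \<open>card I \<le> D\<close> by (simp add: mult_right_mono)
    also have "\<dots> \<le> (2 - \<beta>) * ?b * card (?G U)" using \<beta>(2) by (intro mult_right_mono) auto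
    finally have "?b * (\<Sum>e\<in>I. real (card (Bad e))) \<le> ?b * ((2 - \<beta>) * card (?G U))" by (simp add: mult_ac)
    then show ?thesis using b by simp
  qed
  ultimately show ?case by (simp add: algebra_simps)
qed

lemma proper_classes_nonempty:
  fixes H :: "'a set set" and \<beta> :: real
  assumes V: "finite V" and H: "\<And>e. e \<in> H \<Longrightarrow> e \<subseteq> V" "\<And>e. e \<in> H \<Longrightarrow> card e = k" and k: "k \<ge> 2"
    and deg: "\<And>v. v \<in> V \<Longrightarrow> card {e \<in> H. v \<in> e} \<le> D"
    and \<beta>: "\<beta> > 0" "real D \<le> (2 - \<beta>) * \<beta> ^ (k - 2)"
  shows "proper_classes H V \<noteq> {}"
proof -
  have "U \<subseteq> V \<Longrightarrow> card (proper_classes H U) > 0" if "finite U" for U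
    using that
  proof (induction U)
    case empty
    have "{} \<notin> H" using H(2)[of "{}"] k by auto
    then have "proper_classes H {} = {{}}" unfolding proper_classes_def by auto
    then show ?case by simp
  next
    case (insert v U)
    have "0 < \<beta> * card (proper_classes H U)" using insert \<beta>(1) by simp
    also have "\<dots> \<le> card (proper_classes H (insert v U))"
      using insert by (intro proper_classes_growth[OF assms]) auto
    finally show ?case by simp
  qed
  from this[OF V] show ?thesis by auto
qed

section \<open>Progressions as the edges of a uniform hypergraph\<close>

lemma card_AP:
  assumes "is_AP k S"
  shows "finite S" "card S = k"
proof -
  obtain a d where ad: "0 < d" "S = {a + i * d | i. i < k}" using assms unfolding is_AP_def by auto
  have "S = (\<lambda>i. a + i * d) ` {..<k}" using ad by auto
  moreover have "inj_on (\<lambda>i. a + i * d) {..<k}" using ad by (auto intro: inj_onI)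
  ultimately show "finite S" "card S = k" by (simp_all add: card_image)
qed

text \<open>A progression through \<open>v\<close> is fixed by the position of \<open>v\<close> in
  it and by its difference, and \<open>k\<close> terms in \<open>{1..n}\<close> leave room for a
  difference of at most \<open>(n - 1) / (k - 1)\<close>.\<close>

lemma card_APs_through:
  assumes "k \<ge> 2"
  shows "card {e. e \<subseteq> {1..n} \<and> is_AP k e \<and> v \<in> e} \<le> k * ((n - 1) div (k - 1))"
proof -
  define f where "f = (\<lambda>(i, d). {v - i * d + j * d | j. j < k})"
  let ?A = "{e. e \<subseteq> {1..n} \<and> is_AP k e \<and> v \<in> e}"
  let ?P = "{..<k} \<times> {1..(n - 1) div (k - 1)}"
  have "?A \<subseteq> f ` ?P"
  proof
    fix S assume S: "S \<in> ?A"
    then obtain a d where ad: "0 < a" "0 < d" "S = {a + i * d | i. i < k}"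
      unfolding is_AP_def by auto
    then obtain i where i: "i < k" "v = a + i * d" using S by auto
    have "a + (k - 1) * d \<in> S" using ad assms by auto
    then have "a + (k - 1) * d \<le> n" using S by auto
    then have "d * (k - 1) \<le> n - 1" using ad(1) by (simp add: mult.commute)
    then have "d \<le> (n - 1) div (k - 1)" using assms by (simp add: less_eq_div_iff_mult_less_eq)
    moreover have "f (i, d) = S" unfolding f_def ad(3) using i(2) by simp
    ultimately show "S \<in> f ` ?P" using i ad(2) by force
  qed
  then have "card ?A \<le> card ?P" by (meson finite_SigmaI finite_lessThan finite_atLeastAtMost surj_card_le)
  then show ?thesis by simp
qed

lemma proper_coloring_0: "k \<ge> 1 \<Longrightarrow> proper_coloring k 0 c"
  unfolding proper_coloring_def two_coloring_def has_mono_AP_def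
  using card_AP(2)[of k "{}"] by auto

lemma proper_coloring_of_class:
  assumes "S \<in> proper_classes {e. e \<subseteq> {1..n} \<and> is_AP k e} {1..n}"
  shows "proper_coloring k n (\<lambda>x. if x \<in> S then 1 else 0)"
proof -
  have "\<not> monochromatic (\<lambda>x. if x \<in> S then 1 else 0) e" if e: "e \<subseteq> {1..n}" "is_AP k e" for e
  proof
    assume "monochromatic (\<lambda>x. if x \<in> S then 1 else 0) e"
    then obtain w :: nat where w: "\<forall>x\<in>e. (if x \<in> S then 1 else 0) = w" unfolding monochromatic_def by blast
    have "\<not> e \<subseteq> S \<and> e \<inter> S \<noteq> {}" using assms e unfolding proper_classes_def by auto
    then obtain x y where "x \<in> e" "x \<notin> S" "y \<in> e" "y \<in> S" by auto
    then show False using w by (metis zero_neq_one)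
  qed
  moreover have "two_coloring n (\<lambda>x. if x \<in> S then 1 else 0)" unfolding two_coloring_def by simp
  ultimately show ?thesis unfolding proper_coloring_def has_mono_AP_def by blast
qed

text \<open>This is \<open>(1 + 1 / m) ^ m <= e\<close>; in the counting argument the factor
  \<open>exp 1\<close> of the bound is spent here.\<close>

lemma inverse_exp_1_le_power: "1 / exp 1 \<le> (real m / (real m + 1)) ^ m"
proof (cases "m = 0")
  case True
  then show ?thesis by simp
next
  case False
  have "(1 + 1 / real m) ^ m \<le> exp (1 / real m) ^ m"
    by (intro power_mono exp_ge_add_one_self) auto
  also have "\<dots> = exp 1" using False by (simp flip: exp_of_nat_mult)
  finally have *: "(1 + 1 / real m) ^ m \<le> exp 1" .
  have "real m / (real m + 1) = 1 / (1 + 1 / real m)" using False by (simp add: field_simps)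
  then have "(real m / (real m + 1)) ^ m = 1 / (1 + 1 / real m) ^ m"
    by (simp add: power_one_over)
  moreover have "(1 + 1 / real m) ^ m > 0"
    by (metis add_pos_nonneg of_nat_0_le_iff zero_less_divide_1_iff zero_less_one zero_less_power zero_le_divide_1_iff)
  ultimately show ?thesis using * by (simp add: frac_le)
qed

theorem proper_coloring_exists:
  assumes k: "k \<ge> 1" and n: "real n \<le> 2 ^ (k - 1) / (exp 1 * real k)"
  shows "\<exists>c. proper_coloring k n c"
proof (cases "k \<ge> 3")
  case False
  \<comment> \<open>For these \<open>k\<close> the bound is below 1. The choice of \<beta> made in
    the other case would be 0 for \<open>k = 2\<close>.\<close>
  have "k = 1 \<or> k = 2" using False k by linarith
  then have "2 ^ (k - 1) \<le> real k" by auto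
  then have "real n \<le> real k / (exp 1 * real k)" using n
    by (smt (verit) divide_right_mono exp_gt_zero mult_nonneg_nonneg of_nat_0_le_iff)
  also have "\<dots> < 1" using k by (simp add: field_simps)
  finally have "n = 0" by simp
  then show ?thesis using proper_coloring_0[OF k] by blast
next
  case k3: True
  let ?H = "{e. e \<subseteq> {1..n} \<and> is_AP k e}"
  define m where "m = k - 2"
  have km: "k = m + 2" "m \<ge> 1" using k3 unfolding m_def by auto
  \<comment> \<open>This \<beta> maximizes \<open>(2 - \<beta>) * \<beta> ^ m\<close>, the number of
    edges per vertex that the counting lemma tolerates.\<close>
  define \<beta> where "\<beta> = 2 * (real m / (real m + 1))"
  have "real (k * ((n - 1) div (k - 1))) \<le> real k * (real n / real (k - 1))"
  proof -
    have "real ((n - 1) div (k - 1)) * real (k - 1) \<le> real (n - 1)"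
      unfolding of_nat_mult[symmetric] of_nat_le_iff by (rule div_times_less_eq_dividend)
    then have "real ((n - 1) div (k - 1)) \<le> real (n - 1) / real (k - 1)"
      using k3 by (simp add: pos_le_divide_eq)
    also have "\<dots> \<le> real n / real (k - 1)" by (intro divide_right_mono) auto
    finally show ?thesis unfolding of_nat_mult by (rule mult_left_mono) simp
  qed
  also have "\<dots> \<le> real k * ((2 ^ (k - 1) / (exp 1 * real k)) / real (k - 1))"
    using n by (intro mult_left_mono divide_right_mono) auto
  also have "\<dots> = 2 ^ (k - 1) / exp 1 / real (k - 1)" using k by simp
  also have "\<dots> = (2 / (real m + 1)) * (2 ^ m * (1 / exp 1))"
    unfolding km(1) by (simp add: field_simps)
  also have "\<dots> \<le> (2 / (real m + 1)) * (2 ^ m * (real m / (real m + 1)) ^ m)"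
    using inverse_exp_1_le_power[of m] by (intro mult_left_mono) auto
  also have "\<dots> = (2 - \<beta>) * \<beta> ^ m"
    unfolding \<beta>_def power_mult_distrib by (simp add: field_simps)
  finally have D: "real (k * ((n - 1) div (k - 1))) \<le> (2 - \<beta>) * \<beta> ^ (k - 2)"
    unfolding m_def .
  have "\<beta> > 0" unfolding \<beta>_def using km by simp
  have "proper_classes ?H {1..n} \<noteq> {}"
  proof (rule proper_classes_nonempty[where D = "k * ((n - 1) div (k - 1))" and k = k and \<beta> = \<beta>])
    fix v
    have "{e \<in> ?H. v \<in> e} = {e. e \<subseteq> {1..n} \<and> is_AP k e \<and> v \<in> e}" by auto
    then show "card {e \<in> ?H. v \<in> e} \<le> k * ((n - 1) div (k - 1))"
      using card_APs_through[of k n v] k3 by simp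
  qed (use k3 D \<open>\<beta> > 0\<close> card_AP in auto)
  then show ?thesis using proper_coloring_of_class by blast
qed

section \<open>Van der Waerden's theorem\<close>

text \<open>Serves to treat a block of \<open>L\<close> consecutive colors as a single color below
  \<open>R\<close>.\<close>

lemma list_code:
  fixes r L :: nat
  shows "\<exists>h :: nat list \<Rightarrow> nat. \<exists>R. inj_on h {xs. set xs \<subseteq> {..<r} \<and> length xs = L} \<and>
    (\<forall>xs. set xs \<subseteq> {..<r} \<and> length xs = L \<longrightarrow> h xs < R)"
proof -
  let ?X = "{xs. set xs \<subseteq> {..<r} \<and> length xs = L}"
  have "finite ?X" by (rule finite_lists_length_eq) simp
  from ex_bij_betw_finite_nat[OF this] obtain h where h: "bij_betw h ?X {0..<card ?X}" by blast
  have "h xs < card ?X" if "xs \<in> ?X" for xs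
    using bij_betwE[OF h] that by (meson atLeastLessThan_iff)
  then show ?thesis using bij_betw_imp_inj_on[OF h] by blast
qed

text \<open>The bound includes the point \<open>a + k * d\<close> following the progression, which serves as focus.\<close>

definition ap_unavoidable :: "nat \<Rightarrow> nat \<Rightarrow> bool" where
  "ap_unavoidable k r \<longleftrightarrow> (\<exists>N. \<forall>c :: nat \<Rightarrow> nat. (\<forall>x. c x < r) \<longrightarrow>
     (\<exists>a d. d > 0 \<and> a + k * d < N \<and> (\<forall>i<k. c (a + i * d) = c a)))"

text \<open>The invariant of color focusing: \<open>s\<close> monochromatic progressions of
  \<open>k\<close> terms, in pairwise different colors, all of which would be continued by the same
  point \<open>f\<close>.\<close>

definition focused :: "nat \<Rightarrow> nat \<Rightarrow> nat \<Rightarrow> (nat \<Rightarrow> nat) \<Rightarrow> bool" where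
  "focused k s N c \<longleftrightarrow> (\<exists>f A D. f < N \<and> inj_on (\<lambda>j. c (A j)) {..<s} \<and>
     (\<forall>j<s. D j > 0 \<and> A j + k * D j = f \<and> (\<forall>i<k. c (A j + i * D j) = c (A j))))"

text \<open>Color focusing. With the pattern of a block of length \<open>L\<close> as its color,
  \<open>k\<close> blocks in progression look alike, and each contains the same \<open>s\<close>
  focused progressions. If the focus shares a color with one of them, that one gets longer.
  Otherwise each of them is made to advance by one block step per term, and the focus itself, taken
  from block to block, is one more progression; all \<open>s + 1\<close> are focused at the copy of
  the focus in the next block.\<close>

lemma focused_extend:
  fixes r :: nat
  assumes k: "\<And>r. ap_unavoidable k r"
  shows "\<exists>N. \<forall>c :: nat \<Rightarrow> nat. (\<forall>x. c x < r) \<longrightarrow>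
    (\<exists>a d. d > 0 \<and> a + k * d < N \<and> (\<forall>i\<le>k. c (a + i * d) = c a)) \<or> focused k s N c"
proof (induction s)
  case 0
  then show ?case by (intro exI[of _ 1]) (auto simp: focused_def)
next
  case (Suc s)
  then obtain L where L: "\<And>c :: nat \<Rightarrow> nat. (\<forall>x. c x < r) \<Longrightarrow>
      (\<exists>a d. d > 0 \<and> a + k * d < L \<and> (\<forall>i\<le>k. c (a + i * d) = c a)) \<or> focused k s L c" by blast
  obtain h :: "nat list \<Rightarrow> nat" and R where
    h: "inj_on h {xs. set xs \<subseteq> {..<r} \<and> length xs = L}"
       "\<And>xs. set xs \<subseteq> {..<r} \<Longrightarrow> length xs = L \<Longrightarrow> h xs < R"
    using list_code[of r L] by blast
  obtain N2 where N2: "\<And>c :: nat \<Rightarrow> nat. (\<forall>x. c x < R) \<Longrightarrow>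
      \<exists>a d. d > 0 \<and> a + k * d < N2 \<and> (\<forall>i<k. c (a + i * d) = c a)"
    using k[of R] unfolding ap_unavoidable_def by blast
  show ?case
  proof (intro exI[of _ "N2 * L"] allI impI)
    fix c :: "nat \<Rightarrow> nat" assume c: "\<forall>x. c x < r"
    define B where "B x = map (\<lambda>t. c (x * L + t)) [0..<L]" for x
    have B: "set (B x) \<subseteq> {..<r}" "length (B x) = L" for x unfolding B_def using c by auto
    have "\<forall>x. h (B x) < R" using h(2) B by blast
    from N2[OF this] obtain b d where bd: "d > 0" "b + k * d < N2"
      "\<And>i. i < k \<Longrightarrow> h (B (b + i * d)) = h (B b)" by blast
    have "B (b + i * d) = B b" if "i < k" for i
      using bd(3)[OF that] h(1) B by (auto dest: inj_onD)
    then have blk: "c ((b + i * d) * L + t) = c (b * L + t)" if "i < k" "t < L" for i t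
      using that unfolding B_def by (auto simp: map_eq_conv)
    define c' where "c' t = c (b * L + t)" for t
    have bound: "(b + i * d) * L + t < N2 * L" if "i \<le> k" "t < L" for i t
    proof -
      have "i * d \<le> k * d" using that by simp
      then have "b + i * d + 1 \<le> N2" using bd(2) by linarith
      then have "(b + i * d + 1) * L \<le> N2 * L" by (rule mult_le_mono1)
      then show ?thesis using that by (simp add: algebra_simps)
    qed
    have lift: "\<exists>a d. d > 0 \<and> a + k * d < N2 * L \<and> (\<forall>i\<le>k. c (a + i * d) = c a)"
      if "e > 0" "a + k * e < L" "\<And>i. i \<le> k \<Longrightarrow> c' (a + i * e) = c' a" for a e
      using that bound[of 0 "a + k * e"] unfolding c'_def
      by (intro exI[of _ "b * L + a"] exI[of _ e]) (auto simp: add.assoc)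
    have "\<forall>x. c' x < r" using c unfolding c'_def by simp
    from L[OF this] show "(\<exists>a d. d > 0 \<and> a + k * d < N2 * L \<and> (\<forall>i\<le>k. c (a + i * d) = c a))
        \<or> focused k (Suc s) (N2 * L) c"
    proof
      assume "\<exists>a d. d > 0 \<and> a + k * d < L \<and> (\<forall>i\<le>k. c' (a + i * d) = c' a)"
      then show ?thesis using lift by blast
    next
      assume "focused k s L c'"
      then obtain f A D where f: "f < L" "inj_on (\<lambda>j. c' (A j)) {..<s}"
        and A: "\<And>j. j < s \<Longrightarrow> D j > 0" "\<And>j. j < s \<Longrightarrow> A j + k * D j = f"
          "\<And>j i. j < s \<Longrightarrow> i < k \<Longrightarrow> c' (A j + i * D j) = c' (A j)"
        unfolding focused_def by blast
      show ?thesis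
      proof (cases "\<exists>j<s. c' (A j) = c' f")
        case True
        then obtain j where j: "j < s" "c' (A j) = c' f" by blast
        have "c' (A j + i * D j) = c' (A j)" if "i \<le> k" for i
          using A(2,3)[OF j(1)] j(2) that by (cases "i = k") auto
        then show ?thesis using lift[of "D j" "A j"] A(1,2)[OF j(1)] f(1) by auto
      next
        case False
        define A' where "A' = (\<lambda>j. b * L + (if j < s then A j else f))"
        \<comment> \<open>The index \<open>j = s\<close> stands for the old focus copied from block
          to block, hence the inner difference 0.\<close>
        define D' where "D' = (\<lambda>j. d * L + (if j < s then D j else 0))"
        have cA': "c (A' j) = (if j < s then c' (A j) else c' f)" for j
          unfolding A'_def c'_def by simp
        have "inj_on (\<lambda>j. c (A' j)) {..<Suc s}"
          unfolding cA' using f(2) False by (auto simp: inj_on_def less_Suc_eq)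
        moreover have "D' j > 0 \<and> A' j + k * D' j = (b + k * d) * L + f \<and>
            (\<forall>i<k. c (A' j + i * D' j) = c (A' j))" if j: "j < Suc s" for j
        proof (cases "j < s")
          case True
          have "c (A' j + i * D' j) = c (A' j)" if i: "i < k" for i
          proof -
            have "A j + i * D j \<le> A j + k * D j" using i by simp
            then have "A j + i * D j < L" using A(2)[OF True] f(1) by simp
            moreover have "A' j + i * D' j = (b + i * d) * L + (A j + i * D j)"
              unfolding A'_def D'_def using True by (simp add: algebra_simps)
            ultimately have "c (A' j + i * D' j) = c' (A j + i * D j)"
              using blk[OF i] unfolding c'_def by simp
            then show ?thesis using A(3)[OF True i] cA'[of j] True by simp
          qed
          moreover have "A' j + k * D' j = (b + k * d) * L + f"
            unfolding A'_def D'_def using True A(2)[OF True, symmetric] by (simp add: algebra_simps)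
          ultimately show ?thesis using A(1)[OF True] True unfolding D'_def by simp
        next
          case False
          have "c (A' j + i * D' j) = c (A' j)" if i: "i < k" for i
            using blk[OF i f(1)] False unfolding A'_def D'_def by (simp add: algebra_simps)
          then show ?thesis using bd(1) f(1) False unfolding A'_def D'_def
            by (simp add: algebra_simps)
        qed
        ultimately have "focused k (Suc s) (N2 * L) c"
          unfolding focused_def using bound[of k f] f(1) by blast
        then show ?thesis by blast
      qed
    qed
  qed
qed

text \<open>\<open>r + 1\<close> focused progressions would need \<open>r + 1\<close> different
  colors, so the other alternative of \<open>focused_extend\<close> holds.\<close>

lemma ap_unavoidable_Suc:
  assumes k: "\<And>r. ap_unavoidable k r" "k \<ge> 1"
  shows "ap_unavoidable (Suc k) r"
proof -
  obtain N where N: "\<And>c :: nat \<Rightarrow> nat. (\<forall>x. c x < r) \<Longrightarrow>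
      (\<exists>a d. d > 0 \<and> a + k * d < N \<and> (\<forall>i\<le>k. c (a + i * d) = c a)) \<or> focused k (Suc r) N c"
    using focused_extend[OF k(1), where r = r and s = "Suc r"] by blast
  show ?thesis
    unfolding ap_unavoidable_def
  \<comment> \<open>Twice \<open>N\<close> leaves room for the point after the longer progression,
    since \<open>d <= k * d < N\<close>.\<close>
  proof (rule exI[of _ "2 * N"], intro allI impI)
    fix c :: "nat \<Rightarrow> nat" assume c: "\<forall>x. c x < r"
    have "\<not> focused k (Suc r) N c"
    proof
      assume "focused k (Suc r) N c"
      then obtain A where "inj_on (\<lambda>j. c (A j)) {..<Suc r}" unfolding focused_def by blast
      moreover have "(\<lambda>j. c (A j)) ` {..<Suc r} \<subseteq> {..<r}" using c by auto
      ultimately have "card {..<Suc r} \<le> card {..<r}" by (intro card_inj_on_le) auto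
      then show False by simp
    qed
    then obtain a d where ad: "d > 0" "a + k * d < N" "\<forall>i\<le>k. c (a + i * d) = c a"
      using N[OF c] by blast
    have "d \<le> k * d" using k(2) by simp
    then have "a + Suc k * d < 2 * N" using ad(2) unfolding mult_Suc by linarith
    then show "\<exists>a d. d > 0 \<and> a + Suc k * d < 2 * N \<and> (\<forall>i<Suc k. c (a + i * d) = c a)"
      using ad by (auto simp: less_Suc_eq_le)
  qed
qed

theorem van_der_Waerden: "k \<ge> 1 \<Longrightarrow> ap_unavoidable k r"
proof (induction k arbitrary: r rule: dec_induct)
  case base
  show ?case unfolding ap_unavoidable_def
    by (intro exI[of _ 2] allI impI exI[of _ 0] exI[of _ 1]) auto
qed (use ap_unavoidable_Suc in blast)

text \<open>Without this, \<open>vdW\<close> would be the least element of a possibly empty set, and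
  nothing could be compared with it.\<close>

lemma two_coloring_mono_AP_exists:
  assumes "k \<ge> 1"
  shows "\<exists>W. \<forall>c. two_coloring W c \<longrightarrow> has_mono_AP k W c"
proof -
  obtain N where N: "\<And>c :: nat \<Rightarrow> nat. (\<forall>x. c x < 2) \<Longrightarrow>
     \<exists>a d. d > 0 \<and> a + k * d < N \<and> (\<forall>i<k. c (a + i * d) = c a)"
    using van_der_Waerden[OF assms, of 2] unfolding ap_unavoidable_def by blast
  show ?thesis
  proof (intro exI[of _ N] allI impI)
    fix c assume c: "two_coloring N c"
    \<comment> \<open>Shifted by one because \<open>ap_unavoidable\<close> counts from 0. From
      \<open>N\<close> on, the value 0 is a default that keeps all colors below 2.\<close>
    define c' where "c' x = (if x < N then c (Suc x) else 0)" for x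
    have "c (Suc x) = 0 \<or> c (Suc x) = 1" if "x < N" for x
      using c that unfolding two_coloring_def by auto
    then have "\<forall>x. c' x < 2" unfolding c'_def by fastforce
    from N[OF this] obtain a d where ad: "d > 0" "a + k * d < N"
      "\<And>i. i < k \<Longrightarrow> c' (a + i * d) = c' a" by blast
    define S where "S = {Suc a + i * d | i. i < k}"
    have lt: "a + i * d < N" if "i < k" for i
    proof -
      have "i * d \<le> k * d" using that by simp
      then show ?thesis using ad(2) by linarith
    qed
    have "S \<subseteq> {1..N}" unfolding S_def using lt by fastforce
    moreover have "is_AP k S" unfolding is_AP_def S_def using ad(1) by blast
    moreover have "monochromatic c S"
      unfolding monochromatic_def S_def
    proof (intro exI[of _ "c' a"] ballI)
      fix x assume "x \<in> {Suc a + i * d | i. i < k}"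
      then obtain i where i: "i < k" "x = Suc (a + i * d)" by auto
      then show "c x = c' a" using ad(3)[OF i(1)] lt[OF i(1)] unfolding c'_def by simp
    qed
    ultimately show "has_mono_AP k N c" unfolding has_mono_AP_def by blast
  qed
qed

lemma proper_coloring_less_vdW:
  assumes "k \<ge> 1" "proper_coloring k n c"
  shows "n < vdW k"
proof (rule ccontr)
  assume "\<not> n < vdW k"
  then have le: "vdW k \<le> n" by simp
  have "\<forall>c. two_coloring (vdW k) c \<longrightarrow> has_mono_AP k (vdW k) c"
    unfolding vdW_def using two_coloring_mono_AP_exists[OF assms(1)] by (rule LeastI_ex)
  moreover have "two_coloring (vdW k) c" using assms(2) le unfolding proper_coloring_def two_coloring_def by auto
  ultimately have "has_mono_AP k (vdW k) c" by blast
  then have "has_mono_AP k n c" using le unfolding has_mono_AP_def by (meson atLeastatMost_subset_iff le_refl order_trans)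
  then show False using assms(2) unfolding proper_coloring_def by blast
qed

section \<open>Binary linear recurrences\<close>

text \<open>The coefficients of the power series $X / (1 - \sum_j f_j X^j)$ over $GF(2)$.\<close>

fun recseq :: "(nat \<Rightarrow> nat) \<Rightarrow> nat \<Rightarrow> nat" where
  "recseq f v = (if v = 1 then 1 else (\<Sum>j\<in>{1..<v}. f j * recseq f (v - j)) mod 2)"

declare recseq.simps [simp del]

lemma recseq_1 [simp]: "recseq f (Suc 0) = 1"
  by (simp add: recseq.simps)

lemma recseq_rec: "v \<ge> 2 \<Longrightarrow> recseq f v = (\<Sum>j\<in>{1..<v}. f j * recseq f (v - j)) mod 2"
  by (subst recseq.simps) simp

lemma recseq_less_2: "recseq f v < 2"
  by (subst recseq.simps) simp

lemma two_coloring_recseq: "two_coloring n (recseq f)"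
  unfolding two_coloring_def using recseq_less_2[of f] by (auto simp: less_2_cases_iff)

lemma recseq_cong:
  assumes "\<And>j. 1 \<le> j \<Longrightarrow> j < n \<Longrightarrow> f j = g j" "v \<le> n"
  shows "recseq f v = recseq g v"
  using assms(2)
proof (induction v rule: less_induct)
  case (less v)
  show ?case
  proof (cases "v = 1")
    case False
    have "(\<Sum>j\<in>{1..<v}. f j * recseq f (v - j)) = (\<Sum>j\<in>{1..<v}. g j * recseq g (v - j))"
      using less assms(1) by (intro sum.cong) auto
    then show ?thesis using False by (simp add: recseq.simps[of _ v])
  qed simp
qed

lemma recseq_unique:
  assumes "r 1 = 1" "\<And>v. 2 \<le> v \<Longrightarrow> v \<le> n \<Longrightarrow> r v = (\<Sum>j\<in>{1..<v}. f j * r (v - j)) mod 2"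
    and "1 \<le> v" "v \<le> n"
  shows "recseq f v = r v"
  using assms(3,4)
proof (induction v rule: less_induct)
  case (less v)
  show ?case
  proof (cases "v = 1")
    case True
    then show ?thesis using assms(1) by simp
  next
    case False
    have "(\<Sum>j\<in>{1..<v}. f j * recseq f (v - j)) = (\<Sum>j\<in>{1..<v}. f j * r (v - j))"
      using less by (intro sum.cong) auto
    then show ?thesis using False less.prems assms(2)[of v] by (simp add: recseq_rec)
  qed
qed

text \<open>Solving the triangular system for \<open>f\<close>.\<close>

lemma recseq_surj:
  assumes "r 1 = (1::nat)" "\<And>v. v \<in> {1..n} \<Longrightarrow> r v < 2"
  shows "\<exists>f. (\<forall>j. f j < 2) \<and> (\<forall>j\<ge>n. f j = 0) \<and> (\<forall>v\<in>{1..n}. recseq f v = r v)"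
  using assms(2)
proof (induction n)
  case 0
  show ?case by (intro exI[of _ "\<lambda>_. 0"]) simp
next
  case (Suc n)
  then obtain f where f: "\<And>j. f j < 2" "\<And>j. j \<ge> n \<Longrightarrow> f j = 0" "\<And>v. v \<in> {1..n} \<Longrightarrow> recseq f v = r v"
    by force
  show ?case
  proof (cases "n = 0")
    case True
    then show ?thesis using assms(1) by (intro exI[of _ "\<lambda>_. 0"]) (auto simp: le_Suc_eq)
  next
    case False
    \<comment> \<open>The coefficient \<open>f n\<close> enters the value at \<open>Suc n\<close>
      through the product with \<open>recseq f 1 = 1\<close> and enters no earlier value, so this
      bit corrects exactly that value.\<close>
    define b where "b = (recseq f (Suc n) + r (Suc n)) mod 2"
    define g where "g = f(n := b)"
    have g: "recseq g v = r v" if "v \<in> {1..n}" for v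
      using recseq_cong[of n g f v] f(3)[OF that] that unfolding g_def by auto
    have "recseq g (Suc n) = (\<Sum>j\<in>{1..<Suc n}. g j * recseq g (Suc n - j)) mod 2"
      using False by (intro recseq_rec) simp
    also have "{1..<Suc n} = insert n {1..<n}" using False by auto
    also have "(\<Sum>j\<in>insert n {1..<n}. g j * recseq g (Suc n - j)) = b + (\<Sum>j\<in>{1..<n}. g j * recseq g (Suc n - j))"
      by (subst sum.insert) (auto simp: g_def)
    also have "(\<Sum>j\<in>{1..<n}. g j * recseq g (Suc n - j)) = (\<Sum>j\<in>{1..<n}. f j * recseq f (Suc n - j))"
      using recseq_cong[of n g f] unfolding g_def by (intro sum.cong) auto
    also have "\<dots> = (\<Sum>j\<in>insert n {1..<n}. f j * recseq f (Suc n - j))"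
      using f(2)[of n] by (subst sum.insert) auto
    also have "insert n {1..<n} = {1..<Suc n}" using False by auto
    also have "(b + (\<Sum>j\<in>{1..<Suc n}. f j * recseq f (Suc n - j))) mod 2 = (b + recseq f (Suc n)) mod 2"
      using False by (subst recseq_rec) (auto simp: mod_simps)
    also have "\<dots> = r (Suc n)"
      using Suc.prems[of "Suc n"] unfolding b_def by (auto simp: mod_simps less_2_cases_iff) presburger+
    finally have "recseq g v = r v" if "v \<in> {1..Suc n}" for v
      using that g by (cases "v = Suc n") auto
    moreover have "g j < 2" for j using f(1)[of j] unfolding g_def b_def by simp
    moreover have "g j = 0" if "j \<ge> Suc n" for j using f(2)[of j] that unfolding g_def by simp
    ultimately show ?thesis by blast
  qed
qed

text \<open>Binary digit \<open>j - 1\<close> of \<open>z\<close>. Recurrences are thereby numbered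
  by one natural number, which a program can count up.\<close>

definition seed :: "nat \<Rightarrow> nat \<Rightarrow> nat" where
  "seed z j = z div 2 ^ (j - 1) mod 2"

lemma seed_surj:
  assumes "\<And>j. f j < (2::nat)"
  shows "\<exists>z < 2 ^ m. \<forall>j\<in>{1..m}. seed z j = f j"
  using assms
proof (induction m arbitrary: f)
  case 0
  show ?case by simp
next
  case (Suc m)
  obtain z where z: "z < 2 ^ m" "\<And>j. j \<in> {1..m} \<Longrightarrow> seed z j = f (Suc j)"
    using Suc.IH[of "\<lambda>j. f (Suc j)"] Suc.prems by blast
  define y where "y = f 1 + 2 * z"
  have f1: "f 1 < 2" by fact
  have "y < 2 ^ Suc m" using z(1) f1 unfolding y_def by simp
  moreover have "seed y j = f j" if j: "j \<in> {1..Suc m}" for j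
  proof (cases "j = 1")
    case True
    then show ?thesis using f1 unfolding y_def seed_def by simp
  next
    case False
    then obtain i where i: "j = Suc i" "i \<in> {1..m}" using j by (cases j) auto
    then obtain l where l: "i = Suc l" by (cases i) auto
    have "y div 2 ^ i = y div 2 div 2 ^ l" unfolding l by (simp add: div_mult2_eq)
    also have "y div 2 = z" unfolding y_def using f1 by simp
    finally show ?thesis using z(2)[OF i(2)] i l unfolding seed_def by simp
  qed
  ultimately show ?case by blast
qed

lemma seed_zero: "z < 2 ^ m \<Longrightarrow> j > m \<Longrightarrow> seed z j = 0"
proof -
  assume "z < 2 ^ m" "j > m"
  moreover from this have "(2::nat) ^ m \<le> 2 ^ (j - 1)" by (intro power_increasing) auto
  ultimately have "z < 2 ^ (j - 1)" by linarith
  then show ?thesis by (simp add: seed_def)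
qed

lemma recseq_seed:
  assumes "\<And>j. f j < 2" "\<And>j. j > m \<Longrightarrow> f j = 0"
  shows "\<exists>z < 2 ^ m. \<forall>v. recseq (seed z) v = recseq f v"
proof -
  obtain z where z: "z < 2 ^ m" "\<And>j. j \<in> {1..m} \<Longrightarrow> seed z j = f j"
    using seed_surj[of f m] assms(1) by blast
  have "seed z j = f j" if "j \<ge> 1" for j
    using z(2)[of j] seed_zero[OF z(1), of j] assms(2)[of j] that by (cases "j \<le> m") auto
  then have "recseq (seed z) v = recseq f v" for v by (intro recseq_cong[of v]) auto
  then show ?thesis using z(1) by blast
qed

section \<open>Colorings from finite fields\<close>

text \<open>In an algebraically closed field of characteristic 2 this is, for \<open>m >= 1\<close>,
  the subfield with \<open>2 ^ m\<close> elements. All these fields live in one type, so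
  \<open>m\<close> can vary freely.\<close>

definition frob_fixed :: "nat \<Rightarrow> 'a::field set" where
  "frob_fixed m = {x. x ^ (2 ^ m) = x}"

context
  fixes ty :: "'a::alg_closed_field itself"
  assumes char2: "CHAR('a) = 2"
begin

section \<open>Arithmetic in characteristic 2 and the fields inside the closure\<close>

lemma two_eq_0: "(2::'a) = 0"
proof -
  have "of_nat CHAR('a) = (0::'a)" by (rule of_nat_CHAR)
  then show ?thesis unfolding char2 by simp
qed

lemma add_self: "(x::'a) + x = 0"
  by (metis two_eq_0 mult_2 mult_zero_left)

lemma add_eq_0: "(x::'a) + y = 0 \<longleftrightarrow> x = y"
  by (metis add_self add_left_cancel)

lemma frob_add: "((x::'a) + y) ^ (2 ^ m) = x ^ (2 ^ m) + y ^ (2 ^ m)"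
  by (rule freshmans_dream') (simp_all add: char2)

lemma frob_sum: "(sum (f :: 'b \<Rightarrow> 'a) A) ^ (2 ^ m) = (\<Sum>i\<in>A. f i ^ (2 ^ m))"
  by (rule freshmans_dream_sum') (simp_all add: char2)

lemma frob_fixed_closed:
  "(0::'a) \<in> frob_fixed m" "(1::'a) \<in> frob_fixed m"
  "(x::'a) \<in> frob_fixed m \<Longrightarrow> y \<in> frob_fixed m \<Longrightarrow> x + y \<in> frob_fixed m"
  "(x::'a) \<in> frob_fixed m \<Longrightarrow> y \<in> frob_fixed m \<Longrightarrow> x * y \<in> frob_fixed m"
  "(x::'a) \<in> frob_fixed m \<Longrightarrow> inverse x \<in> frob_fixed m"
  "(x::'a) \<in> frob_fixed m \<Longrightarrow> x ^ i \<in> frob_fixed m"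
  unfolding frob_fixed_def
  by (simp_all add: frob_add power_mult_distrib power_inverse) (metis mult.commute power_mult)

text \<open>The polynomial \<open>X ^ (2 ^ m) - X\<close> splits into linear factors, and its
  derivative is the constant -1, so no root is double and there are as many roots as the degree
  says.\<close>

lemma card_frob_fixed:
  assumes "m \<ge> 1"
  shows "finite (frob_fixed m :: 'a set)" "card (frob_fixed m :: 'a set) = 2 ^ m"
proof -
  define p :: "'a poly" where "p = Polynomial.monom 1 (2 ^ m) - Polynomial.monom 1 1"
  have m2: "(2::nat) ^ m > 1" using assms by (intro one_less_power) auto
  have deg: "Polynomial.degree p = 2 ^ m"
    unfolding p_def diff_conv_add_uminus using m2
    by (subst degree_add_eq_left) (simp_all add: degree_monom_eq)
  have lc: "(Polynomial.lead_coeff p) = 1" unfolding deg unfolding p_def using m2 by simp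
  have p0: "p \<noteq> 0" using lc by auto
  have dp: "poly (pderiv p) x = - 1" for x
    using assms unfolding p_def by (simp add: pderiv_diff pderiv_monom poly_monom two_eq_0)
  obtain A where A: "size A = Polynomial.degree p" "p = Polynomial.smult ((Polynomial.lead_coeff p)) (\<Prod>x\<in>#A. [:-x, 1:])"
    using alg_closed_imp_factorization[OF p0] by blast
  have pA: "p = (\<Prod>x\<in>#A. [:-x, 1:])" using A(2) lc by simp
  have "count A x \<le> 1" for x
  proof (rule ccontr)
    assume "\<not> count A x \<le> 1"
    then have "\<exists>B. A = add_mset x (add_mset x B)"
      by (metis count_add_mset count_eq_zero_iff le_Suc_eq le_zero_eq linorder_not_less multi_member_split not_less_eq_eq One_nat_def diff_Suc_1 gr0I le0)
    then obtain B where "A = add_mset x (add_mset x B)" by blast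
    then have "p = [:-x, 1:] * ([:-x, 1:] * (\<Prod>x\<in>#B. [:-x, 1:]))" unfolding pA by simp
    then have "poly (pderiv p) x = 0" by (simp only: pderiv_mult poly_add poly_mult) simp
    then show False using dp by simp
  qed
  then have "A = mset_set (set_mset A)"
    by (intro multiset_eqI) (metis count_eq_zero_iff count_mset_set(1,3) finite_set_mset le_Suc_eq le_zero_eq One_nat_def)
  then have "card (set_mset A) = size A" by (metis size_mset_set)
  moreover have "set_mset A = (frob_fixed m :: 'a set)"
  proof -
    have "x \<in># A \<longleftrightarrow> poly p x = 0" for x
      unfolding pA by (simp add: poly_prod_mset prod_mset_zero_iff image_iff)
    moreover have "poly p x = 0 \<longleftrightarrow> x \<in> frob_fixed m" for x
      unfolding p_def frob_fixed_def by (simp add: poly_monom)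
    ultimately show ?thesis by blast
  qed
  ultimately show "card (frob_fixed m :: 'a set) = 2 ^ m" using A(1) deg by simp
  then show "finite (frob_fixed m :: 'a set)" by (metis card.infinite power_not_zero zero_neq_numeral)
qed

section \<open>Linear spans of powers over the field with two elements\<close>

definition powsum :: "'a \<Rightarrow> nat set \<Rightarrow> 'a" where
  "powsum b T = (\<Sum>i\<in>T. b ^ i)"

text \<open>With coefficients 0 and 1, a linear combination of \<open>1, b, ..., b ^ (l - 1)\<close>
  is a sum over a set of exponents, and addition is symmetric difference of these sets.\<close>

definition powspan :: "'a \<Rightarrow> nat \<Rightarrow> 'a set" where
  "powspan b l = powsum b ` Pow {..<l}"

lemma powsum_sym_diff:
  assumes "finite S" "finite T"
  shows "powsum b (sym_diff S T) = powsum b S + powsum b T"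
proof -
  have S: "powsum b S = powsum b (S - T) + powsum b (S \<inter> T)"
    unfolding powsum_def using assms(1) by (metis add.commute sum.Int_Diff)
  have T: "powsum b T = powsum b (T - S) + powsum b (S \<inter> T)"
    unfolding powsum_def using assms(2) by (metis Int_commute add.commute sum.Int_Diff)
  have "powsum b (sym_diff S T) = powsum b (S - T) + powsum b (T - S)"
    unfolding powsum_def using assms by (intro sum.union_disjoint) auto
  also have "\<dots> = powsum b S + powsum b T"
    unfolding S T using add_self[of "powsum b (S \<inter> T)"] by (simp add: algebra_simps)
  finally show ?thesis .
qed

lemma powspan_closed:
  "0 \<in> powspan b l"
  "x \<in> powspan b l \<Longrightarrow> y \<in> powspan b l \<Longrightarrow> x + y \<in> powspan b l"
  "i < l \<Longrightarrow> b ^ i \<in> powspan b l"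
proof -
  show "0 \<in> powspan b l" unfolding powspan_def powsum_def by (rule image_eqI[of _ _ "{}"]) auto
  show "b ^ i \<in> powspan b l" if "i < l"
    using that unfolding powspan_def powsum_def by (intro image_eqI[of _ _ "{i}"]) auto
  assume "x \<in> powspan b l" "y \<in> powspan b l"
  then obtain S T where ST: "S \<subseteq> {..<l}" "T \<subseteq> {..<l}" "x = powsum b S" "y = powsum b T"
    unfolding powspan_def by auto
  then have "finite S" "finite T" using finite_subset by blast+
  then show "x + y \<in> powspan b l"
    unfolding ST(3,4) powspan_def using ST(1,2)
    by (intro image_eqI[of _ _ "sym_diff S T"]) (auto simp: powsum_sym_diff)
qed

lemma powspan_sum: "(\<And>t. t \<in> T \<Longrightarrow> f t \<in> powspan b l) \<Longrightarrow> sum f T \<in> powspan b l"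
  by (induction T rule: infinite_finite_induct) (auto intro: powspan_closed)

lemma powspan_mult:
  assumes "b ^ l \<in> powspan b l" "x \<in> powspan b l"
  shows "b * x \<in> powspan b l"
proof -
  obtain T where T: "T \<subseteq> {..<l}" "x = powsum b T" using assms(2) unfolding powspan_def by auto
  have "b * x = (\<Sum>i\<in>T. b ^ Suc i)" unfolding T powsum_def by (simp add: sum_distrib_left)
  moreover have "b ^ Suc i \<in> powspan b l" if "i \<in> T" for i
    using that T(1) assms(1) powspan_closed(3)[of "Suc i" l b] by (cases "Suc i = l") (auto simp: Suc_lessI)
  ultimately show ?thesis using powspan_sum by metis
qed

text \<open>Two different sets with equal sums differ in a set of exponents with sum 0, whose
  largest element makes a power of \<open>b\<close> dependent on lower ones.\<close>

lemma card_powspan: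
  assumes "\<And>j. j < l \<Longrightarrow> b ^ j \<notin> powspan b j"
  shows "card (powspan b l) = 2 ^ l"
proof -
  have "inj_on (powsum b) (Pow {..<l})"
  proof (rule inj_onI, rule ccontr)
    fix S T assume ST: "S \<in> Pow {..<l}" "T \<in> Pow {..<l}" "powsum b S = powsum b T" "S \<noteq> T"
    define U where "U = sym_diff S T"
    have fin: "finite S" "finite T" using ST finite_subset[of _ "{..<l}"] by auto
    have "powsum b U = 0" unfolding U_def using powsum_sym_diff[OF fin] ST(3) add_self by simp
    have U: "finite U" "U \<noteq> {}" "U \<subseteq> {..<l}" unfolding U_def using fin ST by auto
    define j where "j = Max U"
    have j: "j \<in> U" using U unfolding j_def by simp
    have "powsum b U = b ^ j + powsum b (U - {j})"
      unfolding powsum_def using U j by (simp add: sum.remove)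
    then have "b ^ j = powsum b (U - {j})" using \<open>powsum b U = 0\<close> add_eq_0 by metis
    moreover have "U - {j} \<subseteq> {..<j}" using U unfolding j_def by (auto simp: le_neq_trans)
    ultimately have "b ^ j \<in> powspan b j" unfolding powspan_def by auto
    then show False using assms j U by auto
  qed
  then show ?thesis unfolding powspan_def by (simp add: card_image card_Pow)
qed

text \<open>For the least \<open>l\<close> with \<open>b ^ l\<close> in the span of the lower
  powers, that span has exactly \<open>2 ^ l\<close> elements and is closed under multiplication by
  \<open>b\<close>. This multiplication permutes the nonzero elements, so comparing their products
  gives \<open>b ^ (2 ^ l - 1) = 1\<close>, without showing first that the span is a field.\<close>

lemma powspan_dependent:
  assumes "b \<noteq> 0" "j < m" "b ^ j \<in> powspan b j"
  shows "\<exists>l. 1 \<le> l \<and> l < m \<and> b ^ (2 ^ l - 1) = 1"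
proof -
  define l where "l = (LEAST l. b ^ l \<in> powspan b l)"
  have l: "b ^ l \<in> powspan b l" unfolding l_def using assms(3) by (rule LeastI)
  have "l < m" using assms(2,3) unfolding l_def by (meson Least_le order_le_less_trans)
  have "\<And>j. j < l \<Longrightarrow> b ^ j \<notin> powspan b j" unfolding l_def by (rule not_less_Least)
  then have card: "card (powspan b l) = 2 ^ l" by (rule card_powspan)
  then have fin: "finite (powspan b l)" by (metis card.infinite power_not_zero zero_neq_numeral)
  have "l \<noteq> 0" using l unfolding powspan_def powsum_def by (cases "l = 0") auto
  let ?R = "powspan b l - {0}"
  have inj: "inj_on ((*) b) ?R" using assms(1) by (auto intro: inj_onI)
  have "(*) b ` ?R \<subseteq> ?R" using powspan_mult[OF l] assms(1) by auto
  then have im: "(*) b ` ?R = ?R" using inj fin by (metis endo_inj_surj finite_Diff)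
  have "(\<Prod>x\<in>?R. x) = (\<Prod>x\<in>?R. b * x)"
    using prod.reindex[OF inj, of "\<lambda>x. x"] unfolding im by simp
  also have "\<dots> = b ^ card ?R * (\<Prod>x\<in>?R. x)" by (simp add: prod.distrib)
  finally have "b ^ card ?R = 1" using fin by auto
  moreover have "card ?R = 2 ^ l - 1" using card fin powspan_closed(1)[of b l] by (simp add: card_Diff_singleton)
  ultimately show ?thesis using \<open>l \<noteq> 0\<close> \<open>l < m\<close> by (intro exI[of _ l]) auto
qed

text \<open>Euclid's algorithm by subtraction, carried out on the exponents: the intersection of two
  of the fields is the field belonging to the gcd.\<close>

lemma power_frob_gcd:
  "(b::'a) ^ 2 ^ l = b \<Longrightarrow> b ^ 2 ^ m = b \<Longrightarrow> b ^ 2 ^ gcd l m = b"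
proof (induction "l + m" arbitrary: l m rule: less_induct)
  case less
  have sub: "b ^ 2 ^ (q - p) = b" if "p \<le> q" "b ^ 2 ^ p = b" "b ^ 2 ^ q = b" for p q
  proof -
    have "b ^ 2 ^ q = (b ^ 2 ^ p) ^ 2 ^ (q - p)"
      using that(1) by (simp flip: power_mult power_add)
    then show ?thesis using that by simp
  qed
  consider "l = 0 \<or> m = 0" | "0 < l" "l \<le> m" | "0 < m" "m \<le> l" by linarith
  then show ?case
  proof cases
    case 1
    then show ?thesis using less.prems by auto
  next
    case 2
    then have "b ^ 2 ^ gcd l (m - l) = b" using less sub[of l m] by (intro less.hyps) auto
    then show ?thesis using 2 by (metis gcd.commute gcd_diff1_nat)
  next
    case 3
    then have "b ^ 2 ^ gcd (l - m) m = b" using less sub[of m l] by (intro less.hyps) auto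
    then show ?thesis using 3 by (metis gcd_diff1_nat)
  qed
qed

text \<open>Cyclicity of the multiplicative group. The order of the generator is recorded as a lower
  bound for every positive exponent \<open>i\<close> with \<open>x ^ i = 1\<close>, the form in
  which it is used.\<close>

lemma primitive_root_exists:
  assumes "m \<ge> 1"
  shows "\<exists>x \<in> frob_fixed m. (x::'a) \<noteq> 0 \<and> (\<forall>i>0. x ^ i = 1 \<longrightarrow> 2 ^ m - 1 \<le> i)"
proof -
  let ?F = "frob_fixed m :: 'a set"
  \<comment> \<open>The fixed set is packaged as a ring with explicit carrier, the setting of the
    generator theorem for finite fields.\<close>
  define R :: "'a ring" where "R = \<lparr>carrier = ?F, monoid.mult = (*), one = 1, ring.zero = 0, add = (+)\<rparr>"
  have R: "carrier R = ?F" "mult R = (*)" "one R = 1" "ring.zero R = 0" "add R = (+)"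
    unfolding R_def by simp_all
  have "abelian_group R"
  proof (rule abelian_groupI)
    fix x assume "x \<in> carrier R"
    then show "\<exists>y\<in>carrier R. y \<oplus>\<^bsub>R\<^esub> x = \<zero>\<^bsub>R\<^esub>"
      unfolding R using add_self by blast
  qed (auto simp: R frob_fixed_closed add_ac)
  moreover have "Group.comm_monoid R"
    by (rule comm_monoidI) (auto simp: R frob_fixed_closed mult_ac)
  ultimately have "cring R" by (rule cringI) (auto simp: R algebra_simps)
  then interpret cring R .
  have "field R"
  proof (rule cring_fieldI2)
    fix a assume a: "a \<in> carrier R" "a \<noteq> \<zero>\<^bsub>R\<^esub>"
    then show "\<exists>b\<in>carrier R. a \<otimes>\<^bsub>R\<^esub> b = \<one>\<^bsub>R\<^esub>"
      unfolding R using frob_fixed_closed(5)[of a m] by (intro bexI[of _ "inverse a"]) auto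
  qed (simp add: R)
  then interpret field R .
  have pow: "a [^]\<^bsub>R\<^esub> (i::nat) = a ^ i" for a :: 'a and i
    by (induction i) (simp_all add: R)
  obtain x where x: "x \<in> carrier (mult_of R)" "carrier (mult_of R) = {x [^]\<^bsub>R\<^esub> i | i :: nat. i \<in> UNIV}"
    using finite_field_mult_group_has_gen card_frob_fixed(1)[OF assms] R(1) by auto
  then have x: "x \<in> ?F" "x \<noteq> 0" "?F - {0} = range (\<lambda>i. x ^ i)"
    by (auto simp: R pow)
  have "2 ^ m - 1 \<le> i" if i: "i > 0" "x ^ i = 1" for i
  proof -
    have "x ^ j = x ^ (j mod i)" for j
      by (metis div_mult_mod_eq i(2) mult.commute mult_1 power_add power_mult power_one)
    then have "?F - {0} \<subseteq> (\<lambda>j. x ^ j) ` {..<i}"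
      unfolding x(3) using i(1) by (metis (no_types, lifting) image_subset_iff image_eqI lessThan_iff mod_less_divisor)
    then have "card (?F - {0}) \<le> i" by (metis card_lessThan finite_lessThan surj_card_le)
    then show ?thesis using card_frob_fixed[OF assms] frob_fixed_closed(1) by (simp add: card_Diff_singleton)
  qed
  then show ?thesis using x by blast
qed

section \<open>The trace form\<close>

definition trace :: "nat \<Rightarrow> 'a \<Rightarrow> 'a" where
  "trace m y = (\<Sum>i<m. y ^ 2 ^ i)"

lemma trace_add: "trace m (x + y) = trace m x + trace m y"
  unfolding trace_def by (simp add: frob_add sum.distrib)

lemma trace_0: "trace m 0 = 0"
  unfolding trace_def by (simp add: zero_power)

lemma trace_sum: "trace m (sum f T) = (\<Sum>t\<in>T. trace m (f t))"
  by (induction T rule: infinite_finite_induct) (simp_all add: trace_0 trace_add)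

text \<open>Squaring permutes the conjugates \<open>x ^ 2 ^ i\<close> cyclically, so the trace
  equals its own square.\<close>

lemma trace_01:
  assumes "x \<in> frob_fixed m"
  shows "trace m x = 0 \<or> trace m x = 1"
proof -
  have "trace m x ^ 2 = (\<Sum>i<m. (x ^ 2 ^ i) ^ 2)"
    unfolding trace_def using frob_sum[of "\<lambda>i. x ^ 2 ^ i" "{..<m}" 1] by simp
  also have "\<dots> = (\<Sum>i<m. x ^ 2 ^ Suc i)" by (simp add: mult.commute flip: power_mult)
  also have "\<dots> + x = trace m x + x"
    using sum.lessThan_Suc_shift[of "\<lambda>i. x ^ 2 ^ i" m] sum.lessThan_Suc[of "\<lambda>i. x ^ 2 ^ i" m] assms
    unfolding trace_def frob_fixed_def by (simp add: add.commute)
  finally have "trace m x * (trace m x - 1) = 0" by (simp add: power2_eq_square algebra_simps)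
  then show ?thesis by simp
qed

text \<open>As a polynomial the trace has degree at most \<open>2 ^ (m - 1)\<close>, too small to
  vanish at \<open>2 ^ m\<close> points.\<close>

lemma trace_nonzero:
  assumes "m \<ge> 1"
  shows "\<exists>x \<in> frob_fixed m. trace m x \<noteq> 0"
proof (rule ccontr)
  assume neg: "\<not> ?thesis"
  define p :: "'a poly" where "p = (\<Sum>i<m. Polynomial.monom 1 (2 ^ i))"
  have poly: "poly p x = trace m x" for x
    unfolding p_def trace_def by (simp add: poly_sum poly_monom)
  have "Polynomial.coeff p (2 ^ 0) = (\<Sum>i<m. if i = 0 then 1 else 0)"
    unfolding p_def by (simp add: coeff_sum)
  also have "\<dots> = 1" using assms by simp
  finally have p0: "p \<noteq> 0" by auto
  have "Polynomial.degree p \<le> 2 ^ (m - 1)"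
    unfolding p_def using assms by (intro degree_sum_le) (auto simp: degree_monom_eq)
  then have "card {x. poly p x = 0} \<le> 2 ^ (m - 1)" using card_poly_roots_bound[OF p0] by linarith
  moreover have "frob_fixed m \<subseteq> {x. poly p x = 0}" using neg poly by auto
  then have "card (frob_fixed m :: 'a set) \<le> card {x. poly p x = 0}"
    using poly_roots_finite[OF p0] by (rule card_mono[rotated])
  ultimately have "(2::nat) ^ m \<le> 2 ^ (m - 1)" using card_frob_fixed(2)[OF assms] by linarith
  then show False using assms by (simp add: power_increasing_iff)
qed

text \<open>Nondegeneracy of the trace form: if \<open>u\<close> were nonzero, every element of the
  field would be \<open>u\<close> times a combination of the powers of \<open>b\<close>, and the
  trace would be zero everywhere.\<close>

lemma trace_span:
  assumes m: "m \<ge> 1" and u: "u \<in> frob_fixed m" and b: "powspan b m = frob_fixed m"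
    and tr: "\<And>j. j < m \<Longrightarrow> trace m (u * b ^ j) = 0"
  shows "u = 0"
proof (rule ccontr)
  assume "u \<noteq> 0"
  obtain x where x: "x \<in> frob_fixed m" "trace m x \<noteq> 0" using trace_nonzero[OF m] by blast
  have "inverse u * x \<in> powspan b m" unfolding b using u x by (intro frob_fixed_closed)
  then obtain T where T: "T \<subseteq> {..<m}" "inverse u * x = powsum b T" unfolding powspan_def by auto
  have "x = u * powsum b T" unfolding T(2)[symmetric] using \<open>u \<noteq> 0\<close> by simp
  then have "trace m x = (\<Sum>j\<in>T. trace m (u * b ^ j))"
    unfolding powsum_def by (simp add: sum_distrib_left trace_sum)
  also have "\<dots> = 0" using T(1) tr by (intro sum.neutral) auto
  finally show False using x by simp
qed

text \<open>A dependence among the first \<open>m\<close> powers yields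
  \<open>b ^ (2 ^ l - 1) = 1\<close> with \<open>l < m\<close>, which places \<open>b\<close> in the
  subfield of degree \<open>gcd l m\<close>, a proper divisor of \<open>m\<close>.\<close>

lemma powspan_eq:
  assumes "m \<ge> 1" "b \<in> frob_fixed m" "b \<noteq> 0"
    and "\<And>g. g dvd m \<Longrightarrow> g < m \<Longrightarrow> b ^ (2 ^ g - 1) \<noteq> 1"
  shows "powspan b m = frob_fixed m"
proof -
  have "b ^ j \<notin> powspan b j" if "j < m" for j
  proof
    assume "b ^ j \<in> powspan b j"
    from powspan_dependent[OF assms(3) that this] obtain l where
      l: "1 \<le> l" "l < m" "b ^ (2 ^ l - 1) = 1" by blast
    have pw: "b ^ 2 ^ i = b * b ^ (2 ^ i - 1)" for i
      by (metis Suc_pred' power_Suc zero_less_numeral zero_less_power)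
    have "b ^ 2 ^ gcd l m = b"
      using pw[of l] l(3) assms(2) by (intro power_frob_gcd) (auto simp: frob_fixed_def)
    then have "b ^ (2 ^ gcd l m - 1) = 1" using pw[of "gcd l m"] assms(3) by simp
    moreover have "gcd l m < m" using gcd_le1_nat[of l m] l by linarith
    ultimately show False using assms(4)[of "gcd l m"] by simp
  qed
  then have "card (powspan b m) = 2 ^ m" by (rule card_powspan)
  moreover have "powspan b m \<subseteq> frob_fixed m"
  proof
    fix x assume "x \<in> powspan b m"
    then obtain T where "x = powsum b T" unfolding powspan_def by auto
    moreover have "powsum b T \<in> frob_fixed m"
      unfolding powsum_def using assms(2)
      by (induction T rule: infinite_finite_induct) (auto intro: frob_fixed_closed)
    ultimately show "x \<in> frob_fixed m" by simp
  qed
  ultimately show ?thesis using card_frob_fixed[OF assms(1)] by (metis card_subset_eq)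
qed

text \<open>By nondegeneracy the map \<phi> is injective. It goes from a set of \<open>2 ^ m\<close>
  elements into the \<open>2 ^ m\<close> subsets of \<open>{..<m}\<close>, so it reaches
  \<open>{m - 1}\<close>.\<close>

lemma impulse_exists:
  assumes m: "m \<ge> 1" and x: "powspan x m = frob_fixed m" "x \<in> frob_fixed m"
  shows "\<exists>y \<in> frob_fixed m. \<forall>i<m. trace m (x ^ i * y) = (if i = m - 1 then 1 else 0)"
proof -
  let ?F = "frob_fixed m :: 'a set"
  define \<phi> where "\<phi> y = {i. i < m \<and> trace m (x ^ i * y) = 1}" for y
  have "inj_on \<phi> ?F"
  proof (rule inj_onI)
    fix y z assume yz: "y \<in> ?F" "z \<in> ?F" "\<phi> y = \<phi> z"
    have tr: "trace m ((y + z) * x ^ i) = 0" if "i < m" for i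
    proof -
      have "trace m (x ^ i * y) = 1 \<longleftrightarrow> trace m (x ^ i * z) = 1" using yz(3) that unfolding \<phi>_def by auto
      then have "trace m (x ^ i * y) = trace m (x ^ i * z)"
        using trace_01 yz x(2) by (metis frob_fixed_closed(4,6))
      then show ?thesis by (simp add: distrib_right trace_add mult.commute add_self)
    qed
    have "y + z = 0"
      by (rule trace_span[OF m _ x(1) tr]) (use yz in \<open>auto intro: frob_fixed_closed(3)\<close>)
    then show "y = z" using add_eq_0 by blast
  qed
  moreover have "\<phi> ` ?F \<subseteq> Pow {..<m}" unfolding \<phi>_def by auto
  moreover have "card (Pow {..<m}) = card ?F" using card_frob_fixed(2)[OF m] by (simp add: card_Pow)
  ultimately have "\<phi> ` ?F = Pow {..<m}" by (metis card_image card_subset_eq finite_Pow_iff finite_lessThan)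
  moreover have "{m - 1} \<in> Pow {..<m}" using m by auto
  ultimately obtain y where y: "y \<in> ?F" "\<phi> y = {m - 1}" by (metis imageE)
  have "trace m (x ^ i * y) = (if i = m - 1 then 1 else 0)" if "i < m" for i
    using y(2) that trace_01[of "x ^ i * y" m] frob_fixed_closed(4,6) x(2) y(1) unfolding \<phi>_def by auto
  then show ?thesis using y(1) by blast
qed

text \<open>
  With \<open>y\<close> as in the previous lemma, $v \mapsto \mathrm{Tr}(x^{v+m-2} y)$ is 1 at $v = 1$ and 0 at the
  $m - 1$ arguments before, so it is \<open>recseq f\<close> for the coefficients \<open>f\<close> of its recurrence.
\<close>

lemma trace_coloring:
  assumes m: "m \<ge> 1" "m < k" and G: "G \<ge> 1" "\<And>g. g dvd m \<Longrightarrow> g < m \<Longrightarrow> g \<le> G"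
    and n: "n * 2 ^ G < 2 ^ m"
  shows "\<exists>f. (\<forall>j. f j < 2) \<and> (\<forall>j>m. f j = 0) \<and> proper_coloring k n (recseq f)"
proof -
  obtain x :: 'a where x: "x \<in> frob_fixed m" "x \<noteq> 0" "\<And>i. i > 0 \<Longrightarrow> x ^ i = 1 \<Longrightarrow> 2 ^ m - 1 \<le> i"
    using primitive_root_exists[OF m(1)] by blast
  \<comment> \<open>If \<open>(x ^ d) ^ (2 ^ g - 1)\<close> were 1, the order of \<open>x\<close>
    would give \<open>2 ^ m - 1 <= d * (2 ^ g - 1)\<close>, which contradicts
    \<open>d * 2 ^ G < 2 ^ m\<close>.\<close>
  have span: "powspan (x ^ d) m = frob_fixed m" if d: "d \<ge> 1" "d * 2 ^ G < 2 ^ m" for d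
  proof (rule powspan_eq[OF m(1)])
    fix g assume g: "g dvd m" "g < m"
    then have "g \<ge> 1" by (metis One_nat_def Suc_leI dvd_0_left gr0I less_nat_zero_code)
    show "(x ^ d) ^ (2 ^ g - 1) \<noteq> 1"
    proof
      assume "(x ^ d) ^ (2 ^ g - 1) = 1"
      moreover have "(2::nat) ^ 1 \<le> 2 ^ g" using \<open>g \<ge> 1\<close> by (intro power_increasing) auto
      ultimately have "2 ^ m - 1 \<le> d * (2 ^ g - 1)"
        using x(3)[of "d * (2 ^ g - 1)"] d(1) by (simp add: power_mult)
      also have "\<dots> = d * 2 ^ g - d" by (simp add: diff_mult_distrib2)
      finally have "2 ^ m - 1 \<le> d * 2 ^ g - d" .
      moreover have "d * 2 ^ g \<le> d * 2 ^ G"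
        using G(2)[OF g] by (intro mult_le_mono2 power_increasing) auto
      moreover have "d * 1 \<le> d * 2 ^ g" by (intro mult_le_mono2) simp
      ultimately show False using d by linarith
    qed
  qed (use x in \<open>auto intro: frob_fixed_closed\<close>)
  show ?thesis
  proof (cases "n = 0")
    case True
    then show ?thesis using m
      by (intro exI[of _ "\<lambda>_. 0"]) (auto simp: proper_coloring_def two_coloring_def has_mono_AP_def is_AP_def)
  next
    case n0: False
    have "1 * 2 ^ G \<le> n * 2 ^ G" using n0 by (intro mult_le_mono1) simp
    then have "1 * 2 ^ G < (2::nat) ^ m" using n by linarith
    then have span_x: "powspan x m = frob_fixed m" using span[of 1] by simp
    obtain y where y: "y \<in> frob_fixed m" "\<And>i. i < m \<Longrightarrow> trace m (x ^ i * y) = (if i = m - 1 then 1 else 0)"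
      using impulse_exists[OF m(1) span_x x(1)] by blast
    define t where "t i = trace m (x ^ i * y)" for i
    have t01: "t i = 0 \<or> t i = 1" for i
      unfolding t_def using x(1) y(1) by (intro trace_01 frob_fixed_closed)
    have "x ^ m \<in> powspan x m" unfolding span_x using x(1) by (rule frob_fixed_closed)
    then obtain T where T: "T \<subseteq> {..<m}" "x ^ m = powsum x T" unfolding powspan_def by auto
    have rec: "t (m + i) = (\<Sum>j\<in>T. t (j + i))" for i
    proof -
      have "x ^ (m + i) * y = (\<Sum>j\<in>T. x ^ (j + i) * y)"
        unfolding power_add T(2) powsum_def by (simp add: sum_distrib_right power_add)
      then show ?thesis unfolding t_def by (simp add: trace_sum)
    qed
    \<comment> \<open>The first \<open>m\<close> values of \<open>t\<close> contain a single 1, at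
      index \<open>m - 1\<close>; the shift by \<open>m - 2\<close> moves it to the argument
      1.\<close>
    define r :: "nat \<Rightarrow> nat" where "r v = (if t (v + m - 2) = 1 then 1 else 0)" for v
    \<comment> \<open>\<open>T\<close> holds the exponents in the expression of \<open>x ^ m\<close>
      by lower powers; going back by \<open>j\<close> corresponds to the exponent
      \<open>m - j\<close>.\<close>
    define f :: "nat \<Rightarrow> nat" where "f j = (if 1 \<le> j \<and> j \<le> m \<and> m - j \<in> T then 1 else 0)" for j
    have r: "of_nat (r v) = t (v + m - 2)" for v unfolding r_def using t01[of "v + m - 2"] by auto
    have r1: "r 1 = 1" unfolding r_def t_def using y(2)[of "m - 1"] m(1) by (simp add: Suc_diff_le)
    have rrec: "r v = (\<Sum>j\<in>{1..<v}. f j * r (v - j)) mod 2" if v: "2 \<le> v" for v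
    proof -
      define s where "s j = t (m - j + (v - 2))" for j
      let ?g = "\<lambda>j. of_nat (f j) * s j :: 'a"
      have "t (v + m - 2) = t (m + (v - 2))" using v by (simp add: add.commute)
      also have "\<dots> = (\<Sum>i\<in>T. s (m - i))"
      proof -
        have "s (m - i) = t (i + (v - 2))" if "i \<in> T" for i
        proof -
          have "m - (m - i) = i" using that T(1) by auto
          then show ?thesis unfolding s_def by (simp only:)
        qed
        then show ?thesis unfolding rec by simp
      qed
      also have "\<dots> = (\<Sum>j\<in>(\<lambda>i. m - i) ` T. s j)"
        using T(1) by (subst sum.reindex) (auto intro!: inj_onI)
      also have "\<dots> = (\<Sum>j\<in>{1..m}. ?g j)"
        using T(1) by (intro sum.mono_neutral_cong_left) (force simp: f_def image_iff)+
      \<comment> \<open>The recurrence of \<open>t\<close> reaches back \<open>m\<close> places,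
        that of \<open>recseq\<close> only to the argument 1. The range is enlarged and then cut:
        indices above \<open>m\<close> have coefficient 0, and indices from \<open>v\<close> to
        \<open>m\<close> meet the zeros of \<open>t\<close> before the impulse.\<close>
      also have "\<dots> = (\<Sum>j\<in>{1..<v + m}. ?g j)"
        using v by (intro sum.mono_neutral_left) (auto simp: f_def)
      also have "\<dots> = (\<Sum>j\<in>{1..<v}. ?g j)"
      proof (intro sum.mono_neutral_right ballI)
        fix j assume j: "j \<in> {1..<v + m} - {1..<v}"
        show "?g j = 0"
        proof (cases "j \<le> m")
          case True
          then have "m - j + (v - 2) < m" "m - j + (v - 2) \<noteq> m - 1" using j v m(1) by auto
          then show ?thesis unfolding s_def t_def using y(2) by simp
        qed (simp add: f_def)
      qed auto
      also have "\<dots> = (\<Sum>j\<in>{1..<v}. of_nat (f j * r (v - j)))"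
      proof (intro sum.cong refl)
        fix j assume j: "j \<in> {1..<v}"
        have "m - j + (v - 2) = v - j + m - 2" if "j \<le> m" using that j by auto
        then show "?g j = of_nat (f j * r (v - j))"
          unfolding of_nat_mult r s_def by (cases "j \<le> m") (auto simp: f_def)
      qed
      finally have *: "of_nat (r v) = (of_nat (\<Sum>j\<in>{1..<v}. f j * r (v - j)) :: 'a)" by (simp add: r)
      let ?S = "\<Sum>j\<in>{1..<v}. f j * r (v - j)"
      have "of_nat (r v + ?S) = (0 :: 'a)" unfolding of_nat_add * by (rule add_self)
      then have "even (r v + ?S)" by (simp only: of_nat_eq_0_iff_char_dvd char2)
      moreover have "r v < 2" by (simp add: r_def)
      ultimately show ?thesis by presburger
    qed
    have rs: "recseq f v = r v" if "v \<ge> 1" for v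
      using recseq_unique[of r v f v] r1 rrec that by auto
    have "\<not> has_mono_AP k n (recseq f)"
    proof
      assume "has_mono_AP k n (recseq f)"
      then obtain a d w where ad: "0 < a" "0 < d" "{a + i * d | i. i < k} \<subseteq> {1..n}"
        "\<And>i. i < k \<Longrightarrow> recseq f (a + i * d) = w"
        unfolding has_mono_AP_def is_AP_def monochromatic_def by blast
      have "k - 1 < k" using m by simp
      then have "a + (k - 1) * d \<in> {a + i * d | i. i < k}" by blast
      then have "a + (k - 1) * d \<le> n" using ad(3) by auto
      moreover have "1 * d \<le> (k - 1) * d" using m by (intro mult_le_mono1) simp
      ultimately have "d \<le> n" by linarith
      then have "d * 2 ^ G < 2 ^ m" using n by (meson le_less_trans mult_le_mono1)
      then have sp: "powspan (x ^ d) m = frob_fixed m" using span ad(2) by simp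
      have "2 * d < 2 ^ m"
      proof -
        have "(2::nat) ^ 1 \<le> 2 ^ G" using G(1) by (intro power_increasing) auto
        then have "2 * d \<le> d * 2 ^ G" by simp
        then show ?thesis using \<open>d * 2 ^ G < 2 ^ m\<close> by linarith
      qed
      then have xd: "x ^ d \<noteq> 1" using x(3)[of d] ad(2) by auto
      \<comment> \<open>Equal colors of neighboring terms make the trace vanish at \<open>u\<close>
        times a power of \<open>x ^ d\<close>. Having \<open>m\<close> such pairs takes
        \<open>m + 1\<close> terms, hence \<open>m < k\<close>.\<close>
      define u where "u = y * x ^ (a + m - 2) * (x ^ d + 1)"
      have "u = 0"
      proof (rule trace_span[OF m(1) _ sp])
        show "u \<in> frob_fixed m" unfolding u_def using x(1) y(1) by (intro frob_fixed_closed)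
        fix j assume j: "j < m"
        have am: "a + m \<ge> 2" using ad(1) m(1) by linarith
        have "t (a + i * d + m - 2) = of_nat w" if "i < k" for i
          using ad(4)[OF that] rs[of "a + i * d"] ad(1) r[of "a + i * d"] by simp
        from this[of j] this[of "Suc j"] have "t (a + j * d + m - 2) + t (a + Suc j * d + m - 2) = 0"
          using j m(2) add_self by simp
        moreover have "x ^ (a + j * d + m - 2) * y + x ^ (a + Suc j * d + m - 2) * y = u * (x ^ d) ^ j"
        proof -
          have e: "a + j * d + m - 2 = (a + m - 2) + d * j" "a + Suc j * d + m - 2 = (a + m - 2) + d * j + d"
            using am by (simp_all add: mult.commute)
          show ?thesis unfolding e u_def power_add power_mult by (simp add: algebra_simps)
        qed
        ultimately show "trace m (u * (x ^ d) ^ j) = 0" unfolding t_def by (metis trace_add)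
      qed
      then have "y = 0" unfolding u_def using x(2) xd add_eq_0 by auto
      then show False using y(2)[of "m - 1"] m(1) by (simp add: trace_0)
    qed
    then have "proper_coloring k n (recseq f)" unfolding proper_coloring_def using two_coloring_recseq by blast
    moreover have "f j < 2" "j > m \<Longrightarrow> f j = 0" for j unfolding f_def by auto
    ultimately show ?thesis by blast
  qed
qed

end

section \<open>From the fields to seeds, and the choice of the degree\<close>

lemma seed_coloring:
  assumes "m \<ge> 1" "m < k" "G \<ge> 1" "\<And>g. g dvd m \<Longrightarrow> g < m \<Longrightarrow> g \<le> G" "n * 2 ^ G < 2 ^ m"
  shows "\<exists>z < 2 ^ m. proper_coloring k n (recseq (seed z))"
proof -
  have "of_nat 2 = (0 :: bit)" by simp
  then have "CHAR(bit) dvd 2" by (simp only: of_nat_eq_0_iff_char_dvd)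
  then have "CHAR(bit) \<le> 2" "CHAR(bit) \<noteq> 0" by (auto dest: dvd_imp_le intro!: Nat.gr0I)
  moreover have "CHAR(bit) \<noteq> 1" using CHAR_not_1'[where 'a = bit] by simp
  ultimately have "CHAR(bit) = 2" by linarith
  \<comment> \<open>The algebraic closure of \<open>bit\<close> supplies the one type that contains
    all the finite fields in question.\<close>
  then have "CHAR(bit alg_closure) = 2" by simp
  from trace_coloring[OF this assms] obtain f where
    f: "\<And>j. f j < 2" "\<And>j. j > m \<Longrightarrow> f j = 0" "proper_coloring k n (recseq f)" by blast
  obtain z where "z < 2 ^ m" "\<And>v. recseq (seed z) v = recseq f v"
    using recseq_seed[of f m] f by blast
  then show ?thesis using f(3) by (metis ext)
qed

text \<open>A cofactor \<open>h <= C\<close> of \<open>g\<close> would divide \<open>fact C\<close>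
  and \<open>m\<close>, hence the remainder 1, so that \<open>h = 1\<close> and
  \<open>g = m\<close>. The cofactor therefore exceeds \<open>C\<close>.\<close>

lemma proper_divisor_le:
  assumes "m mod fact C = 1" "g dvd m" "g < m"
  shows "g \<le> m div C"
proof (cases "C = 0")
  case True
  then show ?thesis using assms by simp
next
  case False
  obtain h where h: "m = g * h" using assms(2) by (auto elim: dvdE)
  have "C < h"
  proof (rule ccontr)
    assume "\<not> C < h"
    moreover have "h \<noteq> 0" using h assms(3) by (intro notI) simp
    ultimately have "h dvd fact C" by (intro dvd_fact) auto
    moreover have "h dvd m" using h by simp
    ultimately have "h dvd m mod fact C" by (rule dvd_mod[rotated])
    then have "h = 1" using assms(1) by simp
    then show False using h assms(3) by simp
  qed
  then have "g * C \<le> m" unfolding h by simp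
  then show ?thesis using False by (simp add: less_eq_div_iff_mult_less_eq)
qed

lemma vdW_bound_le: "k \<ge> 1 \<Longrightarrow> vdW_bound \<epsilon> k \<le> 2 powr ((real k - 1) * (1 - \<epsilon>))"
proof -
  assume "k \<ge> 1"
  then have "1 * 1 \<le> exp 1 * real k" by (intro mult_mono) auto
  then show ?thesis unfolding vdW_bound_def by (simp add: divide_le_eq)
qed

lemma vdW_length_le_bound: "k \<ge> 1 \<Longrightarrow> real (vdW_length \<epsilon> k) \<le> vdW_bound \<epsilon> k"
proof -
  assume "k \<ge> 1"
  have "vdW_bound \<epsilon> k \<ge> 0" unfolding vdW_bound_def by simp
  then show ?thesis unfolding vdW_length_def by simp
qed

lemma proper_coloring_vdW_length:
  assumes "\<epsilon> > 0" "k \<ge> 1"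
  shows "\<exists>c. proper_coloring k (vdW_length \<epsilon> k) c"
proof (rule proper_coloring_exists[OF assms(2)])
  have "(2::real) powr ((real k - 1) * (1 - \<epsilon>)) \<le> 2 powr (real (k - 1))"
    using assms by (intro powr_mono) (auto simp: algebra_simps)
  then have "vdW_bound \<epsilon> k \<le> 2 ^ (k - 1) / (exp 1 * real k)"
    unfolding vdW_bound_def by (simp add: divide_right_mono powr_realpow)
  then show "real (vdW_length \<epsilon> k) \<le> 2 ^ (k - 1) / (exp 1 * real k)"
    using vdW_length_le_bound[OF assms(2), of \<epsilon>] by linarith
qed

text \<open>What has to hold is \<open>n * 2 ^ G < 2 ^ m\<close>. In the exponent, one half of
  \<epsilon> pays for \<open>G <= m * \<epsilon> / 2\<close>, the other half for the loss of at most
  \<open>Q\<close> in passing from \<open>k - 1\<close> to \<open>m\<close>, as soon as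
  \<open>k0\<close> exceeds \<open>2 * Q / \<epsilon>\<close>.\<close>

lemma large_k_seed:
  assumes e: "0 < \<epsilon>" "\<epsilon> < 1"
  shows "\<exists>k0. \<forall>k\<ge>k0. \<exists>z < 2 ^ k. proper_coloring k (vdW_length \<epsilon> k) (recseq (seed z))"
proof -
  obtain C :: nat where C: "2 / \<epsilon> < real C" using reals_Archimedean2 by blast
  have "2 < 2 / \<epsilon>" using e by (simp add: field_simps)
  then have C2: "C > 2" using C by linarith
  have C1: "1 / real C \<le> \<epsilon> / 2" using C C2 e by (simp add: field_simps)
  define Q :: nat where "Q = fact C"
  have Q1: "Q \<ge> 1" unfolding Q_def by simp
  obtain k0 :: nat where k0: "2 * real Q / \<epsilon> < real k0" using reals_Archimedean2 by blast
  show ?thesis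
  proof (rule exI[of _ "k0 + Q + C + 2"], intro allI impI)
    fix k assume k: "k \<ge> k0 + Q + C + 2"
    \<comment> \<open>The largest number below \<open>k\<close> that is 1 modulo
      \<open>Q\<close>.\<close>
    define m where "m = (k - 2) div Q * Q + 1"
    have "(k - 2) div Q * Q + (k - 2) mod Q = k - 2" by simp
    moreover have "(k - 2) mod Q < Q" using Q1 by simp
    ultimately have m: "m < k" "m + Q \<ge> k - 1" "m \<ge> C" "m \<ge> 1" using k unfolding m_def by linarith+
    define G where "G = m div C"
    have "G \<ge> 1" unfolding G_def using m(3) C2 by (simp add: div_greater_zero_iff Suc_leI)
    have "Q > 1" unfolding Q_def using C2 fact_mono_nat[of 2 C] by (simp add: numeral_2_eq_2)
    then have "m mod Q = 1" unfolding m_def by (subst mod_mult_self3) simp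
    then have div: "g \<le> G" if "g dvd m" "g < m" for g
      using proper_divisor_le[of m C g] that unfolding Q_def G_def by simp
    have "real G * real C \<le> real m" unfolding G_def
      by (metis div_times_less_eq_dividend of_nat_le_iff of_nat_mult)
    then have "real G \<le> real m * (1 / real C)" using C2 by (simp add: field_simps)
    also have "\<dots> \<le> real m * (\<epsilon> / 2)" using C1 by (intro mult_left_mono) auto
    finally have G: "real G \<le> real m * (\<epsilon> / 2)" .
    have "(real k - 1) * (1 - \<epsilon>) + real G < real m"
    proof -
      have kQ: "real m \<ge> real k - 1 - real Q" using m(2) k by linarith
      have "(real k - 1 - real Q) * (1 - \<epsilon> / 2) \<le> real m * (1 - \<epsilon> / 2)"
        using kQ e by (intro mult_right_mono) auto
      also have "\<dots> \<le> real m - real G" using G by (simp add: algebra_simps)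
      finally have 1: "(real k - 1 - real Q) * (1 - \<epsilon> / 2) \<le> real m - real G" .
      have "2 * real Q < \<epsilon> * real k0" using k0 e by (simp add: field_simps)
      also have "\<dots> \<le> \<epsilon> * (real k - 1)" using k e by (intro mult_left_mono) auto
      finally have "real Q < (real k - 1) * (\<epsilon> / 2)" by (simp add: mult.commute)
      moreover have "real Q * (1 - \<epsilon> / 2) \<le> real Q" using e by (simp add: mult_left_le)
      moreover have "(real k - 1 - real Q) * (1 - \<epsilon> / 2) =
          (real k - 1) * (1 - \<epsilon>) + (real k - 1) * (\<epsilon> / 2) - real Q * (1 - \<epsilon> / 2)"
        by (simp add: field_simps)
      ultimately show ?thesis using 1 by linarith
    qed
    then have "(2::real) powr ((real k - 1) * (1 - \<epsilon>) + real G) < 2 powr real m" by simp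
    then have "2 powr ((real k - 1) * (1 - \<epsilon>)) * 2 ^ G < (2::real) ^ m"
      by (simp add: powr_add powr_realpow)
    moreover have "real (vdW_length \<epsilon> k) \<le> 2 powr ((real k - 1) * (1 - \<epsilon>))"
      using vdW_length_le_bound[of k \<epsilon>] vdW_bound_le[of k \<epsilon>] k by linarith
    ultimately have "real (vdW_length \<epsilon> k) * 2 ^ G < 2 ^ m"
      by (meson le_less_trans mult_right_mono zero_le_numeral zero_le_power)
    then have "real (vdW_length \<epsilon> k * 2 ^ G) < real (2 ^ m)" by simp
    then have "vdW_length \<epsilon> k * 2 ^ G < 2 ^ m" unfolding of_nat_less_iff .
    from seed_coloring[OF m(4,1) \<open>G \<ge> 1\<close> div this] obtain z where
      "z < 2 ^ m" "proper_coloring k (vdW_length \<epsilon> k) (recseq (seed z))" by blast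
    moreover have "(2::nat) ^ m \<le> 2 ^ k" using m(1) by (intro power_increasing) auto
    ultimately show "\<exists>z < 2 ^ k. proper_coloring k (vdW_length \<epsilon> k) (recseq (seed z))"
      by (meson less_le_trans)
  qed
qed

lemma proper_coloring_cong:
  assumes "proper_coloring k n c" "\<And>v. v \<in> {1..n} \<Longrightarrow> c' v = c v"
  shows "proper_coloring k n c'"
proof -
  have "monochromatic c' S \<longleftrightarrow> monochromatic c S" if "S \<subseteq> {1..n}" for S
    unfolding monochromatic_def using assms(2) that by (metis subsetD)
  then show ?thesis using assms unfolding proper_coloring_def two_coloring_def has_mono_AP_def by auto
qed

text \<open>Swapping the two colors, if necessary, gives 1 the color 1.\<close>

lemma some_seed:
  assumes "proper_coloring k n c"
  shows "\<exists>z < 2 ^ n. proper_coloring k n (recseq (seed z))"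
proof -
  define r where "r v = (if c v = c 1 then 1 else 0 :: nat)" for v
  have "proper_coloring k n r"
  proof -
    have "\<not> monochromatic r S" if S: "S \<subseteq> {1..n}" "is_AP k S" for S
    proof
      assume "monochromatic r S"
      then obtain w where w: "\<forall>x\<in>S. r x = w" unfolding monochromatic_def by blast
      have c2: "c x = 0 \<or> c x = 1" if "x \<in> {1..n}" for x
        using assms that unfolding proper_coloring_def two_coloring_def by blast
      have "c x = c y" if "x \<in> S" "y \<in> S" for x y
      proof -
        have xy: "x \<in> {1..n}" "y \<in> {1..n}" using S(1) that by auto
        then have "1 \<in> {1..n}" by auto
        then have "c 1 = 0 \<or> c 1 = 1" "c x = 0 \<or> c x = 1" "c y = 0 \<or> c y = 1" using c2 xy by blast+
        moreover have "r x = r y" using w that by simp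
        then have "c x = c 1 \<longleftrightarrow> c y = c 1" unfolding r_def by (metis zero_neq_one)
        ultimately show ?thesis by metis
      qed
      then have "monochromatic c S" unfolding monochromatic_def by blast
      then show False using assms S unfolding proper_coloring_def has_mono_AP_def by blast
    qed
    then show ?thesis unfolding proper_coloring_def two_coloring_def has_mono_AP_def
      by (auto simp: r_def)
  qed
  moreover have "r 1 = 1" "\<And>v. v \<in> {1..n} \<Longrightarrow> r v < 2" unfolding r_def by auto
  from recseq_surj[of r n, OF this] obtain f where
    f: "\<And>j. f j < 2" "\<And>j. j \<ge> n \<Longrightarrow> f j = 0" "\<And>v. v \<in> {1..n} \<Longrightarrow> recseq f v = r v" by blast
  obtain z where "z < 2 ^ n" "\<And>v. recseq (seed z) v = recseq f v"
    using recseq_seed[of f n] f by force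
  ultimately show ?thesis using f(3) by (metis proper_coloring_cong)
qed

text \<open>Below the threshold \<open>k0\<close> the available bound for a seed is
  \<open>2 ^ n\<close>, with \<open>n\<close> the length; these finitely many lengths have a
  maximum, which goes into the constant \<open>c\<close>.\<close>

theorem seed_exists:
  assumes e: "0 < \<epsilon>" "\<epsilon> < 1"
  shows "\<exists>c. \<forall>k\<ge>1. \<exists>z < 2 ^ (c * k). proper_coloring k (vdW_length \<epsilon> k) (recseq (seed z))"
proof -
  obtain k0 where k0: "\<And>k. k \<ge> k0 \<Longrightarrow>
      \<exists>z < 2 ^ k. proper_coloring k (vdW_length \<epsilon> k) (recseq (seed z))"
    using large_k_seed[OF e] by blast
  define c where "c = Max (vdW_length \<epsilon> ` {..k0}) + 1"
  have "\<exists>z < 2 ^ (c * k). proper_coloring k (vdW_length \<epsilon> k) (recseq (seed z))" if k: "k \<ge> 1" for k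
  proof -
    define b where "b = (if k \<ge> k0 then k else vdW_length \<epsilon> k)"
    have "\<exists>z < 2 ^ b. proper_coloring k (vdW_length \<epsilon> k) (recseq (seed z))"
      using k0[of k] proper_coloring_vdW_length[OF e(1) k] some_seed unfolding b_def by auto
    moreover have "b \<le> c * k"
    proof (cases "k \<ge> k0")
      case False
      then have "vdW_length \<epsilon> k \<le> Max (vdW_length \<epsilon> ` {..k0})" by (intro Max_ge) auto
      then have "b \<le> c * 1" unfolding b_def c_def using False by (simp add: le_SucI)
      also have "\<dots> \<le> c * k" using k by (intro mult_le_mono2)
      finally show ?thesis .
    qed (simp add: b_def c_def)
    then have "(2::nat) ^ b \<le> 2 ^ (c * k)" by (intro power_increasing) auto
    ultimately show ?thesis by (meson less_le_trans)
  qed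
  then show ?thesis by blast
qed

section \<open>Comparing fractions with powers of e\<close>

text \<open>
  With \<open>P i = (\<Prod>s = n+1..2n. i - s)\<close>, the sum of \<open>P i * d ^ i / fact i\<close> over all \<open>i\<close>
  is \<open>A * exp d\<close>, over \<open>i \<le> n\<close> it is \<open>B\<close>, for integers \<open>A\<close> and \<open>B\<close>; the terms with
  \<open>n < i \<le> 2 * n\<close> vanish, and the remaining ones have a very small positive sum.
\<close>

definition exp_integral :: "nat \<Rightarrow> (nat \<Rightarrow> int) \<Rightarrow> bool" where
  "exp_integral d Q \<longleftrightarrow>
     (\<forall>m. \<exists>A::int. (\<lambda>i. real_of_int (Q (i + m)) * real d ^ i / fact i) sums (of_int A * exp (real d)))"

lemma exp_sums: "(\<lambda>i. real d ^ i / fact i) sums exp (real d)"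
  using exp_converges[of "real d"] by (simp add: field_simps scaleR_conv_of_real)

lemma exp_integral_1: "exp_integral d (\<lambda>_. 1)"
  unfolding exp_integral_def using exp_sums[of d] by (auto intro!: exI[of _ 1])

text \<open>Cancelling a factor \<open>i\<close> against \<open>fact i\<close> turns the series with
  coefficients \<open>i * Q (i + m)\<close> into \<open>d\<close> times the one with coefficients
  \<open>Q (i + Suc m)\<close>. This is why \<open>exp_integral\<close> quantifies over all
  shifts.\<close>

lemma exp_integral_mult:
  assumes "exp_integral d Q"
  shows "exp_integral d (\<lambda>i. (int i - c) * Q i)"
  unfolding exp_integral_def
proof
  fix m
  obtain A A' where A: "(\<lambda>i. real_of_int (Q (i + m)) * real d ^ i / fact i) sums (of_int A * exp (real d))"
    and A': "(\<lambda>i. real_of_int (Q (i + Suc m)) * real d ^ i / fact i) sums (of_int A' * exp (real d))"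
    using assms unfolding exp_integral_def by meson
  define f where "f i = real i * real_of_int (Q (i + m)) * real d ^ i / fact i" for i
  have "f (Suc i) = real d * (real_of_int (Q (i + Suc m)) * real d ^ i / fact i)" for i
    unfolding f_def by (simp add: field_simps del: of_nat_Suc)
  then have "(\<lambda>i. f (Suc i)) sums (real d * (of_int A' * exp (real d)))"
    using sums_mult[OF A', of "real d"] by simp
  then have "f sums (real d * (of_int A' * exp (real d)) + f 0)" unfolding sums_Suc_iff .
  from sums_add[OF this sums_mult[OF A, of "real_of_int (int m - c)"]]
  have "(\<lambda>i. f i + real_of_int (int m - c) * (real_of_int (Q (i + m)) * real d ^ i / fact i)) sums
      (of_int (int d * A' + (int m - c) * A) * exp (real d))"
    by (simp add: f_def algebra_simps)
  moreover have "f i + real_of_int (int m - c) * (real_of_int (Q (i + m)) * real d ^ i / fact i) =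
      real_of_int ((int (i + m) - c) * Q (i + m)) * real d ^ i / fact i" for i
    unfolding f_def by (simp add: field_simps)
  ultimately have "(\<lambda>i. real_of_int ((int (i + m) - c) * Q (i + m)) * real d ^ i / fact i) sums
      (of_int (int d * A' + (int m - c) * A) * exp (real d))" by (simp only:)
  then show "\<exists>A. (\<lambda>i. real_of_int ((int (i + m) - c) * Q (i + m)) * real d ^ i / fact i) sums
      (of_int A * exp (real d))" by blast
qed

lemma exp_integral_prod:
  "finite S \<Longrightarrow> exp_integral d (\<lambda>i. \<Prod>s\<in>S. int i - int s)"
  by (induction S rule: finite_induct) (simp_all add: exp_integral_1 exp_integral_mult)

text \<open>Up to sign the product runs over \<open>n\<close> consecutive integers, hence is
  divisible by \<open>fact n\<close>. It follows that the terms of the series up to \<open>n\<close>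
  are integers.\<close>

lemma pade_prod_lower:
  assumes "i \<le> n"
  shows "fact i dvd (\<Prod>s\<in>{n+1..2*n}. int i - int s)"
proof -
  have "(\<Prod>s\<in>{n+1..2*n}. int i - int s) = (\<Prod>j<n. - (int (n - i) + 1 + int j))"
    using assms by (intro prod.reindex_bij_witness[of _ "\<lambda>j. n + 1 + j" "\<lambda>s. s - (n + 1)"]) auto
  also have "\<dots> = (- 1) ^ n * pochhammer (int (n - i) + 1) n"
    by (simp only: pochhammer_prod prod_uminus atLeast0LessThan card_lessThan)
  finally have eq: "(\<Prod>s\<in>{n+1..2*n}. int i - int s) = (- 1) ^ n * pochhammer (int (n - i) + 1) n" .
  have "(fact n :: int) dvd pochhammer (int (n - i) + 1) n" by (rule fact_dvd_pochhammer)
  moreover have "(fact i :: int) dvd fact n" using assms by (rule fact_dvd)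
  ultimately show ?thesis unfolding eq by (meson dvd_mult dvd_trans)
qed

text \<open>At \<open>2 * n + 1 + j\<close> the factors are \<open>j + 1, ..., j + n\<close>; all
  terms of the tail are therefore positive for positive \<open>d\<close>.\<close>

lemma pade_prod_upper: "(\<Prod>s\<in>{n+1..2*n}. int (2 * n + 1 + j) - int s) * fact j = fact (j + n)"
proof -
  have "(\<Prod>s\<in>{n+1..2*n}. int (2 * n + 1 + j) - int s) = (\<Prod>l\<in>{1..n}. int (j + l))"
    by (intro prod.reindex_bij_witness[of _ "\<lambda>l. 2 * n + 1 - l" "\<lambda>s. 2 * n + 1 - s"]) auto
  moreover have "(\<Prod>l\<in>{1..m}. int (j + l)) * fact j = fact (j + m)" for m
  proof (induction m)
    case (Suc m)
    have "(\<Prod>l\<in>{1..Suc m}. int (j + l)) * fact j = int (j + Suc m) * ((\<Prod>l\<in>{1..m}. int (j + l)) * fact j)"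
      by (simp add: mult_ac)
    then show ?case unfolding Suc.IH by simp
  qed simp
  ultimately show ?thesis by simp
qed

lemma fact_mult_le: "(fact a * fact b :: real) \<le> fact (a + b)"
proof -
  have "(fact a * fact b :: nat) \<le> fact (a + b)" by (rule dvd_imp_le) (auto intro: fact_fact_dvd_fact)
  then show ?thesis by (metis of_nat_fact of_nat_le_iff of_nat_mult)
qed

text \<open>Both bounds on \<delta> are used: the upper one makes \<open>q * \<delta>\<close> small,
  the lower one is what the truncation error of the exponential series has to stay below. The lower
  bound comes from the first term of the tail, the upper one from
  \<open>fact (j + n) * fact (n + 1) <= fact (2 * n + 1 + j)\<close>.\<close>

lemma pade_exp:
  assumes d: "d \<ge> 1" and n: "n \<ge> 1"
  shows "\<exists>A B :: int. \<exists>\<delta>. of_int A * exp (real d) = of_int B + \<delta> \<and> 1 / fact (2 * n + 1) \<le> \<delta> \<and>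
    \<delta> \<le> real d ^ (2 * n + 1) / fact (n + 1) * exp (real d) \<and> \<bar>real_of_int B\<bar> \<le> real (2 * n) ^ n * exp (real d)"
proof -
  define P where "P i = (\<Prod>s\<in>{n+1..2*n}. int i - int s)" for i
  define t where "t i = real_of_int (P i) * real d ^ i / fact i" for i
  obtain A :: int where A: "t sums (of_int A * exp (real d))"
  proof -
    have "exp_integral d P" unfolding P_def by (rule exp_integral_prod) simp
    then obtain A :: int where
      "(\<lambda>i. real_of_int (P (i + 0)) * real d ^ i / fact i) sums (of_int A * exp (real d))"
      unfolding exp_integral_def by blast
    then show ?thesis using that unfolding t_def by simp
  qed
  have "t i \<in> \<int>" if i: "i \<le> n" for i
  proof -
    obtain w where "P i = fact i * w" using pade_prod_lower[OF i] unfolding P_def by (auto elim: dvdE)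
    then have "t i = of_int (w * int d ^ i)" unfolding t_def by simp
    then show ?thesis by (simp only: Ints_of_int)
  qed
  then have "(\<Sum>i\<le>n. t i) \<in> \<int>" by (intro Ints_sum) auto
  then obtain B :: int where B: "(\<Sum>i\<le>n. t i) = of_int B" by (auto elim: Ints_cases)
  have "P i = 0" if "i \<in> {n+1..2*n}" for i
    unfolding P_def using that by (intro prod_zero) auto
  then have "(\<Sum>i<2 * n + 1. t i) = (\<Sum>i\<le>n. t i)"
    unfolding t_def by (intro sum.mono_neutral_right) auto
  then have tail: "(\<lambda>j. t (j + (2 * n + 1))) sums (of_int A * exp (real d) - of_int B)"
    using sums_split_initial_segment[OF A, of "2 * n + 1"] B by simp
  define \<delta> where "\<delta> = of_int A * exp (real d) - of_int B"
  have P: "real_of_int (P (2 * n + 1 + j)) * fact j = fact (j + n)" for j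
    using pade_prod_upper[of n j, THEN arg_cong[of _ _ real_of_int]] unfolding P_def
    by (simp only: of_int_mult of_int_fact)
  have tj: "t (j + (2 * n + 1)) = fact (j + n) / fact j * real d ^ (2 * n + 1 + j) / fact (2 * n + 1 + j)" for j
    unfolding t_def P[of j, symmetric] by (simp add: add.commute)
  have nonneg: "t (j + (2 * n + 1)) \<ge> 0" for j unfolding tj by simp
  have "1 / fact (2 * n + 1) \<le> t (0 + (2 * n + 1))"
  proof -
    have "1 \<le> real d ^ (2 * n + 1)" using d by (intro one_le_power) simp
    then have "1 * 1 \<le> fact n * real d ^ (2 * n + 1)" by (intro mult_mono fact_ge_1) auto
    then show ?thesis unfolding tj by (simp add: divide_right_mono del: power_Suc fact_Suc)
  qed
  also have "\<dots> \<le> \<delta>"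
    using sum_le_suminf[of "\<lambda>j. t (j + (2 * n + 1))" "{0}"] tail nonneg unfolding \<delta>_def
    by (auto simp: sums_iff)
  finally have lower: "1 / fact (2 * n + 1) \<le> \<delta>" .
  have "t (j + (2 * n + 1)) \<le> real d ^ (2 * n + 1) / fact (n + 1) * (real d ^ j / fact j)" for j
  proof -
    have "(fact (j + n) * fact (n + 1) :: real) \<le> fact (j + n + (n + 1))" by (rule fact_mult_le)
    then have "(fact (j + n) * fact (n + 1) :: real) \<le> fact (2 * n + 1 + j)"
      by (simp only: mult_2 add_ac)
    then have "(fact (j + n) :: real) / fact (2 * n + 1 + j) \<le> 1 / fact (n + 1)"
      by (simp add: field_simps del: fact_Suc)
    then have "fact (j + n) / fact (2 * n + 1 + j) * (real d ^ (2 * n + 1 + j) / fact j) \<le>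
        1 / fact (n + 1) * (real d ^ (2 * n + 1 + j) / fact j)" by (intro mult_right_mono) auto
    then show ?thesis unfolding tj by (simp add: power_add mult_ac)
  qed
  then have upper: "\<delta> \<le> real d ^ (2 * n + 1) / fact (n + 1) * exp (real d)"
    unfolding \<delta>_def using sums_le[OF _ tail sums_mult[OF exp_sums[of d]]] by blast
  have "\<bar>P i\<bar> \<le> int (2 * n) ^ n" if "i \<le> n" for i
  proof -
    have "\<bar>P i\<bar> = (\<Prod>s\<in>{n+1..2*n}. \<bar>int i - int s\<bar>)" unfolding P_def
      by (induction rule: infinite_finite_induct[where A = "{n+1..2*n}"]) (simp_all add: abs_mult)
    also have "\<dots> \<le> (\<Prod>s\<in>{n+1..2*n}. int (2 * n))" using that by (intro prod_mono) auto
    finally show ?thesis by simp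
  qed
  then have "\<bar>t i\<bar> \<le> real (2 * n) ^ n * (real d ^ i / fact i)" if "i \<le> n" for i
  proof -
    have "real_of_int \<bar>P i\<bar> \<le> real_of_int (int (2 * n) ^ n)"
      using that \<open>\<And>i. i \<le> n \<Longrightarrow> \<bar>P i\<bar> \<le> int (2 * n) ^ n\<close> by (simp only: of_int_le_iff)
    then have "\<bar>real_of_int (P i)\<bar> \<le> real (2 * n) ^ n" by simp
    then have "\<bar>real_of_int (P i)\<bar> * (real d ^ i / fact i) \<le> real (2 * n) ^ n * (real d ^ i / fact i)"
      by (intro mult_right_mono) auto
    then show ?thesis unfolding t_def by (simp add: abs_mult)
  qed
  then have "\<bar>real_of_int B\<bar> \<le> (\<Sum>i\<le>n. real (2 * n) ^ n * (real d ^ i / fact i))"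
    unfolding B[symmetric] by (intro order_trans[OF sum_abs sum_mono]) auto
  also have "\<dots> = real (2 * n) ^ n * (\<Sum>i\<le>n. real d ^ i / fact i)" by (simp add: sum_distrib_left)
  also have "\<dots> \<le> real (2 * n) ^ n * exp (real d)"
    using sum_le_suminf[of "\<lambda>i. real d ^ i / fact i" "{..n}"] exp_sums[of d]
    by (intro mult_left_mono) (auto simp: sums_iff)
  finally show ?thesis using lower upper
    by (intro exI[of _ A] exI[of _ B] exI[of _ \<delta>]) (auto simp: \<delta>_def)
qed

lemma exp_tail:
  "0 \<le> exp (real d) - (\<Sum>i\<le>J. real d ^ i / fact i)"
  "exp (real d) - (\<Sum>i\<le>J. real d ^ i / fact i) \<le> real d ^ (J + 1) / fact (J + 1) * exp (real d)"
proof -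
  have tail: "(\<lambda>j. real d ^ (j + (J + 1)) / fact (j + (J + 1))) sums (exp (real d) - (\<Sum>i\<le>J. real d ^ i / fact i))"
    using sums_split_initial_segment[OF exp_sums[of d], of "J + 1"] by (simp add: lessThan_Suc_atMost)
  show "0 \<le> exp (real d) - (\<Sum>i\<le>J. real d ^ i / fact i)"
    using suminf_nonneg[of "\<lambda>j. real d ^ (j + (J + 1)) / fact (j + (J + 1))"] tail by (auto simp: sums_iff)
  have "real d ^ (j + (J + 1)) / fact (j + (J + 1)) \<le> real d ^ (J + 1) / fact (J + 1) * (real d ^ j / fact j)" for j
  proof -
    have "real d ^ (j + (J + 1)) / fact (j + (J + 1)) \<le> real d ^ (j + (J + 1)) / (fact j * fact (J + 1))"
      using fact_mult_le[of j "J + 1"] by (intro divide_left_mono) auto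
    then show ?thesis by (simp add: power_add mult_ac)
  qed
  then show "exp (real d) - (\<Sum>i\<le>J. real d ^ i / fact i) \<le> real d ^ (J + 1) / fact (J + 1) * exp (real d)"
    by (rule sums_le[OF _ tail sums_mult[OF exp_sums[of d]]])
qed

lemma power_le_exp_fact: "real N ^ N \<le> exp (real N) * fact N"
proof -
  have "(\<Sum>i\<in>{N}. real N ^ i / fact i) \<le> (\<Sum>i. real N ^ i / fact i)"
    using exp_sums[of N] by (intro sum_le_suminf) (auto simp: sums_iff)
  also have "\<dots> = exp (real N)" using exp_sums[of N] by (simp add: sums_iff)
  finally show ?thesis by (simp add: field_simps)
qed

text \<open>The left side bounds \<open>A\<close> times the error of the truncated exponential
  series, the right side is the lower bound of \<delta>. From \<open>N ^ N <= exp N * fact N\<close>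
  and the first summand in the bound for \<open>N\<close> one gets
  \<open>fact N >= d ^ N * exp d * L ^ N\<close> with \<open>L = 2 * n + 1\<close>. The summand 3
  ensures \<open>N > 2 * L\<close>, and \<open>L ^ (2 * L)\<close> dominates the remaining
  factors.\<close>

lemma exp_comparison_aux:
  assumes n: "n \<ge> 1" and N: "real N \<ge> (real d * exp (1 + real d) + 3) * real (2 * n + 1)" and d: "d \<ge> 1"
  shows "(real (2 * n) ^ n + 1) * (real d ^ N / fact N * exp (real d)) < 1 / fact (2 * n + 1)"
proof -
  define L where "L = 2 * n + 1"
  have L: "L \<ge> 3" using n unfolding L_def by simp
  have "real N \<ge> real d * exp (1 + real d) * real L + 3 * real L"
    using N unfolding L_def distrib_right .
  moreover have "0 \<le> real d * exp (1 + real d) * real L" by simp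
  ultimately have N3: "real N \<ge> 3 * real L" by linarith
  then have NL: "N \<ge> 2 * L + 1" "N \<ge> 1" using L by linarith+
  have "real N \<ge> real d * exp 1 * exp (real d) * real L"
    using N unfolding L_def by (simp add: distrib_right exp_add mult.assoc)
  then have "(real d * exp 1 * exp (real d) * real L) ^ N \<le> real N ^ N" by (intro power_mono) auto
  also have "\<dots> \<le> exp (real N) * fact N" by (rule power_le_exp_fact)
  also have "exp (real N) = exp 1 ^ N" by (simp flip: exp_of_nat_mult)
  finally have "real d ^ N * exp (real d) ^ N * real L ^ N \<le> fact N"
    by (simp add: power_mult_distrib mult_ac)
  moreover have "exp (real d) ^ 1 \<le> exp (real d) ^ N" using NL by (intro power_increasing) auto
  then have "real d ^ N * exp (real d) ^ 1 * real L ^ N \<le> real d ^ N * exp (real d) ^ N * real L ^ N"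
    by (intro mult_right_mono mult_left_mono) auto
  ultimately have *: "real d ^ N * exp (real d) * real L ^ N \<le> fact N" by simp
  have "real L ^ (2 * L) < real L ^ N" using L NL by (intro power_strict_increasing) auto
  moreover have "(real (2 * n) ^ n + 1) * fact L \<le> real L ^ (2 * L)"
  proof -
    have "real (2 * n) ^ n + 1 \<le> real L ^ n"
    proof -
      have "(2 * n) ^ n < L ^ n" unfolding L_def using n by (intro power_strict_mono) auto
      then have "(2 * n) ^ n + 1 \<le> L ^ n" by simp
      then have "real ((2 * n) ^ n + 1) \<le> real (L ^ n)" unfolding of_nat_le_iff .
      then show ?thesis by simp
    qed
    moreover have "(fact L :: real) \<le> real L ^ L"
      using fact_le_power[of L, where 'a = real] by simp
    ultimately have "(real (2 * n) ^ n + 1) * fact L \<le> real L ^ n * real L ^ L"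
      by (intro mult_mono) auto
    also have "\<dots> = real L ^ (n + L)" by (simp add: power_add)
    also have "\<dots> \<le> real L ^ (2 * L)" using L unfolding L_def by (intro power_increasing) auto
    finally show ?thesis .
  qed
  ultimately have "(real (2 * n) ^ n + 1) * fact L < real L ^ N" by linarith
  moreover have "real d ^ N * exp (real d) > 0" using d by simp
  ultimately have "real d ^ N * exp (real d) * ((real (2 * n) ^ n + 1) * fact L) < real d ^ N * exp (real d) * real L ^ N"
    by (rule mult_strict_left_mono)
  then have "real d ^ N * exp (real d) * ((real (2 * n) ^ n + 1) * fact L) < fact N" using * by linarith
  then show ?thesis unfolding L_def by (simp add: field_simps del: fact_Suc)
qed

text \<open>This is an effective irrationality measure of $e^d$ in disguise.\<close>

theorem exp_comparison:
  assumes d: "d \<ge> 1"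
  shows "\<exists>C. \<forall>q\<ge>1. \<forall>p. \<forall>J\<ge>C * q. real q * exp (real d) \<le> real p \<longleftrightarrow>
    real q * (\<Sum>i\<le>J. real d ^ i / fact i) \<le> real p"
proof -
  \<comment> \<open>\<open>q * \<delta>\<close> will be at most
    \<open>d * exp d * (d ^ 2) ^ n / fact n\<close>, and \<open>c\<close> is chosen so that this is
    below 1/2 for every \<open>n >= c\<close>.\<close>
  have "(\<lambda>n. real (d ^ 2) ^ n / fact n) \<longlonglongrightarrow> 0"
    using summable_LIMSEQ_zero[OF sums_summable[OF exp_sums[of "d ^ 2"]]] .
  then have "eventually (\<lambda>n. real (d ^ 2) ^ n / fact n < 1 / (2 * real d * exp (real d))) sequentially"
    using d by (intro order_tendstoD(2)) auto
  then obtain c where c: "\<And>n. n \<ge> c \<Longrightarrow> real (d ^ 2) ^ n / fact n < 1 / (2 * real d * exp (real d))"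
    unfolding eventually_sequentially by blast
  \<comment> \<open>With \<open>n = q + c\<close> one has
    \<open>2 * n + 1 <= (2 * c + 3) * q\<close>, so \<open>J + 1\<close> reaches the size that
    \<open>exp_comparison_aux\<close> asks for.\<close>
  define C where "C = nat \<lceil>(real d * exp (1 + real d) + 3) * (2 * real c + 3)\<rceil>"
  show ?thesis
  proof (intro exI[of _ C] allI impI)
    fix q p J :: nat assume q: "q \<ge> 1" and J: "J \<ge> C * q"
    define n where "n = q + c"
    let ?S = "\<Sum>i\<le>J. real d ^ i / fact i"
    let ?T = "exp (real d) - ?S"
    have n1: "n \<ge> 1" "q \<le> n" using q unfolding n_def by auto
    obtain A B \<delta> where AB: "of_int A * exp (real d) = of_int B + \<delta>" "1 / fact (2 * n + 1) \<le> \<delta>"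
      "\<delta> \<le> real d ^ (2 * n + 1) / fact (n + 1) * exp (real d)"
      "\<bar>real_of_int B\<bar> \<le> real (2 * n) ^ n * exp (real d)"
      using pade_exp[OF d n1(1)] by blast
    have "real (J + 1) \<ge> (real d * exp (1 + real d) + 3) * real (2 * n + 1)"
    proof -
      have "real (2 * n + 1) \<le> (2 * real c + 3) * real q"
      proof -
        obtain q' where "q = Suc q'" using q by (cases q) auto
        then have "2 * n + 1 \<le> (2 * c + 3) * q" unfolding n_def by (simp add: algebra_simps)
        then have "real (2 * n + 1) \<le> real ((2 * c + 3) * q)" unfolding of_nat_le_iff .
        then show ?thesis by simp
      qed
      then have "(real d * exp (1 + real d) + 3) * real (2 * n + 1) \<le>
          (real d * exp (1 + real d) + 3) * ((2 * real c + 3) * real q)"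
        by (intro mult_left_mono) auto
      also have "\<dots> \<le> real C * real q" unfolding mult.assoc[symmetric] C_def
        by (intro mult_right_mono) (auto intro: real_nat_ceiling_ge)
      also have "\<dots> \<le> real (J + 1)" using J unfolding of_nat_mult[symmetric] of_nat_le_iff by simp
      finally show ?thesis .
    qed
    from exp_comparison_aux[OF n1(1) this d]
    have small: "(real (2 * n) ^ n + 1) * (real d ^ (J + 1) / fact (J + 1) * exp (real d)) < \<delta>"
      using AB(2) by linarith
    have "(0::real) < 1 / fact (2 * n + 1)" by (simp del: fact_Suc)
    then have \<delta>0: "\<delta> > 0" using AB(2) by (rule less_le_trans)
    have q\<delta>: "real q * \<delta> < 1 / 2"
    proof -
      have "real q * \<delta> \<le> real (n + 1) * (real d ^ (2 * n + 1) / fact (n + 1) * exp (real d))"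
        using n1 AB(3) \<delta>0 by (intro mult_mono) auto
      also have "\<dots> = real d * exp (real d) * (real (d ^ 2) ^ n / fact n)"
        by (simp add: power_mult[symmetric] field_simps del: of_nat_Suc)
      also have "\<dots> < real d * exp (real d) * (1 / (2 * real d * exp (real d)))"
        using c[of n] d unfolding n_def by (intro mult_strict_left_mono) auto
      also have "\<dots> = 1 / 2" using d by simp
      finally show ?thesis .
    qed
    have "\<delta> \<le> 1"
    proof -
      have "1 * \<delta> \<le> real q * \<delta>" using q \<delta>0 by (intro mult_right_mono) auto
      then show ?thesis using q\<delta> by linarith
    qed
    have "\<bar>real_of_int A\<bar> * exp (real d) \<le> (real (2 * n) ^ n + 1) * exp (real d)"
    proof -
      have "\<bar>real_of_int A\<bar> * exp (real d) = \<bar>of_int B + \<delta>\<bar>" unfolding AB(1)[symmetric] by (simp add: abs_mult)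
      also have "\<dots> \<le> real (2 * n) ^ n * exp (real d) + 1" using AB(4) \<delta>0 \<open>\<delta> \<le> 1\<close> by linarith
      also have "\<dots> \<le> (real (2 * n) ^ n + 1) * exp (real d)" by (simp add: distrib_right)
      finally show ?thesis .
    qed
    then have A: "\<bar>real_of_int A\<bar> \<le> real (2 * n) ^ n + 1" by simp
    have T: "0 \<le> ?T" "?T \<le> real d ^ (J + 1) / fact (J + 1) * exp (real d)" using exp_tail by auto
    have "\<bar>real_of_int A\<bar> * ?T \<le> (real (2 * n) ^ n + 1) * (real d ^ (J + 1) / fact (J + 1) * exp (real d))"
      using A T by (intro mult_mono) auto
    then have AT: "\<bar>real_of_int A\<bar> * ?T < \<delta>" using small by linarith
    show "real q * exp (real d) \<le> real p \<longleftrightarrow> real q * ?S \<le> real p"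
    proof
      assume "real q * exp (real d) \<le> real p"
      moreover have "real q * ?S \<le> real q * exp (real d)" using T(1) by (intro mult_left_mono) auto
      ultimately show "real q * ?S \<le> real p" by linarith
    next
      assume S: "real q * ?S \<le> real p"
      show "real q * exp (real d) \<le> real p"
      proof (rule ccontr)
        assume "\<not> ?thesis"
        \<comment> \<open>If the truncated sum decided wrongly, \<open>A * \<theta>\<close> would
          differ from \<open>q * \<delta>\<close> by an integer \<open>N\<close>. Smallness of both
          forces \<open>N = 0\<close>, yet \<open>A * \<theta>\<close> is strictly smaller than
          \<open>q * \<delta>\<close>.\<close>
        define \<theta> where "\<theta> = real q * exp (real d) - real p"
        have \<theta>: "\<theta> > 0" "\<theta> \<le> real q * ?T"
          using \<open>\<not> _\<close> S unfolding \<theta>_def by (auto simp: algebra_simps)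
        have "\<bar>real_of_int A\<bar> * \<theta> \<le> \<bar>real_of_int A\<bar> * (real q * ?T)" using \<theta> by (intro mult_left_mono) auto
        also have "\<dots> = real q * (\<bar>real_of_int A\<bar> * ?T)" by (simp only: mult_ac)
        also have "\<dots> < real q * \<delta>" using AT q by (intro mult_strict_left_mono) auto
        finally have A\<theta>: "\<bar>real_of_int A * \<theta>\<bar> < real q * \<delta>" using \<theta>(1) by (simp add: abs_mult)
        define N where "N = int q * B - A * int p"
        have "real_of_int A * \<theta> = real q * (of_int A * exp (real d)) - of_int A * real p"
          unfolding \<theta>_def by (simp add: algebra_simps)
        also have "\<dots> = of_int N + real q * \<delta>" unfolding AB(1) N_def by (simp add: algebra_simps)
        finally have N: "real_of_int A * \<theta> = of_int N + real q * \<delta>" .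
        then have "\<bar>real_of_int N\<bar> < 1" using A\<theta> q\<delta> by linarith
        then have "N = 0" by linarith
        then show False using N A\<theta> by simp
      qed
    qed
  qed
qed

section \<open>Unit-cost execution\<close>

text \<open>Unit costs suffice: the values at most double in each step.\<close>

inductive steps :: "com \<Rightarrow> memory \<Rightarrow> nat \<Rightarrow> nat list \<Rightarrow> memory \<Rightarrow> bool" where
  Skip: "steps Skip M 1 [] M"
| Const: "steps (Const r x) M 1 [] (M(r := x))"
| Add: "steps (Add r i j) M 1 [] (M(r := M i + M j))"
| Sub: "steps (Sub r i j) M 1 [] (M(r := M i - M j))"
| Load: "steps (Load r i) M 1 [] (M(r := M (M i)))"
| Store: "steps (Store r i) M 1 [] (M(M r := M i))"
| Print: "steps (Print i) M 1 [M i] M"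
| Seq: "steps P M s xs M' \<Longrightarrow> steps Q M' t ys M'' \<Longrightarrow> steps (Seq P Q) M (s + t) (xs @ ys) M''"
| CondTrue: "M i \<noteq> 0 \<Longrightarrow> steps P M t xs M' \<Longrightarrow> steps (Cond i P Q) M (1 + t) xs M'"
| CondFalse: "M i = 0 \<Longrightarrow> steps Q M t xs M' \<Longrightarrow> steps (Cond i P Q) M (1 + t) xs M'"
| WhileTrue: "M i \<noteq> 0 \<Longrightarrow> steps P M s xs M' \<Longrightarrow> steps (While i P) M' t ys M''
    \<Longrightarrow> steps (While i P) M (1 + s + t) (xs @ ys) M''"
| WhileFalse: "M i = 0 \<Longrightarrow> steps (While i P) M 1 [] M"

text \<open>A literal can create a large number in a single step, so its digits enter the bound on
  the register contents.\<close>

fun literals_le :: "nat \<Rightarrow> com \<Rightarrow> bool" where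
  "literals_le D (Const r x) \<longleftrightarrow> digits x \<le> D"
| "literals_le D (Seq P Q) \<longleftrightarrow> literals_le D P \<and> literals_le D Q"
| "literals_le D (Cond i P Q) \<longleftrightarrow> literals_le D P \<and> literals_le D Q"
| "literals_le D (While i P) \<longleftrightarrow> literals_le D P"
| "literals_le D _ \<longleftrightarrow> True"

lemma literals_le_mono: "literals_le D P \<Longrightarrow> D \<le> E \<Longrightarrow> literals_le E P"
  by (induction P) auto

lemma literals_le_exists: "\<exists>D. literals_le D P"
proof (induction P)
  case (Const r x)
  show ?case by (rule exI[of _ "digits x"]) simp
next
  case (Seq P Q)
  then obtain D E where "literals_le D P" "literals_le E Q" by blast
  then show ?case by (intro exI[of _ "max D E"]) (auto intro: literals_le_mono)
next
  case (Cond i P Q)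
  then obtain D E where "literals_le D P" "literals_le E Q" by blast
  then show ?case by (intro exI[of _ "max D E"]) (auto intro: literals_le_mono)
qed auto

lemma digits_add: "digits x \<le> D \<Longrightarrow> digits y \<le> D \<Longrightarrow> digits (x + y) \<le> Suc D"
  by (auto simp: floorlog_le_iff)

lemma digits_diff: "digits x \<le> D \<Longrightarrow> digits (x - y) \<le> D"
  by (auto simp: floorlog_le_iff)

text \<open>After \<open>s\<close> steps every register has at most \<open>D + s\<close> digits, and
  a step reads at most two numbers; the logarithmic cost is thus at most quadratic in
  \<open>s\<close>.\<close>

lemma steps_exec:
  "steps P M s xs M' \<Longrightarrow> (\<And>r. digits (M r) \<le> D) \<Longrightarrow> literals_le D P \<Longrightarrow>
    (\<exists>t \<le> s * (2 * (D + s) + 1). exec P M t xs M') \<and> (\<forall>r. digits (M' r) \<le> D + s)"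
proof (induction arbitrary: D rule: steps.induct)
  case (Skip M)
  then show ?case using exec.Skip[of M] by (auto intro!: exI[of _ "1::nat"] intro: le_SucI trans_le_add1)
next
  case (Const r x M)
  then have "1 + digits x \<le> 1 * (2 * (D + 1) + 1)" "digits ((M(r := x)) q) \<le> D + 1" for q
    by (auto intro: le_SucI)
  then show ?case using exec.Const by blast
next
  case (Add r i j M)
  have "digits (M i) + digits (M j) \<le> D + D"
    using Add(1)[of i] Add(1)[of j] by (rule add_mono)
  then have "1 + digits (M i) + digits (M j) \<le> 1 * (2 * (D + 1) + 1)" by simp
  moreover have "digits ((M(r := M i + M j)) q) \<le> D + 1" for q
    using Add(1) by (auto intro: digits_add le_SucI)
  ultimately show ?case using exec.Add by blast
next
  case (Sub r i j M)
  have "digits (M i) + digits (M j) \<le> D + D"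
    using Sub(1)[of i] Sub(1)[of j] by (rule add_mono)
  then have "1 + digits (M i) + digits (M j) \<le> 1 * (2 * (D + 1) + 1)" by simp
  moreover have "digits ((M(r := M i - M j)) q) \<le> D + 1" for q
    using Sub(1) by (auto intro: digits_diff le_SucI)
  ultimately show ?case using exec.Sub by blast
next
  case (Load r i M)
  have "digits (M i) + digits (M (M i)) \<le> D + D"
    using Load(1)[of i] Load(1)[of "M i"] by (rule add_mono)
  then have "1 + digits (M i) + digits (M (M i)) \<le> 1 * (2 * (D + 1) + 1)" by simp
  moreover have "digits ((M(r := M (M i))) q) \<le> D + 1" for q
    using Load(1) by (auto intro: le_SucI)
  ultimately show ?case using exec.Load by blast
next
  case (Store r i M)
  have "digits (M r) + digits (M i) \<le> D + D"
    using Store(1)[of r] Store(1)[of i] by (rule add_mono)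
  then have "1 + digits (M r) + digits (M i) \<le> 1 * (2 * (D + 1) + 1)" by simp
  moreover have "digits ((M(M r := M i)) q) \<le> D + 1" for q
    using Store(1) by (auto intro: le_SucI)
  ultimately show ?case using exec.Store by blast
next
  case (Print i M)
  have "1 + digits (M i) \<le> 1 * (2 * (D + 1) + 1)"
    using Print(1)[of i] by simp
  moreover have "digits (M q) \<le> D + 1" for q using Print(1) by (auto intro: le_SucI)
  ultimately show ?case using exec.Print by blast
next
  case (Seq P M s xs M' Q t ys M'')
  have 1: "\<exists>u \<le> s * (2 * (D + s) + 1). exec P M u xs M'" "\<And>r. digits (M' r) \<le> D + s"
    using Seq.IH(1)[of D] Seq.prems by auto
  have 2: "\<exists>v \<le> t * (2 * (D + s + t) + 1). exec Q M' v ys M''" "\<And>r. digits (M'' r) \<le> D + s + t"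
  proof -
    have "literals_le D Q" using Seq.prems(2) by simp
    then have "literals_le (D + s) Q" by (rule literals_le_mono) simp
    from Seq.IH(2)[OF 1(2) this] show "\<exists>v \<le> t * (2 * (D + s + t) + 1). exec Q M' v ys M''"
      "\<And>r. digits (M'' r) \<le> D + s + t" by blast+
  qed
  obtain u v where uv: "u \<le> s * (2 * (D + s) + 1)" "exec P M u xs M'"
    "v \<le> t * (2 * (D + s + t) + 1)" "exec Q M' v ys M''" using 1 2 by blast
  let ?B = "2 * (D + (s + t)) + 1"
  have "s * (2 * (D + s) + 1) \<le> s * ?B" "t * (2 * (D + s + t) + 1) \<le> t * ?B"
    by (intro mult_le_mono2; simp)+
  then have "u + v \<le> s * ?B + t * ?B" using uv(1,3) by linarith
  then have "u + v \<le> (s + t) * ?B" by (simp only: add_mult_distrib)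
  then show ?case using exec.Seq[OF uv(2,4)] 2(2) by (auto simp: add.assoc)
next
  case (CondTrue M i P t xs M' Q)
  obtain u where u: "u \<le> t * (2 * (D + t) + 1)" "exec P M u xs M'" "\<And>r. digits (M' r) \<le> D + t"
    using CondTrue.IH[of D] CondTrue.prems by auto
  have "t * (2 * (D + t) + 1) \<le> t * (2 * (D + (1 + t)) + 1)" by (intro mult_le_mono2) simp
  moreover have "digits (M i) \<le> 2 * D" using CondTrue.prems(1)[of i] by simp
  ultimately have "1 + digits (M i) + u \<le> (1 + t) * (2 * (D + (1 + t)) + 1)"
    using u(1) by (simp add: add_mult_distrib)
  then show ?case using exec.CondTrue[OF CondTrue.hyps(1) u(2), of Q] u(3) by (auto intro: le_SucI)
next
  case (CondFalse M i Q t xs M' P)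
  obtain u where u: "u \<le> t * (2 * (D + t) + 1)" "exec Q M u xs M'" "\<And>r. digits (M' r) \<le> D + t"
    using CondFalse.IH[of D] CondFalse.prems by auto
  have "t * (2 * (D + t) + 1) \<le> t * (2 * (D + (1 + t)) + 1)" by (intro mult_le_mono2) simp
  then have "1 + u \<le> (1 + t) * (2 * (D + (1 + t)) + 1)"
    using u(1) by (simp add: add_mult_distrib)
  then show ?case using exec.CondFalse[OF CondFalse.hyps(1) u(2), of P] u(3) by (auto intro: le_SucI)
next
  case (WhileTrue M i P s xs M' t ys M'')
  have 1: "\<exists>u \<le> s * (2 * (D + s) + 1). exec P M u xs M'" "\<And>r. digits (M' r) \<le> D + s"
    using WhileTrue.IH(1)[of D] WhileTrue.prems by auto
  have 2: "\<exists>v \<le> t * (2 * (D + s + t) + 1). exec (While i P) M' v ys M''" "\<And>r. digits (M'' r) \<le> D + s + t"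
  proof -
    have "literals_le (D + s) (While i P)" by (rule literals_le_mono[OF WhileTrue.prems(2)]) simp
    from WhileTrue.IH(2)[OF 1(2) this] show "\<exists>v \<le> t * (2 * (D + s + t) + 1). exec (While i P) M' v ys M''"
      "\<And>r. digits (M'' r) \<le> D + s + t" by blast+
  qed
  obtain u v where uv: "u \<le> s * (2 * (D + s) + 1)" "exec P M u xs M'"
    "v \<le> t * (2 * (D + s + t) + 1)" "exec (While i P) M' v ys M''" using 1 2 by blast
  let ?B = "2 * (D + (1 + s + t)) + 1"
  have "s * (2 * (D + s) + 1) \<le> s * ?B" "t * (2 * (D + s + t) + 1) \<le> t * ?B"
    by (intro mult_le_mono2; simp)+
  moreover have "1 + digits (M i) \<le> ?B" using WhileTrue.prems(1)[of i] by simp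
  ultimately have "1 + digits (M i) + u + v \<le> 1 * ?B + s * ?B + t * ?B"
    using uv(1,3) by simp
  then have "1 + digits (M i) + u + v \<le> (1 + s + t) * ?B" by (simp only: add_mult_distrib)
  moreover have "digits (M'' r) \<le> D + (1 + s + t)" for r using le_SucI[OF 2(2)[of r]] by (simp add: add.assoc)
  ultimately show ?case using exec.WhileTrue[OF WhileTrue.hyps(1) uv(2,4)] by blast
next
  case (WhileFalse M i P)
  then show ?case using exec.WhileFalse[of M i P]
    by (auto intro!: exI[of _ "1::nat"] intro: le_SucI trans_le_add1)
qed

section \<open>A calculus for total correctness with time and output\<close>

definition wp :: "com \<Rightarrow> (nat \<Rightarrow> nat list \<Rightarrow> memory \<Rightarrow> bool) \<Rightarrow> memory \<Rightarrow> bool" where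
  "wp P Q M \<longleftrightarrow> (\<exists>s xs M'. steps P M s xs M' \<and> Q s xs M')"

lemma wp_mono: "wp P Q M \<Longrightarrow> (\<And>s xs M'. Q s xs M' \<Longrightarrow> Q' s xs M') \<Longrightarrow> wp P Q' M"
  unfolding wp_def by blast

inductive_cases SkipE: "steps Skip M s xs M'"
inductive_cases ConstE: "steps (Const r x) M s xs M'"
inductive_cases AddE: "steps (Add r i j) M s xs M'"
inductive_cases SubE: "steps (Sub r i j) M s xs M'"
inductive_cases LoadE: "steps (Load r i) M s xs M'"
inductive_cases StoreE: "steps (Store r i) M s xs M'"
inductive_cases PrintE: "steps (Print i) M s xs M'"
inductive_cases SeqE: "steps (Seq P Q) M s xs M'"
inductive_cases CondE: "steps (Cond i P Q) M s xs M'"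

lemma wp_simps [simp]:
  "wp Skip Q M = Q 1 [] M"
  "wp (Const r x) Q M = Q 1 [] (M(r := x))"
  "wp (Add r i j) Q M = Q 1 [] (M(r := M i + M j))"
  "wp (Sub r i j) Q M = Q 1 [] (M(r := M i - M j))"
  "wp (Load r i) Q M = Q 1 [] (M(r := M (M i)))"
  "wp (Store r i) Q M = Q 1 [] (M(M r := M i))"
  "wp (Print i) Q M = Q 1 [M i] M"
  unfolding wp_def
  by (auto elim!: SkipE ConstE AddE SubE LoadE StoreE PrintE
      intro: steps.intros[simplified])

lemma wp_Seq [simp]:
  "wp (Seq A B) Q M = wp A (\<lambda>s xs M'. wp B (\<lambda>t ys M''. Q (s + t) (xs @ ys) M'') M') M"
  unfolding wp_def by (auto elim!: SeqE intro: steps.Seq) (blast intro: steps.Seq)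

lemma wp_Cond [simp]:
  "wp (Cond i A B) Q M = (if M i \<noteq> 0 then wp A (\<lambda>s. Q (Suc s)) M else wp B (\<lambda>s. Q (Suc s)) M)"
proof -
  have "steps (Cond i A B) M s xs M' \<longleftrightarrow>
      (\<exists>t. s = Suc t \<and> (if M i \<noteq> 0 then steps A M t xs M' else steps B M t xs M'))" for s xs M'
    using steps.CondTrue[of M i A _ xs M' B] steps.CondFalse[of M i B _ xs M' A]
    by (auto elim: CondE)
  then show ?thesis unfolding wp_def by auto
qed

text \<open>\<open>I j\<close> is the invariant with \<open>j\<close> iterations left, and
  \<open>F j\<close> is the output still to be printed. Counting down yields the exit condition at
  \<open>I 0\<close> and the time bound together.\<close>

lemma wp_loop_print:
  assumes body: "\<And>j M. j < n \<Longrightarrow> I (Suc j) M \<Longrightarrow> M i \<noteq> 0 \<and>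
      wp body (\<lambda>s xs M'. s \<le> B \<and> F (Suc j) = xs @ F j \<and> I j M') M"
    and exit: "\<And>M. I 0 M \<Longrightarrow> M i = 0" and F: "F 0 = []"
    and init: "I n M"
  shows "wp (While i body) (\<lambda>s xs M'. s \<le> n * (B + 1) + 1 \<and> xs = F n \<and> I 0 M') M"
  using body init
proof (induction n arbitrary: M)
  case 0
  then show ?case using exit F steps.WhileFalse[of M i body] unfolding wp_def by fastforce
next
  case (Suc n)
  have *: "M i \<noteq> 0" "wp body (\<lambda>s xs M'. s \<le> B \<and> F (Suc n) = xs @ F n \<and> I n M') M"
    using Suc.prems(1)[of n M] Suc.prems(2) by auto
  then obtain s xs M' where 1: "steps body M s xs M'" "s \<le> B" "F (Suc n) = xs @ F n" "I n M'"
    unfolding wp_def by blast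
  obtain t ys M'' where 2: "steps (While i body) M' t ys M''" "t \<le> n * (B + 1) + 1" "ys = F n" "I 0 M''"
  proof -
    have "wp (While i body) (\<lambda>s xs M'. s \<le> n * (B + 1) + 1 \<and> xs = F n \<and> I 0 M') M'"
    proof (rule Suc.IH)
      fix j N assume "j < n" "I (Suc j) N"
      then show "N i \<noteq> 0 \<and> wp body (\<lambda>s xs M'. s \<le> B \<and> F (Suc j) = xs @ F j \<and> I j M') N"
        by (intro Suc.prems(1)) auto
    qed fact
    then show ?thesis using that unfolding wp_def by blast
  qed
  have "1 + s + t \<le> Suc n * (B + 1) + 1" using 1(2) 2(2) by simp
  then show ?case
    using steps.WhileTrue[OF *(1) 1(1) 2(1)] 1(3) 2(3,4) unfolding wp_def by metis
qed

lemma wp_loop: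
  assumes body: "\<And>j M. j < n \<Longrightarrow> I (Suc j) M \<Longrightarrow> M i \<noteq> 0 \<and>
      wp body (\<lambda>s xs M'. s \<le> B \<and> xs = [] \<and> I j M') M"
    and exit: "\<And>M. I 0 M \<Longrightarrow> M i = 0"
    and init: "I n M"
  shows "wp (While i body) (\<lambda>s xs M'. s \<le> n * (B + 1) + 1 \<and> xs = [] \<and> I 0 M') M"
proof (rule wp_loop_print[where F = "\<lambda>_. []"])
  fix j M assume "j < n" "I (Suc j) M"
  from body[OF this] show "M i \<noteq> 0 \<and> wp body (\<lambda>s xs M'. s \<le> B \<and> [] = xs @ [] \<and> I j M') M"
    by (auto elim: wp_mono)
qed (use exit init in auto)

section \<open>The coloring program\<close>

fun seqs :: "com list \<Rightarrow> com" where
  "seqs [] = Skip"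
| "seqs [P] = P"
| "seqs (P # Q # Ps) = Seq P (seqs (Q # Ps))"

text \<open>
  Register 0 holds \<open>k\<close>, register 1 holds \<open>n\<close>, registers 2 and 3 hold 1 and 0.
  The seed is in register 4, \<open>f j\<close> in register \<open>20 + j\<close>, the color of \<open>v\<close>
  in register \<open>20 + n + v\<close>; registers 6 and 7 hold the base addresses.
\<close>

definition halve :: com where
  "halve = seqs [Const 11 0, Sub 12 8 2,
     While 12 (seqs [Sub 8 8 2, Sub 8 8 2, Add 11 11 2, Sub 12 8 2])]"

text \<open>Register 12 holds the truncated predecessor of register 8, which is nonzero exactly
  while 2 can be subtracted. Time linear in the number itself is affordable, since seeds stay below
  \<open>2 ^ (c * k)\<close>.\<close>

lemma halve:
  assumes "M 2 = 1"
  shows "wp halve (\<lambda>s xs M'. s \<le> 5 * M 8 + 3 \<and> xs = [] \<and> M' 8 = M 8 mod 2 \<and> M' 11 = M 8 div 2 \<and>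
    (\<forall>r. r \<notin> {8, 11, 12} \<longrightarrow> M' r = M r)) M"
proof -
  let ?I = "\<lambda>l N. N 8 = M 8 mod 2 + 2 * l \<and> N 11 = M 8 div 2 - l \<and> l \<le> M 8 div 2 \<and> N 12 = N 8 - 1 \<and>
    (\<forall>r. r \<notin> {8, 11, 12} \<longrightarrow> N r = M r)"
  let ?M = "M(11 := 0, 12 := M 8 - 1)"
  have "wp (While 12 (seqs [Sub 8 8 2, Sub 8 8 2, Add 11 11 2, Sub 12 8 2]))
      (\<lambda>s xs M'. s \<le> (M 8 div 2) * (4 + 1) + 1 \<and> xs = [] \<and> ?I 0 M') ?M"
  proof (rule wp_loop)
    fix j N assume "?I (Suc j) N"
    then show "N 12 \<noteq> 0 \<and> wp (seqs [Sub 8 8 2, Sub 8 8 2, Add 11 11 2, Sub 12 8 2])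
        (\<lambda>s xs M'. s \<le> 4 \<and> xs = [] \<and> ?I j M') N"
      using assms by auto
  qed (use assms in auto)
  then show ?thesis unfolding halve_def using assms
    by (auto elim!: wp_mono)
qed

text \<open>All \<open>n\<close> coefficients are written, zeros included, so that the order of the
  recurrence never has to be known.\<close>

definition decode :: com where
  "decode = seqs [Add 8 4 3, Add 9 1 3, Add 10 6 3,
     While 9 (seqs [Add 10 10 2, halve, Store 10 8, Add 8 11 3, Sub 9 9 2])]"

lemma decode:
  assumes "M 1 = n" "M 2 = 1" "M 3 = 0" "M 4 = z" "M 6 = 20"
  shows "wp decode (\<lambda>s xs M'. s \<le> n * (5 * z + 7 + 1) + 4 \<and> xs = [] \<and>
    (\<forall>j\<in>{1..n}. M' (20 + j) = seed z j) \<and>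
    (\<forall>r<20. r \<notin> {8, 9, 10, 11, 12} \<longrightarrow> M' r = M r)) M"
proof -
  let ?I = "\<lambda>l N. l \<le> n \<and> N 8 = z div 2 ^ (n - l) \<and> N 9 = l \<and> N 10 = 20 + (n - l) \<and>
    (\<forall>j\<in>{1..n - l}. N (20 + j) = seed z j) \<and> (\<forall>r<20. r \<notin> {8, 9, 10, 11, 12} \<longrightarrow> N r = M r)"
  let ?M = "M(8 := z, 9 := n, 10 := 20)"
  let ?body = "seqs [Add 10 10 2, halve, Store 10 8, Add 8 11 3, Sub 9 9 2]"
  have "wp (While 9 ?body) (\<lambda>s xs M'. s \<le> n * ((5 * z + 7) + 1) + 1 \<and> xs = [] \<and> ?I 0 M') ?M"
  proof (rule wp_loop)
    fix l N assume I: "?I (Suc l) N"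
    define i where "i = n - l"
    have i: "n - l = i" "n - Suc l = i - 1" "1 \<le> i" "i \<le> n" "Suc (i - 1) = i" "l \<le> n"
      using I unfolding i_def by auto
    have N: "N 2 = 1" "N 3 = 0" "N 9 = Suc l" "N 10 + N 2 = 20 + i" using I assms i(2,3) by auto
    have div: "z div 2 ^ (i - 1) div 2 = z div 2 ^ i"
      using power_Suc2[of "2::nat" "i - 1"] unfolding i(5) by (simp only: div_mult2_eq)
    have N8: "N 8 \<le> z" "N 8 mod 2 = seed z i" "N 8 div 2 = z div 2 ^ i"
      using I div unfolding i(2) by (auto simp: seed_def)
    have Nf: "N (20 + j) = seed z j" if "1 \<le> j" "j < i" for j using I that unfolding i(2) by auto
    have Nr: "N r = M r" if "r < 20" "r \<notin> {8, 9, 10, 11, 12}" for r using I that by auto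
    let ?N = "N(10 := 20 + i)"
    have "wp halve (\<lambda>s xs M'. s \<le> 5 * ?N 8 + 3 \<and> xs = [] \<and> M' 8 = ?N 8 mod 2 \<and> M' 11 = ?N 8 div 2 \<and>
      (\<forall>r. r \<notin> {8, 11, 12} \<longrightarrow> M' r = ?N r)) ?N"
      using N by (intro halve) simp
    then have "wp halve (\<lambda>s xs M'. wp (seqs [Store 10 8, Add 8 11 3, Sub 9 9 2])
        (\<lambda>t ys M''. 1 + (s + t) \<le> 5 * z + 7 \<and> xs @ ys = [] \<and> ?I l M'') M') ?N"
    proof (rule wp_mono)
      fix s and xs :: "nat list" and M'
      assume "s \<le> 5 * ?N 8 + 3 \<and> xs = [] \<and> M' 8 = ?N 8 mod 2 \<and> M' 11 = ?N 8 div 2 \<and>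
        (\<forall>r. r \<notin> {8, 11, 12} \<longrightarrow> M' r = ?N r)"
      then have s: "s \<le> 5 * z + 3" "xs = []" and M': "M' 8 = seed z i" "M' 11 = z div 2 ^ i"
        "\<And>r. r \<notin> {8, 11, 12} \<Longrightarrow> M' r = ?N r" using N8 by auto
      have R: "M' 10 = 20 + i" "M' 9 = Suc l" "M' 3 = 0" "M' 2 = 1" using M'(3) N by simp_all
      let ?L = "M'(20 + i := seed z i, 8 := z div 2 ^ i, 9 := l)"
      have "?L (20 + j) = seed z j" if "j \<in> {1..i}" for j
        using that Nf[of j] M'(3)[of "20 + j"] by (cases "j = i") auto
      moreover have "?L r = M r" if "r < 20" "r \<notin> {8, 9, 10, 11, 12}" for r
        using that M'(3)[of r] Nr[of r] by auto
      ultimately have IL: "?I l ?L" unfolding i(1) using i(6) R(1) by simp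
      have "wp (seqs [Store 10 8, Add 8 11 3, Sub 9 9 2]) (\<lambda>t ys M''. t = 3 \<and> ys = [] \<and> M'' = ?L) M'"
        using R M' by simp
      then show "wp (seqs [Store 10 8, Add 8 11 3, Sub 9 9 2])
        (\<lambda>t ys M''. 1 + (s + t) \<le> 5 * z + 7 \<and> xs @ ys = [] \<and> ?I l M'') M'"
      proof (rule wp_mono)
        fix t :: nat and ys :: "nat list" and M''
        assume *: "t = 3 \<and> ys = [] \<and> M'' = ?L"
        then have "1 + (s + t) \<le> 5 * z + 7 \<and> xs @ ys = []" using s by simp
        then show "1 + (s + t) \<le> 5 * z + 7 \<and> xs @ ys = [] \<and> ?I l M''" using IL * by blast
      qed
    qed
    then have "wp ?body (\<lambda>s xs M'. s \<le> 5 * z + 7 \<and> xs = [] \<and> ?I l M') N"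
      by (simp only: seqs.simps wp_Seq wp_simps append_Nil N(4))
    moreover have "N 9 \<noteq> 0" using N(3) by simp
    ultimately show "N 9 \<noteq> 0 \<and> wp ?body (\<lambda>s xs M'. s \<le> 5 * z + 7 \<and> xs = [] \<and> ?I l M') N"
      by blast
  qed (use assms in auto)
  then show ?thesis unfolding decode_def using assms
    by (auto elim!: wp_mono)
qed

text \<open>
  Register 9 counts the terms left and register 10 holds the address of the current term;
  registers 12 and 13 run upwards through \<open>f\<close> and downwards through the earlier terms.
\<close>

definition term_loop :: com where
  "term_loop = While 14 (seqs [Add 12 12 2, Sub 13 13 2, Load 15 12,
     Cond 15 (seqs [Load 16 13, Cond 16 (Sub 11 2 11) Skip]) Skip, Sub 14 14 2])"

definition next_term :: com where
  "next_term = Seq (seqs [Add 10 10 2, Const 11 0, Add 12 6 3, Add 13 10 3, Sub 14 10 7, Sub 14 14 2])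
     (Seq term_loop (seqs [Store 10 11, Sub 9 9 2]))"

lemma wp_seq:
  assumes "wp A (\<lambda>s xs M'. s \<le> a \<and> xs = [] \<and> R M') M"
    and "\<And>M'. R M' \<Longrightarrow> wp B (\<lambda>s xs M''. s \<le> b \<and> xs = ys \<and> Q M'') M'"
    and "a + b \<le> c"
  shows "wp (Seq A B) (\<lambda>s xs M''. s \<le> c \<and> xs = ys \<and> Q M'') M"
  unfolding wp_Seq
proof (rule wp_mono[OF assms(1)])
  fix s and xs :: "nat list" and M'
  assume *: "s \<le> a \<and> xs = [] \<and> R M'"
  then have "wp B (\<lambda>s xs M''. s \<le> b \<and> xs = ys \<and> Q M'') M'" using assms(2) by blast
  then show "wp B (\<lambda>t zs M''. s + t \<le> c \<and> xs @ zs = ys \<and> Q M'') M'"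
    by (rule wp_mono) (use * assms(3) in auto)
qed

lemma next_term:
  assumes M: "M 1 = n" "M 2 = 1" "M 3 = 0" "M 6 = 20" "M 7 = 20 + n" "M 10 = 20 + n + v"
    and v: "1 \<le> v" "v < n"
    and f: "\<And>j. j \<in> {1..n} \<Longrightarrow> M (20 + j) = f j" "\<And>j. f j < 2"
    and r: "\<And>j. j \<in> {1..v} \<Longrightarrow> M (20 + n + j) = recseq f j"
  shows "wp next_term (\<lambda>s xs M'. s \<le> n * 9 + 9 \<and> xs = [] \<and> (M' 10 = 20 + n + Suc v \<and> M' 9 = M 9 - 1 \<and>
    (\<forall>j\<in>{1..n}. M' (20 + j) = f j) \<and> (\<forall>j\<in>{1..Suc v}. M' (20 + n + j) = recseq f j) \<and>
    (\<forall>r<20. r \<notin> {9, 10, 11, 12, 13, 14, 15, 16} \<longrightarrow> M' r = M r))) M"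
proof -
  define S where "S i = (\<Sum>j\<in>{1..<Suc i}. f j * recseq f (Suc v - j)) mod 2" for i
  let ?I = "\<lambda>l N. l \<le> v \<and> N 11 = S (v - l) \<and> N 12 = 20 + (v - l) \<and> N 13 = 20 + n + Suc l \<and> N 14 = l \<and>
    (\<forall>r. r \<notin> {10, 11, 12, 13, 14, 15, 16} \<longrightarrow> N r = M r) \<and> N 10 = 20 + n + Suc v"
  let ?body = "seqs [Add 12 12 2, Sub 13 13 2, Load 15 12,
       Cond 15 (seqs [Load 16 13, Cond 16 (Sub 11 2 11) Skip]) Skip, Sub 14 14 2]"
  let ?M = "M(10 := 20 + n + Suc v, 11 := 0, 12 := 20, 13 := 20 + n + Suc v, 14 := v)"
  have "wp (While 14 ?body) (\<lambda>s xs M'. s \<le> v * (8 + 1) + 1 \<and> xs = [] \<and> ?I 0 M') ?M"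
  proof (rule wp_loop)
    fix l N assume I: "?I (Suc l) N"
    define h where "h = v - Suc l"
    have h: "v - Suc l = h" "v - l = Suc h" "Suc v - Suc h = Suc l" "Suc h \<in> {1..n}" "Suc l \<in> {1..v}" "l \<le> v"
      using I v unfolding h_def by auto
    have N: "N 11 = S h" "N 12 = 20 + h" "N 13 = 20 + n + Suc (Suc l)" "N 14 = Suc l" "N 10 = 20 + n + Suc v"
      and Nr: "\<And>r. r \<notin> {10, 11, 12, 13, 14, 15, 16} \<Longrightarrow> N r = M r"
      using I unfolding h(1) by blast+
    have N2: "N 2 = 1" using Nr[of 2] M(2) by simp
    have fh: "N (20 + Suc h) = f (Suc h)" using Nr[of "20 + Suc h"] f(1)[OF h(4)] by simp
    have rl: "N (20 + n + Suc l) = recseq f (Suc l)" using Nr[of "20 + n + Suc l"] r[OF h(5)] by simp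
    have "{1..<Suc (Suc h)} = insert (Suc h) {1..<Suc h}" by auto
    note ins = this
    have Sh: "S (Suc h) = (f (Suc h) * recseq f (Suc l) + S h) mod 2"
      unfolding S_def ins mod_add_right_eq h(3)[symmetric] by (subst sum.insert) auto
    have S2: "S h < 2" unfolding S_def by simp
    \<comment> \<open>Adding 1 modulo 2 is subtracting from 1, which \<open>Sub 11 2 11\<close> does
      as register 2 holds 1.\<close>
    have Sh': "S (Suc h) = (if f (Suc h) \<noteq> 0 then (if recseq f (Suc l) \<noteq> 0 then 1 - S h else S h) else S h)"
      unfolding Sh using f(2)[of "Suc h"] recseq_less_2[of f "Suc l"] S2
      by (auto simp: less_2_cases_iff)
    have "wp ?body (\<lambda>s xs M'. s \<le> 8 \<and> xs = [] \<and> M' 11 = S (Suc h) \<and> M' 12 = 20 + Suc h \<and>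
        M' 13 = 20 + n + Suc l \<and> M' 14 = l \<and> (\<forall>r. r \<notin> {11, 12, 13, 14, 15, 16} \<longrightarrow> M' r = N r)) N"
      using N(1-4) N2 fh rl by (simp add: Sh')
    then have "wp ?body (\<lambda>s xs M'. s \<le> 8 \<and> xs = [] \<and> ?I l M') N"
    proof (rule wp_mono)
      fix s and xs :: "nat list" and M'
      assume *: "s \<le> 8 \<and> xs = [] \<and> M' 11 = S (Suc h) \<and> M' 12 = 20 + Suc h \<and>
        M' 13 = 20 + n + Suc l \<and> M' 14 = l \<and> (\<forall>r. r \<notin> {11, 12, 13, 14, 15, 16} \<longrightarrow> M' r = N r)"
      then have "M' r = M r" if "r \<notin> {10, 11, 12, 13, 14, 15, 16}" for r
        using that Nr[of r] by simp
      moreover have "M' 10 = 20 + n + Suc v" using * N(5) by simp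
      ultimately show "s \<le> 8 \<and> xs = [] \<and> ?I l M'"
        using * h(6) unfolding h(2) by blast
    qed
    moreover have "N 14 \<noteq> 0" using N(4) by simp
    ultimately show "N 14 \<noteq> 0 \<and> wp ?body (\<lambda>s xs M'. s \<le> 8 \<and> xs = [] \<and> ?I l M') N"
      by blast
  qed (use M v in \<open>auto simp: S_def\<close>)
  then have loop: "wp term_loop (\<lambda>s xs M'. s \<le> n * 9 + 1 \<and> xs = [] \<and> ?I 0 M') ?M"
    unfolding term_loop_def
  proof (rule wp_mono)
    fix s and xs :: "nat list" and M'
    assume *: "s \<le> v * (8 + 1) + 1 \<and> xs = [] \<and> ?I 0 M'"
    have "v * (8 + 1) + 1 \<le> n * 9 + 1" using v by simp
    with * show "s \<le> n * 9 + 1 \<and> xs = [] \<and> ?I 0 M'" using order_trans by blast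
  qed
  have "S v = recseq f (Suc v)" unfolding S_def using v by (subst recseq_rec) auto
  note Sv = this
  show ?thesis unfolding next_term_def
  proof (rule wp_seq[where a = 6 and R = "\<lambda>M'. M' = ?M"])
    show "wp (seqs [Add 10 10 2, Const 11 0, Add 12 6 3, Add 13 10 3, Sub 14 10 7, Sub 14 14 2])
      (\<lambda>s xs M'. s \<le> 6 \<and> xs = [] \<and> M' = ?M) M"
      using M v by simp
  next
    fix N assume "N = ?M"
    show "wp (Seq term_loop (seqs [Store 10 11, Sub 9 9 2]))
      (\<lambda>s xs M'. s \<le> n * 9 + 3 \<and> xs = [] \<and> (M' 10 = 20 + n + Suc v \<and> M' 9 = M 9 - 1 \<and>
      (\<forall>j\<in>{1..n}. M' (20 + j) = f j) \<and> (\<forall>j\<in>{1..Suc v}. M' (20 + n + j) = recseq f j) \<and>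
      (\<forall>r<20. r \<notin> {9, 10, 11, 12, 13, 14, 15, 16} \<longrightarrow> M' r = M r))) N"
      unfolding \<open>N = ?M\<close>
    proof (rule wp_seq[OF loop])
      fix M' assume *: "?I 0 M'"
      have M': "M' 11 = recseq f (Suc v)" "M' 10 = 20 + n + Suc v" "M' 9 = M 9" "M' 2 = 1" using * M Sv by auto
      have 1: "M' (20 + j) = f j" if "j \<in> {1..n}" for j using f(1)[OF that] * by simp
      have 2: "M' (20 + n + j) = recseq f j" if "j \<in> {1..v}" for j using r[OF that] * by simp
      have 3: "M' r = M r" if "r < 20" "r \<notin> {9, 10, 11, 12, 13, 14, 15, 16}" for r using that * by auto
      let ?N = "M'(20 + n + Suc v := recseq f (Suc v), 9 := M 9 - 1)"
      have "?N (20 + j) = f j" if "j \<in> {1..n}" for j using 1[OF that] that by simp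
      moreover have "?N (20 + n + j) = recseq f j" if "j \<in> {1..Suc v}" for j
        using 2[of j] that by (cases "j = Suc v") auto
      moreover have "?N r = M r" if "r < 20" "r \<notin> {9, 10, 11, 12, 13, 14, 15, 16}" for r
        using 3[OF that] that by auto
      moreover have "?N 10 = 20 + n + Suc v" "?N 9 = M 9 - 1" using M' by auto
      ultimately have N: "?N 10 = 20 + n + Suc v \<and> ?N 9 = M 9 - 1 \<and>
        (\<forall>j\<in>{1..n}. ?N (20 + j) = f j) \<and> (\<forall>j\<in>{1..Suc v}. ?N (20 + n + j) = recseq f j) \<and>
        (\<forall>r<20. r \<notin> {9, 10, 11, 12, 13, 14, 15, 16} \<longrightarrow> ?N r = M r)" by blast
      have "wp (seqs [Store 10 11, Sub 9 9 2]) (\<lambda>s xs M''. s = 2 \<and> xs = [] \<and> M'' = ?N) M'"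
        using M' by simp
      then show "wp (seqs [Store 10 11, Sub 9 9 2])
        (\<lambda>s xs M'. s \<le> 2 \<and> xs = [] \<and> (M' 10 = 20 + n + Suc v \<and> M' 9 = M 9 - 1 \<and>
        (\<forall>j\<in>{1..n}. M' (20 + j) = f j) \<and> (\<forall>j\<in>{1..Suc v}. M' (20 + n + j) = recseq f j) \<and>
        (\<forall>r<20. r \<notin> {9, 10, 11, 12, 13, 14, 15, 16} \<longrightarrow> M' r = M r))) M'"
        by (rule wp_mono) (use N in \<open>blast intro: eq_refl\<close>)
    qed simp
  qed simp
qed

definition generate :: com where
  "generate = Seq (seqs [Add 10 7 2, Store 10 2, Sub 9 1 2]) (While 9 next_term)"

lemma generate:
  assumes M: "M 1 = n" "M 2 = 1" "M 3 = 0" "M 6 = 20" "M 7 = 20 + n" "n \<ge> 1"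
    and f: "\<And>j. j \<in> {1..n} \<Longrightarrow> M (20 + j) = f j" "\<And>j. f j < 2"
  shows "wp generate (\<lambda>s xs M'. s \<le> n * (n * 9 + 10) + 4 \<and> xs = [] \<and>
    ((\<forall>j\<in>{1..n}. M' (20 + n + j) = recseq f j) \<and>
    (\<forall>r<20. r \<notin> {9, 10, 11, 12, 13, 14, 15, 16} \<longrightarrow> M' r = M r))) M"
proof -
  let ?I = "\<lambda>l N. l < n \<and> N 9 = l \<and> N 10 = 20 + n + (n - l) \<and>
    (\<forall>j\<in>{1..n}. N (20 + j) = f j) \<and> (\<forall>j\<in>{1..n - l}. N (20 + n + j) = recseq f j) \<and>
    (\<forall>r<20. r \<notin> {9, 10, 11, 12, 13, 14, 15, 16} \<longrightarrow> N r = M r)"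
  let ?M = "M(10 := 20 + n + 1, 20 + n + 1 := 1, 9 := n - 1)"
  have loop: "wp (While 9 next_term) (\<lambda>s xs M'. s \<le> (n - 1) * ((n * 9 + 9) + 1) + 1 \<and> xs = [] \<and> ?I 0 M') ?M"
  proof (rule wp_loop)
    fix l N assume I: "?I (Suc l) N"
    define v where "v = n - Suc l"
    have v: "n - Suc l = v" "n - l = Suc v" "1 \<le> v" "v < n" "l < n" using I unfolding v_def by auto
    have Nr: "N r = M r" if "r < 20" "r \<notin> {9, 10, 11, 12, 13, 14, 15, 16}" for r using I that by blast
    have N: "N 1 = n" "N 2 = 1" "N 3 = 0" "N 6 = 20" "N 7 = 20 + n"
      using M Nr by simp_all
    have N10: "N 10 = 20 + n + v" "N 9 = Suc l" using I unfolding v(1) by blast+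
    have Nf: "N (20 + j) = f j" if "j \<in> {1..n}" for j using I that by blast
    have Ns: "N (20 + n + j) = recseq f j" if "j \<in> {1..v}" for j using I that unfolding v(1) by blast
    from next_term[OF N N10(1) v(3,4) Nf f(2) Ns]
    have "wp next_term (\<lambda>s xs M'. s \<le> n * 9 + 9 \<and> xs = [] \<and> ?I l M') N"
    proof (rule wp_mono)
      fix s and xs :: "nat list" and M'
      assume *: "s \<le> n * 9 + 9 \<and> xs = [] \<and> M' 10 = 20 + n + Suc v \<and> M' 9 = N 9 - 1 \<and>
        (\<forall>j\<in>{1..n}. M' (20 + j) = f j) \<and> (\<forall>j\<in>{1..Suc v}. M' (20 + n + j) = recseq f j) \<and>
        (\<forall>r<20. r \<notin> {9, 10, 11, 12, 13, 14, 15, 16} \<longrightarrow> M' r = N r)"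
      then have "M' 9 = l" using N10(2) by simp
      moreover have "M' r = M r" if "r < 20" "r \<notin> {9, 10, 11, 12, 13, 14, 15, 16}" for r
        using * Nr[OF that] that by metis
      ultimately show "s \<le> n * 9 + 9 \<and> xs = [] \<and> ?I l M'"
        using * v(5) unfolding v(2) by blast
    qed
    moreover have "N 9 \<noteq> 0" using N10 by simp
    ultimately show "N 9 \<noteq> 0 \<and> wp next_term (\<lambda>s xs M'. s \<le> n * 9 + 9 \<and> xs = [] \<and> ?I l M') N"
      by blast
  next
    have "?M (20 + j) = f j" if "j \<in> {1..n}" for j using f(1)[OF that] that by simp
    moreover have "n - (n - 1) = 1" using M(6) by simp
    ultimately show "?I (n - 1) ?M" using M(6) by simp
  qed simp
  show ?thesis unfolding generate_def
  proof (rule wp_seq[where a = 3 and R = "\<lambda>M'. M' = ?M"])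
    show "wp (seqs [Add 10 7 2, Store 10 2, Sub 9 1 2]) (\<lambda>s xs M'. s \<le> 3 \<and> xs = [] \<and> M' = ?M) M"
      using M by simp
    fix N assume "N = ?M"
    show "wp (While 9 next_term) (\<lambda>s xs M'. s \<le> n * (n * 9 + 10) + 1 \<and> xs = [] \<and>
      ((\<forall>j\<in>{1..n}. M' (20 + n + j) = recseq f j) \<and>
      (\<forall>r<20. r \<notin> {9, 10, 11, 12, 13, 14, 15, 16} \<longrightarrow> M' r = M r))) N"
      unfolding \<open>N = ?M\<close>
    proof (rule wp_mono[OF loop])
      fix s and xs :: "nat list" and M'
      assume *: "s \<le> (n - 1) * ((n * 9 + 9) + 1) + 1 \<and> xs = [] \<and> ?I 0 M'"
      have "(n - 1) * ((n * 9 + 9) + 1) \<le> n * (n * 9 + 10)" by (intro mult_le_mono) auto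
      then have "s \<le> n * (n * 9 + 10) + 1" using * by linarith
      then show "s \<le> n * (n * 9 + 10) + 1 \<and> xs = [] \<and>
        ((\<forall>j\<in>{1..n}. M' (20 + n + j) = recseq f j) \<and>
        (\<forall>r<20. r \<notin> {9, 10, 11, 12, 13, 14, 15, 16} \<longrightarrow> M' r = M r))" using * unfolding diff_zero by blast
    qed
  qed simp
qed

text \<open>Register 11 holds the current term, 12 the number of terms left, 15 the color of the
  first term, and 13 stays 1 as long as no term exceeds \<open>n\<close> or changes color. The test
  of register 16 comes before the load, so no color beyond \<open>n\<close> is read. Two colors are
  equal when the sum of both truncated differences vanishes.\<close>

definition walk_loop :: com where
  "walk_loop = While 12 (seqs [Sub 16 11 1, Cond 16 (Const 13 0) (seqs [Add 14 11 7, Load 17 14,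
      Sub 18 17 15, Sub 17 15 17, Add 17 18 17, Cond 17 (Const 13 0) Skip]), Add 11 11 10, Sub 12 12 2])"

definition walk :: com where
  "walk = Seq (seqs [Add 11 9 3, Add 12 0 3, Const 13 1, Add 14 9 7, Load 15 14])
     (Seq walk_loop (seqs [Cond 13 (Const 8 1) Skip, Sub 10 10 2]))"

lemma walk:
  assumes M: "M 0 = k" "M 1 = n" "M 2 = 1" "M 3 = 0" "M 7 = 20 + n" "M 9 = a" "M 10 = d" "a \<in> {1..n}"
    and r: "\<And>j. j \<in> {1..n} \<Longrightarrow> M (20 + n + j) = c j"
  shows "wp walk (\<lambda>s xs M'. s \<le> k * 12 + 9 \<and> xs = [] \<and>
    (M' 8 = (if \<forall>i<k. a + i * d \<le> n \<and> c (a + i * d) = c a then 1 else M 8) \<and>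
     M' 10 = d - 1 \<and> (\<forall>r. r \<notin> {8, 10, 11, 12, 13, 14, 15, 16, 17, 18} \<longrightarrow> M' r = M r))) M"
proof -
  let ?ok = "\<lambda>i. a + i * d \<le> n \<and> c (a + i * d) = c a"
  let ?I = "\<lambda>l N. l \<le> k \<and> N 12 = l \<and> N 11 = a + (k - l) * d \<and> N 13 = (if \<forall>i<k - l. ?ok i then 1 else 0) \<and>
    N 15 = c a \<and> (\<forall>r. r \<notin> {11, 12, 13, 14, 15, 16, 17, 18} \<longrightarrow> N r = M r)"
  let ?body = "seqs [Sub 16 11 1, Cond 16 (Const 13 0) (seqs [Add 14 11 7, Load 17 14,
      Sub 18 17 15, Sub 17 15 17, Add 17 18 17, Cond 17 (Const 13 0) Skip]), Add 11 11 10, Sub 12 12 2]"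
  let ?M = "M(11 := a, 12 := k, 13 := 1, 14 := a + (20 + n), 15 := c a)"
  have loop: "wp walk_loop (\<lambda>s xs M'. s \<le> k * (11 + 1) + 1 \<and> xs = [] \<and> ?I 0 M') ?M"
    unfolding walk_loop_def
  proof (rule wp_loop[where I = ?I])
    fix l N assume I: "?I (Suc l) N"
    define i where "i = k - Suc l"
    have i: "k - Suc l = i" "k - l = Suc i" "l \<le> k" using I unfolding i_def by auto
    define x where "x = a + i * d"
    have x: "a + Suc i * d = x + d" "x \<ge> 1" using M(8) unfolding x_def by auto
    have Nr: "N r = M r" if "r \<notin> {11, 12, 13, 14, 15, 16, 17, 18}" for r using I that by blast
    have N: "N 1 = n" "N 2 = 1" "N 7 = 20 + n" "N 10 = d" using M Nr by simp_all
    have N': "N 12 = Suc l" "N 11 = x" "N 15 = c a" "N 13 = (if \<forall>j<i. ?ok j then 1 else 0)"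
      using I unfolding i(1) x_def by blast+
    have Nx: "N (x + (20 + n)) = c x" if "x \<le> n"
      using Nr[of "x + (20 + n)"] r[of x] x(2) that by (simp add: add.commute)
    have ok: "(\<forall>j<Suc i. ?ok j) \<longleftrightarrow> (\<forall>j<i. ?ok j) \<and> x \<le> n \<and> c x = c a"
      unfolding x_def by (auto simp: less_Suc_eq)
    let ?Q = "\<lambda>s xs M'. s \<le> 11 \<and> xs = [] \<and> M' 12 = l \<and> M' 11 = x + d \<and>
       M' 13 = (if (\<forall>j<i. ?ok j) \<and> x \<le> n \<and> c x = c a then 1 else 0) \<and>
       (\<forall>r. r \<notin> {11, 12, 13, 14, 16, 17, 18} \<longrightarrow> M' r = N r)"
    obtain b where b: "b = (\<forall>j<i. ?ok j)" by blast
    have "wp ?body ?Q N"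
    proof (cases "x \<le> n")
      case True
      have "c x - c a + (c a - c x) = 0 \<longleftrightarrow> c x = c a" by auto
      then show ?thesis using True N N'(1-3) N'(4)[folded b] Nx[OF True] unfolding b[symmetric]
        by simp
    next
      case False
      then show ?thesis using N N'(1-3) N'(4)[folded b] unfolding b[symmetric] by simp
    qed
    then have "wp ?body (\<lambda>s xs M'. s \<le> 11 \<and> xs = [] \<and> ?I l M') N"
    proof (rule wp_mono)
      fix s and xs :: "nat list" and M'
      assume *: "?Q s xs M'"
      have "M' r = M r" if "r \<notin> {11, 12, 13, 14, 15, 16, 17, 18}" for r
        using * Nr[OF that] that by (metis insert_iff)
      moreover have "M' 15 = c a" using * N'(3) by simp
      ultimately show "s \<le> 11 \<and> xs = [] \<and> ?I l M'"
        using * i(3) unfolding i(2) x(1) ok by blast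
    qed
    moreover have "N 12 \<noteq> 0" using N' by simp
    ultimately show "N 12 \<noteq> 0 \<and> wp ?body (\<lambda>s xs M'. s \<le> 11 \<and> xs = [] \<and> ?I l M') N" by blast
  qed simp_all
  have a: "M (a + (20 + n)) = c a" using r[OF M(8)] by (simp add: add.commute)
  let ?Q = "\<lambda>M'. M' 8 = (if \<forall>i<k. ?ok i then 1 else M 8) \<and>
     M' 10 = d - 1 \<and> (\<forall>r. r \<notin> {8, 10, 11, 12, 13, 14, 15, 16, 17, 18} \<longrightarrow> M' r = M r)"
  show ?thesis unfolding walk_def
  proof (rule wp_seq[where a = 5 and R = "\<lambda>M'. M' = ?M"])
    show "wp (seqs [Add 11 9 3, Add 12 0 3, Const 13 1, Add 14 9 7, Load 15 14])
      (\<lambda>s xs M'. s \<le> 5 \<and> xs = [] \<and> M' = ?M) M"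
      using M a by simp
    fix N assume "N = ?M"
    show "wp (Seq walk_loop (seqs [Cond 13 (Const 8 1) Skip, Sub 10 10 2]))
      (\<lambda>s xs M'. s \<le> k * 12 + 4 \<and> xs = [] \<and> ?Q M') N"
      unfolding \<open>N = ?M\<close>
    proof (rule wp_seq[OF loop])
      fix M' assume I: "?I 0 M'"
      have "M' 10 = d" "M' 2 = 1" "M' 8 = M 8" "M' 13 = (if \<forall>i<k. ?ok i then 1 else 0)"
        using I M(3,7) by simp_all
      moreover have "M' r = M r" if "r \<notin> {8, 10, 11, 12, 13, 14, 15, 16, 17, 18}" for r
        using I that by (metis insert_iff)
      moreover obtain b where b: "b = (\<forall>i<k. ?ok i)" by blast
      ultimately show "wp (seqs [Cond 13 (Const 8 1) Skip, Sub 10 10 2]) (\<lambda>s xs M''. s \<le> 3 \<and> xs = [] \<and> ?Q M'') M'"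
        unfolding b[symmetric] by simp
    qed simp
  qed simp
qed

definition mono_from :: "nat \<Rightarrow> nat \<Rightarrow> (nat \<Rightarrow> nat) \<Rightarrow> nat \<Rightarrow> nat \<Rightarrow> bool" where
  "mono_from k n c a d \<longleftrightarrow> (\<forall>i<k. a + i * d \<le> n \<and> c (a + i * d) = c a)"

text \<open>A second term in \<open>{1..n}\<close> forces \<open>d <= n\<close>. For
  \<open>k = 1\<close> there is no second term, and the difference is replaced by 1.\<close>

lemma has_mono_AP_iff:
  assumes "k \<ge> 1"
  shows "has_mono_AP k n c \<longleftrightarrow> (\<exists>a\<in>{1..n}. \<exists>d\<in>{1..n}. mono_from k n c a d)"
proof
  assume "has_mono_AP k n c"
  then obtain S where S: "S \<subseteq> {1..n}" "is_AP k S" "monochromatic c S"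
    unfolding has_mono_AP_def by blast
  obtain a d where ad: "0 < a" "0 < d" "S = {a + i * d | i. i < k}"
    using S(2) unfolding is_AP_def by blast
  obtain w where w: "\<And>x. x \<in> S \<Longrightarrow> c x = w" using S(3) unfolding monochromatic_def by blast
  have mem: "a + i * d \<in> S" if "i < k" for i using that ad(3) by blast
  have le: "a + i * d \<le> n" if "i < k" for i using mem[OF that] S(1) by auto
  have a: "a \<in> {1..n}" using le[of 0] assms ad(1) by simp
  have eq: "c (a + i * d) = c a" if "i < k" for i using w[OF mem[OF that]] w[OF mem[of 0]] assms by simp
  show "\<exists>a\<in>{1..n}. \<exists>d\<in>{1..n}. mono_from k n c a d"
  proof (cases "k = 1")
    case True
    then have "mono_from k n c a 1" using a unfolding mono_from_def by simp
    then show ?thesis using a by (intro bexI[of _ a] bexI[of _ 1]) auto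
  next
    case False
    then have "d \<le> n" using le[of 1] assms by simp
    moreover have "mono_from k n c a d" unfolding mono_from_def using le eq by blast
    ultimately show ?thesis using a ad(2) by (intro bexI[of _ a] bexI[of _ d]) auto
  qed
next
  assume "\<exists>a\<in>{1..n}. \<exists>d\<in>{1..n}. mono_from k n c a d"
  then obtain a d where ad: "a \<in> {1..n}" "d \<in> {1..n}" "mono_from k n c a d" by blast
  have "is_AP k {a + i * d | i. i < k}" unfolding is_AP_def
    using ad(1,2) by (intro exI[of _ a] exI[of _ d]) simp
  moreover have "{a + i * d | i. i < k} \<subseteq> {1..n}" using ad unfolding mono_from_def by auto
  moreover have "monochromatic c {a + i * d | i. i < k}"
    using ad(3) unfolding mono_from_def monochromatic_def by blast
  ultimately show "has_mono_AP k n c" unfolding has_mono_AP_def by blast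
qed

definition check_row :: com where
  "check_row = Seq (Add 10 1 3) (Seq (While 10 walk) (Sub 9 9 2))"

lemma check_row:
  assumes M: "M 0 = k" "M 1 = n" "M 2 = 1" "M 3 = 0" "M 7 = 20 + n" "M 9 = a" "a \<in> {1..n}"
    and r: "\<And>j. j \<in> {1..n} \<Longrightarrow> M (20 + n + j) = c j"
  shows "wp check_row (\<lambda>s xs M'. s \<le> n * (k * 12 + 10) + 3 \<and> xs = [] \<and>
    (M' 8 = (if \<exists>d\<in>{1..n}. mono_from k n c a d then 1 else M 8) \<and> M' 9 = a - 1 \<and>
     (\<forall>r. r \<notin> {8, 9, 10, 11, 12, 13, 14, 15, 16, 17, 18} \<longrightarrow> M' r = M r))) M"
proof -
  let ?I = "\<lambda>l N. l \<le> n \<and> N 10 = l \<and> N 8 = (if \<exists>d\<in>{l<..n}. mono_from k n c a d then 1 else M 8) \<and>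
    (\<forall>r. r \<notin> {8, 10, 11, 12, 13, 14, 15, 16, 17, 18} \<longrightarrow> N r = M r)"
  let ?M = "M(10 := n)"
  have loop: "wp (While 10 walk) (\<lambda>s xs M'. s \<le> n * ((k * 12 + 9) + 1) + 1 \<and> xs = [] \<and> ?I 0 M') ?M"
  proof (rule wp_loop[where I = ?I])
    fix l N assume I: "?I (Suc l) N"
    have Nr: "N r = M r" if "r \<notin> {8, 10, 11, 12, 13, 14, 15, 16, 17, 18}" for r using I that by blast
    have N: "N 0 = k" "N 1 = n" "N 2 = 1" "N 3 = 0" "N 7 = 20 + n" "N 9 = a" "N 10 = Suc l"
      using M Nr I by simp_all
    have Nc: "N (20 + n + j) = c j" if "j \<in> {1..n}" for j using r[OF that] Nr[of "20 + n + j"] by simp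
    have "{l<..n} = insert (Suc l) {Suc l<..n}" using I by auto
    then have ex: "(\<exists>d\<in>{l<..n}. mono_from k n c a d) \<longleftrightarrow>
        mono_from k n c a (Suc l) \<or> (\<exists>d\<in>{Suc l<..n}. mono_from k n c a d)" by simp
    from walk[OF N M(7) Nc, folded mono_from_def]
    have "wp walk (\<lambda>s xs M'. s \<le> k * 12 + 9 \<and> xs = [] \<and> ?I l M') N"
    proof (rule wp_mono)
      fix s and xs :: "nat list" and M'
      assume *: "s \<le> k * 12 + 9 \<and> xs = [] \<and> (M' 8 = (if mono_from k n c a (Suc l) then 1 else N 8) \<and>
        M' 10 = Suc l - 1 \<and> (\<forall>r. r \<notin> {8, 10, 11, 12, 13, 14, 15, 16, 17, 18} \<longrightarrow> M' r = N r))"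
      have "N 8 = (if \<exists>d\<in>{Suc l<..n}. mono_from k n c a d then 1 else M 8)" using I by blast
      then have "M' 8 = (if \<exists>d\<in>{l<..n}. mono_from k n c a d then 1 else M 8)"
        unfolding ex using * by (cases "mono_from k n c a (Suc l)") (simp_all only: if_True if_False simp_thms)
      moreover have "M' r = M r" if "r \<notin> {8, 10, 11, 12, 13, 14, 15, 16, 17, 18}" for r
        using * Nr[OF that] that by metis
      moreover have "M' 10 = l" "l \<le> n" using * I by simp_all
      ultimately show "s \<le> k * 12 + 9 \<and> xs = [] \<and> ?I l M'" using * by blast
    qed
    moreover have "N 10 \<noteq> 0" using N by simp
    ultimately show "N 10 \<noteq> 0 \<and> wp walk (\<lambda>s xs M'. s \<le> k * 12 + 9 \<and> xs = [] \<and> ?I l M') N" by blast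
  qed simp_all
  let ?Q = "\<lambda>M'. M' 8 = (if \<exists>d\<in>{1..n}. mono_from k n c a d then 1 else M 8) \<and> M' 9 = a - 1 \<and>
     (\<forall>r. r \<notin> {8, 9, 10, 11, 12, 13, 14, 15, 16, 17, 18} \<longrightarrow> M' r = M r)"
  show ?thesis unfolding check_row_def
  proof (rule wp_seq[where a = 1 and R = "\<lambda>M'. M' = ?M"])
    show "wp (Add 10 1 3) (\<lambda>s xs M'. s \<le> 1 \<and> xs = [] \<and> M' = ?M) M" using M by simp
    fix N assume "N = ?M"
    show "wp (Seq (While 10 walk) (Sub 9 9 2)) (\<lambda>s xs M'. s \<le> n * (k * 12 + 10) + 2 \<and> xs = [] \<and> ?Q M') N"
      unfolding \<open>N = ?M\<close>
    proof (rule wp_seq[OF loop])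
      fix M' assume I: "?I 0 M'"
      have "{0<..n} = {1..n}" by auto
      then have "M' 8 = (if \<exists>d\<in>{1..n}. mono_from k n c a d then 1 else M 8)" using I by (simp only:)
      moreover have "M' 9 = a" "M' 2 = 1" using I M by simp_all
      moreover have "M' r = M r" if "r \<notin> {8, 9, 10, 11, 12, 13, 14, 15, 16, 17, 18}" for r
        using I that by (metis insert_iff)
      ultimately show "wp (Sub 9 9 2) (\<lambda>s xs M'. s \<le> 1 \<and> xs = [] \<and> ?Q M') M'"
        by (simp del: atLeastAtMost_iff)
    qed simp
  qed simp
qed

definition check :: com where
  "check = Seq (seqs [Const 8 0, Add 9 1 3]) (While 9 check_row)"

lemma check:
  assumes M: "M 0 = k" "M 1 = n" "M 2 = 1" "M 3 = 0" "M 7 = 20 + n" and k: "k \<ge> 1"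
    and r: "\<And>j. j \<in> {1..n} \<Longrightarrow> M (20 + n + j) = c j"
  shows "wp check (\<lambda>s xs M'. s \<le> n * (n * (k * 12 + 10) + 4) + 3 \<and> xs = [] \<and>
    (M' 8 = (if has_mono_AP k n c then 1 else 0) \<and>
     (\<forall>r. r \<notin> {8, 9, 10, 11, 12, 13, 14, 15, 16, 17, 18} \<longrightarrow> M' r = M r))) M"
proof -
  let ?g = "\<lambda>a. \<exists>d\<in>{1..n}. mono_from k n c a d"
  let ?I = "\<lambda>l N. l \<le> n \<and> N 9 = l \<and> N 8 = (if \<exists>a\<in>{l<..n}. ?g a then 1 else 0) \<and>
    (\<forall>r. r \<notin> {8, 9, 10, 11, 12, 13, 14, 15, 16, 17, 18} \<longrightarrow> N r = M r)"
  let ?M = "M(8 := 0, 9 := n)"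
  let ?B = "n * (k * 12 + 10) + 3"
  have loop: "wp (While 9 check_row) (\<lambda>s xs M'. s \<le> n * (?B + 1) + 1 \<and> xs = [] \<and> ?I 0 M') ?M"
  proof (rule wp_loop[where I = ?I])
    fix l N assume I: "?I (Suc l) N"
    have Nr: "N r = M r" if "r \<notin> {8, 9, 10, 11, 12, 13, 14, 15, 16, 17, 18}" for r using I that by blast
    have N: "N 0 = k" "N 1 = n" "N 2 = 1" "N 3 = 0" "N 7 = 20 + n" "N 9 = Suc l"
      using M Nr I by simp_all
    have Nc: "N (20 + n + j) = c j" if "j \<in> {1..n}" for j using r[OF that] Nr[of "20 + n + j"] by simp
    have "{l<..n} = insert (Suc l) {Suc l<..n}" using I by auto
    then have ex: "(\<exists>a\<in>{l<..n}. ?g a) \<longleftrightarrow> ?g (Suc l) \<or> (\<exists>a\<in>{Suc l<..n}. ?g a)" by simp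
    have "Suc l \<in> {1..n}" using I by simp
    from check_row[OF N this Nc]
    have "wp check_row (\<lambda>s xs M'. s \<le> ?B \<and> xs = [] \<and> ?I l M') N"
    proof (rule wp_mono)
      fix s and xs :: "nat list" and M'
      assume *: "s \<le> ?B \<and> xs = [] \<and> (M' 8 = (if ?g (Suc l) then 1 else N 8) \<and> M' 9 = Suc l - 1 \<and>
        (\<forall>r. r \<notin> {8, 9, 10, 11, 12, 13, 14, 15, 16, 17, 18} \<longrightarrow> M' r = N r))"
      have "N 8 = (if \<exists>a\<in>{Suc l<..n}. ?g a then 1 else 0)" using I by blast
      then have "M' 8 = (if \<exists>a\<in>{l<..n}. ?g a then 1 else 0)"
        unfolding ex using * by (cases "?g (Suc l)") (simp_all only: if_True if_False simp_thms)
      moreover have "M' r = M r" if "r \<notin> {8, 9, 10, 11, 12, 13, 14, 15, 16, 17, 18}" for r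
        using * Nr[OF that] that by metis
      moreover have "M' 9 = l" "l \<le> n" using * I by simp_all
      ultimately show "s \<le> ?B \<and> xs = [] \<and> ?I l M'" using * by blast
    qed
    moreover have "N 9 \<noteq> 0" using N by simp
    ultimately show "N 9 \<noteq> 0 \<and> wp check_row (\<lambda>s xs M'. s \<le> ?B \<and> xs = [] \<and> ?I l M') N" by blast
  qed simp_all
  show ?thesis unfolding check_def
  proof (rule wp_seq[where a = 2 and R = "\<lambda>M'. M' = ?M"])
    show "wp (seqs [Const 8 0, Add 9 1 3]) (\<lambda>s xs M'. s \<le> 2 \<and> xs = [] \<and> M' = ?M) M" using M by simp
    fix N assume "N = ?M"
    show "wp (While 9 check_row) (\<lambda>s xs M'. s \<le> n * (?B + 1) + 1 \<and> xs = [] \<and>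
      (M' 8 = (if has_mono_AP k n c then 1 else 0) \<and>
      (\<forall>r. r \<notin> {8, 9, 10, 11, 12, 13, 14, 15, 16, 17, 18} \<longrightarrow> M' r = M r))) N"
      unfolding \<open>N = ?M\<close>
    proof (rule wp_mono[OF loop])
      fix s and xs :: "nat list" and M'
      assume *: "s \<le> n * (?B + 1) + 1 \<and> xs = [] \<and> ?I 0 M'"
      have "{0<..n} = {1..n}" by auto
      then show "s \<le> n * (?B + 1) + 1 \<and> xs = [] \<and> (M' 8 = (if has_mono_AP k n c then 1 else 0) \<and>
        (\<forall>r. r \<notin> {8, 9, 10, 11, 12, 13, 14, 15, 16, 17, 18} \<longrightarrow> M' r = M r))"
        using * unfolding has_mono_AP_iff[OF k] by (simp only:) blast
    qed
  qed simp
qed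

definition search_step :: com where
  "search_step = Seq decode (Seq generate (Seq check (Cond 8 (Add 4 4 2) (Const 5 0))))"

definition step_bound :: "nat \<Rightarrow> nat \<Rightarrow> nat \<Rightarrow> nat" where
  "step_bound k n z = n * (5 * z + 8) + n * (n * 9 + 10) + n * (n * (k * 12 + 10) + 4) + 13"

lemma search_step:
  assumes M: "M 0 = k" "M 1 = n" "M 2 = 1" "M 3 = 0" "M 4 = z" "M 5 = 1" "M 6 = 20" "M 7 = 20 + n"
    and k: "k \<ge> 1" and n: "n \<ge> 1"
  shows "wp search_step (\<lambda>s xs M'. s \<le> step_bound k n z \<and> xs = [] \<and>
    ((if has_mono_AP k n (recseq (seed z)) then M' 4 = z + 1 \<and> M' 5 = 1
      else M' 5 = 0 \<and> (\<forall>j\<in>{1..n}. M' (20 + n + j) = recseq (seed z) j)) \<and>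
     (\<forall>r\<in>{0, 1, 2, 3, 6, 7}. M' r = M r))) M"
proof -
  let ?c = "recseq (seed z)"
  let ?Q = "\<lambda>M'. (if has_mono_AP k n ?c then M' 4 = z + 1 \<and> M' 5 = 1
      else M' 5 = 0 \<and> (\<forall>j\<in>{1..n}. M' (20 + n + j) = ?c j)) \<and> (\<forall>r\<in>{0, 1, 2, 3, 6, 7}. M' r = M r)"
  have dec: "wp decode (\<lambda>s xs M'. s \<le> n * (5 * z + 8) + 4 \<and> xs = [] \<and>
    ((\<forall>j\<in>{1..n}. M' (20 + j) = seed z j) \<and> (\<forall>r<20. r \<notin> {8, 9, 10, 11, 12} \<longrightarrow> M' r = M r))) M"
    using decode[OF M(2-5,7)] by (simp only: add.assoc numeral_plus_one) simp
  show ?thesis unfolding search_step_def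
  proof (rule wp_seq[OF dec])
    fix N assume N: "(\<forall>j\<in>{1..n}. N (20 + j) = seed z j) \<and> (\<forall>r<20. r \<notin> {8, 9, 10, 11, 12} \<longrightarrow> N r = M r)"
    have Nr: "N r = M r" if "r < 8" for r using N that by simp
    have N': "N 0 = k" "N 1 = n" "N 2 = 1" "N 3 = 0" "N 4 = z" "N 5 = 1" "N 6 = 20" "N 7 = 20 + n"
      using M Nr by simp_all
    have f: "N (20 + j) = seed z j" if "j \<in> {1..n}" for j using N that by blast
    have f2: "seed z j < 2" for j unfolding seed_def by simp
    show "wp (Seq generate (Seq check (Cond 8 (Add 4 4 2) (Const 5 0))))
      (\<lambda>s xs M'. s \<le> n * (n * 9 + 10) + n * (n * (k * 12 + 10) + 4) + 9 \<and> xs = [] \<and> ?Q M') N"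
    proof (rule wp_seq[OF generate[OF N'(2-4,7,8) n f f2]])
      fix K assume K: "(\<forall>j\<in>{1..n}. K (20 + n + j) = ?c j) \<and>
        (\<forall>r<20. r \<notin> {9, 10, 11, 12, 13, 14, 15, 16} \<longrightarrow> K r = N r)"
      have Kr: "K r = M r" if "r < 8" for r using K Nr[OF that] that by simp
      have K': "K 0 = k" "K 1 = n" "K 2 = 1" "K 3 = 0" "K 7 = 20 + n" using M Kr by simp_all
      have c: "K (20 + n + j) = ?c j" if "j \<in> {1..n}" for j using K that by blast
      show "wp (Seq check (Cond 8 (Add 4 4 2) (Const 5 0)))
        (\<lambda>s xs M'. s \<le> n * (n * (k * 12 + 10) + 4) + 5 \<and> xs = [] \<and> ?Q M') K"
      proof (rule wp_seq[OF check[OF K' k c]])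
        fix L assume L: "L 8 = (if has_mono_AP k n ?c then 1 else 0) \<and>
          (\<forall>r. r \<notin> {8, 9, 10, 11, 12, 13, 14, 15, 16, 17, 18} \<longrightarrow> L r = K r)"
        have Lr: "L r = M r" if "r < 8" for r using L Kr[OF that] that by simp
        have Lc: "L (20 + n + j) = ?c j" if "j \<in> {1..n}" for j using L c[OF that] by simp
        have L': "L 0 = k" "L 1 = n" "L 2 = 1" "L 3 = 0" "L 4 = z" "L 5 = 1" "L 6 = 20" "L 7 = 20 + n"
          using M Lr by simp_all
        show "wp (Cond 8 (Add 4 4 2) (Const 5 0)) (\<lambda>s xs M'. s \<le> 2 \<and> xs = [] \<and> ?Q M') L"
        proof (cases "has_mono_AP k n ?c")
          case True
          then show ?thesis using L L' M by simp
        next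
          case False
          then show ?thesis using L L' M Lc by simp
        qed
      qed simp_all
    qed simp_all
  qed (simp_all add: step_bound_def)
qed

definition search :: com where
  "search = Seq (seqs [Const 4 0, Const 5 1]) (While 5 search_step)"

lemma search:
  assumes M: "M 0 = k" "M 1 = n" "M 2 = 1" "M 3 = 0" "M 6 = 20" "M 7 = 20 + n"
    and k: "k \<ge> 1" and n: "n \<ge> 1"
    and z: "\<not> has_mono_AP k n (recseq (seed z))" "\<And>y. y < z \<Longrightarrow> has_mono_AP k n (recseq (seed y))"
  shows "wp search (\<lambda>s xs M'. s \<le> (z + 1) * (step_bound k n z + 1) + 3 \<and> xs = [] \<and>
    ((\<forall>j\<in>{1..n}. M' (20 + n + j) = recseq (seed z) j) \<and> (\<forall>r\<in>{0, 1, 2, 3, 6, 7}. M' r = M r))) M"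
proof -
  \<comment> \<open>With \<open>l\<close> iterations left the current seed is
    \<open>z + 1 - l\<close>; \<open>l = 0\<close> means that \<open>z\<close> has been accepted,
    and register 4 is then no longer described.\<close>
  let ?I = "\<lambda>l N. l \<le> z + 1 \<and> (if l = 0 then N 5 = 0 \<and> (\<forall>j\<in>{1..n}. N (20 + n + j) = recseq (seed z) j)
    else N 5 = 1 \<and> N 4 = z + 1 - l) \<and> (\<forall>r\<in>{0, 1, 2, 3, 6, 7}. N r = M r)"
  let ?M = "M(4 := 0, 5 := 1)"
  have loop: "wp (While 5 search_step) (\<lambda>s xs M'. s \<le> (z + 1) * (step_bound k n z + 1) + 1 \<and> xs = [] \<and> ?I 0 M') ?M"
  proof (rule wp_loop[where I = ?I])
    fix l N assume I: "?I (Suc l) N"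
    define y where "y = z - l"
    have y: "z + 1 - Suc l = y" "y \<le> z" "l = 0 \<longleftrightarrow> y = z" "l \<le> z" "l \<noteq> 0 \<Longrightarrow> z + 1 - l = y + 1"
      using I unfolding y_def by auto
    have N: "N 0 = k" "N 1 = n" "N 2 = 1" "N 3 = 0" "N 4 = y" "N 5 = 1" "N 6 = 20" "N 7 = 20 + n"
      using I M unfolding y(1) by simp_all
    have "step_bound k n y \<le> step_bound k n z" unfolding step_bound_def using y(2) by simp
    note B = this
    from search_step[OF N k n]
    have "wp search_step (\<lambda>s xs M'. s \<le> step_bound k n z \<and> xs = [] \<and> ?I l M') N"
    proof (rule wp_mono)
      fix s and xs :: "nat list" and M'
      assume *: "s \<le> step_bound k n y \<and> xs = [] \<and>
        ((if has_mono_AP k n (recseq (seed y)) then M' 4 = y + 1 \<and> M' 5 = 1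
          else M' 5 = 0 \<and> (\<forall>j\<in>{1..n}. M' (20 + n + j) = recseq (seed y) j)) \<and>
         (\<forall>r\<in>{0, 1, 2, 3, 6, 7}. M' r = N r))"
      have fr: "\<forall>r\<in>{0, 1, 2, 3, 6, 7}. M' r = M r" using * I by simp
      have s: "s \<le> step_bound k n z \<and> xs = []" using * B by linarith
      show "s \<le> step_bound k n z \<and> xs = [] \<and> ?I l M'"
      proof (cases "l = 0")
        case True
        then have "y = z" using y(3) by simp
        then show ?thesis using True * fr s z(1) by simp
      next
        case False
        then have "y < z" using y(2,3) by simp
        from z(2)[OF this] have "M' 4 = y + 1 \<and> M' 5 = 1" using * by simp
        then show ?thesis using False fr s y(4) unfolding y(5)[OF False] by simp
      qed
    qed
    moreover have "N 5 \<noteq> 0" using N by simp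
    ultimately show "N 5 \<noteq> 0 \<and> wp search_step (\<lambda>s xs M'. s \<le> step_bound k n z \<and> xs = [] \<and> ?I l M') N" by blast
  qed simp_all
  show ?thesis unfolding search_def
  proof (rule wp_seq[where a = 2 and R = "\<lambda>M'. M' = ?M"])
    show "wp (seqs [Const 4 0, Const 5 1]) (\<lambda>s xs M'. s \<le> 2 \<and> xs = [] \<and> M' = ?M) M" by simp
    fix N assume "N = ?M"
    show "wp (While 5 search_step) (\<lambda>s xs M'. s \<le> (z + 1) * (step_bound k n z + 1) + 1 \<and> xs = [] \<and>
      ((\<forall>j\<in>{1..n}. M' (20 + n + j) = recseq (seed z) j) \<and> (\<forall>r\<in>{0, 1, 2, 3, 6, 7}. M' r = M r))) N"
      unfolding \<open>N = ?M\<close> by (rule wp_mono[OF loop]) simp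
  qed simp
qed

definition print_colors :: com where
  "print_colors = Seq (seqs [Add 9 1 3, Add 10 7 3])
     (While 9 (seqs [Add 10 10 2, Load 11 10, Print 11, Sub 9 9 2]))"

lemma print_colors:
  assumes M: "M 1 = n" "M 2 = 1" "M 3 = 0" "M 7 = 20 + n"
    and c: "\<And>j. j \<in> {1..n} \<Longrightarrow> M (20 + n + j) = c j"
  shows "wp print_colors (\<lambda>s xs M'. s \<le> n * 5 + 3 \<and> xs = map c [1..<Suc n] \<and> True) M"
proof -
  let ?body = "seqs [Add 10 10 2, Load 11 10, Print 11, Sub 9 9 2]"
  let ?F = "\<lambda>l. map c [Suc (n - l)..<Suc n]"
  let ?I = "\<lambda>l N. l \<le> n \<and> N 9 = l \<and> N 10 = 20 + n + (n - l) \<and> (\<forall>r. r \<notin> {9, 10, 11} \<longrightarrow> N r = M r)"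
  let ?M = "M(9 := n, 10 := 20 + n)"
  have loop: "wp (While 9 ?body) (\<lambda>s xs M'. s \<le> n * (4 + 1) + 1 \<and> xs = ?F n \<and> ?I 0 M') ?M"
  proof (rule wp_loop_print[where I = ?I and F = ?F])
    fix l N assume I: "?I (Suc l) N"
    define h where "h = n - Suc l"
    have h: "n - Suc l = h" "n - l = Suc h" "l \<le> n" "Suc h \<in> {1..n}" using I unfolding h_def by auto
    have N: "N 10 = 20 + n + h" "N 9 = Suc l" using I unfolding h(1) by blast+
    have Nr: "N r = M r" if "r \<notin> {9, 10, 11}" for r using I that by blast
    have N2: "N 2 = 1" using Nr[of 2] M by simp
    have Nh: "N (20 + n + Suc h) = c (Suc h)" using Nr[of "20 + n + Suc h"] c[OF h(4)] by simp
    have F: "?F (Suc l) = c (Suc h) # ?F l" unfolding h(1,2) using h(4) by (simp add: upt_conv_Cons del: upt_Suc)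
    have "wp ?body (\<lambda>s xs M'. s \<le> 4 \<and> xs = [c (Suc h)] \<and> M' 9 = l \<and> M' 10 = 20 + n + Suc h \<and>
      (\<forall>r. r \<notin> {9, 10, 11} \<longrightarrow> M' r = N r)) N"
      using N N2 Nh by simp
    then have "wp ?body (\<lambda>s xs M'. s \<le> 4 \<and> ?F (Suc l) = xs @ ?F l \<and> ?I l M') N"
    proof (rule wp_mono)
      fix s and xs :: "nat list" and M'
      assume *: "s \<le> 4 \<and> xs = [c (Suc h)] \<and> M' 9 = l \<and> M' 10 = 20 + n + Suc h \<and>
        (\<forall>r. r \<notin> {9, 10, 11} \<longrightarrow> M' r = N r)"
      have "M' r = M r" if "r \<notin> {9, 10, 11}" for r using * Nr[OF that] that by metis
      moreover have "?F (Suc l) = xs @ ?F l" using * F by simp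
      ultimately show "s \<le> 4 \<and> ?F (Suc l) = xs @ ?F l \<and> ?I l M'" using * h(3) unfolding h(2) by blast
    qed
    moreover have "N 9 \<noteq> 0" using N by simp
    ultimately show "N 9 \<noteq> 0 \<and> wp ?body (\<lambda>s xs M'. s \<le> 4 \<and> ?F (Suc l) = xs @ ?F l \<and> ?I l M') N" by blast
  qed simp_all
  show ?thesis unfolding print_colors_def
  proof (rule wp_seq[where a = 2 and R = "\<lambda>M'. M' = ?M"])
    show "wp (seqs [Add 9 1 3, Add 10 7 3]) (\<lambda>s xs M'. s \<le> 2 \<and> xs = [] \<and> M' = ?M) M" using M by simp
    fix N assume "N = ?M"
    show "wp (While 9 ?body) (\<lambda>s xs M'. s \<le> n * 5 + 1 \<and> xs = map c [1..<Suc n] \<and> True) N"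
      unfolding \<open>N = ?M\<close>
    proof (rule wp_mono[OF loop])
      fix s and xs :: "nat list" and M'
      assume *: "s \<le> n * (4 + 1) + 1 \<and> xs = ?F n \<and> ?I 0 M'"
      have "?F n = map c [1..<Suc n]" by (simp only: diff_self_eq_0 One_nat_def)
      moreover have "s \<le> n * 5 + 1" using * by simp
      ultimately show "s \<le> n * 5 + 1 \<and> xs = map c [1..<Suc n] \<and> True" using * by blast
    qed
  qed simp
qed

definition color_main :: com where
  "color_main = Seq (seqs [Const 2 1, Const 3 0, Const 6 20, Add 7 6 1])
     (Cond 1 (Seq search print_colors) Skip)"

text \<open>The search stops at the least successful seed, so the printed coloring need not come
  from \<open>z\<close> itself, which merely bounds the time. The description of the memory is
  confined to registers 0 and 1, because a relocated program will have run before and left its own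
  values elsewhere.\<close>

lemma color_main:
  assumes M: "M 0 = k" "M 1 = n" and k: "k \<ge> 1" and z: "proper_coloring k n (recseq (seed z))"
  shows "wp color_main (\<lambda>s xs M'. s \<le> (z + 1) * (step_bound k n z + 1) + n * 5 + 12 \<and>
    outputs_proper_coloring k n xs) M"
proof -
  define y where "y = (LEAST y. \<not> has_mono_AP k n (recseq (seed y)))"
  have ex: "\<not> has_mono_AP k n (recseq (seed z))" using z unfolding proper_coloring_def by blast
  have y: "\<not> has_mono_AP k n (recseq (seed y))" "y \<le> z" "\<And>x. x < y \<Longrightarrow> has_mono_AP k n (recseq (seed x))"
  proof -
    let ?P = "\<lambda>y. \<not> has_mono_AP k n (recseq (seed y))"
    show "\<not> has_mono_AP k n (recseq (seed y))" unfolding y_def by (rule LeastI[of ?P, OF ex])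
    show "y \<le> z" unfolding y_def by (rule Least_le[of ?P, OF ex])
    show "has_mono_AP k n (recseq (seed x))" if "x < y" for x
      using not_less_Least[of x ?P] that unfolding y_def by blast
  qed
  have pc: "proper_coloring k n (recseq (seed y))"
    unfolding proper_coloring_def using y(1) two_coloring_recseq by blast
  let ?M = "M(2 := 1, 3 := 0, 6 := 20, 7 := 20 + n)"
  let ?out = "map (recseq (seed y)) [1..<Suc n]"
  have out: "outputs_proper_coloring k n ?out" unfolding outputs_proper_coloring_def using pc by blast
  let ?T = "(y + 1) * (step_bound k n y + 1) + n * 5"
  have run: "wp color_main (\<lambda>s xs M'. s \<le> ?T + 12 \<and> xs = ?out \<and> True) M"
    unfolding color_main_def
  proof (rule wp_seq[where a = 4 and R = "\<lambda>M'. M' = ?M"])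
    show "wp (seqs [Const 2 1, Const 3 0, Const 6 20, Add 7 6 1]) (\<lambda>s xs M'. s \<le> 4 \<and> xs = [] \<and> M' = ?M) M"
      using M by simp
    fix N assume N: "N = ?M"
    show "wp (Cond 1 (Seq search print_colors) Skip) (\<lambda>s xs M'. s \<le> ?T + 8 \<and> xs = ?out \<and> True) N"
    \<comment> \<open>\<open>generate\<close> stores a color for the point 1 and so presumes
      \<open>n >= 1\<close>; for \<open>n = 0\<close> nothing is printed.\<close>
    proof (cases "n = 0")
      case True
      then show ?thesis unfolding N using M by simp
    next
      case False
      have N': "N 0 = k" "N 1 = n" "N 2 = 1" "N 3 = 0" "N 6 = 20" "N 7 = 20 + n" unfolding N using M by simp_all
      have n: "n \<ge> 1" using False by simp
      have "wp (Seq search print_colors) (\<lambda>s xs M'. s \<le> ?T + 6 \<and> xs = ?out \<and> True) N"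
      proof (rule wp_seq[OF search[OF N' k n y(1,3)]])
        fix K assume K: "(\<forall>j\<in>{1..n}. K (20 + n + j) = recseq (seed y) j) \<and> (\<forall>r\<in>{0, 1, 2, 3, 6, 7}. K r = N r)"
        then show "wp print_colors (\<lambda>s xs M'. s \<le> n * 5 + 3 \<and> xs = ?out \<and> True) K"
          using N' by (intro print_colors) simp_all
      qed simp_all
      then have "wp (Seq search print_colors) (\<lambda>s xs M'. Suc s \<le> ?T + 8 \<and> xs = ?out \<and> True) N"
        by (rule wp_mono) simp
      then show ?thesis using N'(2) n by (subst wp_Cond) (simp del: wp_Seq)
    qed
  qed simp
  have "(y + 1) * (step_bound k n y + 1) \<le> (z + 1) * (step_bound k n z + 1)"
    using y(2) unfolding step_bound_def by (intro mult_le_mono add_le_mono) auto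
  then have le: "?T \<le> (z + 1) * (step_bound k n z + 1) + n * 5" by (rule add_le_mono1)
  show ?thesis
  proof (rule wp_mono[OF run])
    fix s and xs :: "nat list" and M'
    assume "s \<le> ?T + 12 \<and> xs = ?out \<and> True"
    then show "s \<le> (z + 1) * (step_bound k n z + 1) + n * 5 + 12 \<and> outputs_proper_coloring k n xs"
      using le out order_trans[OF _ add_le_mono1[OF le, of 12]] by blast
  qed
qed

section \<open>Relocating a program\<close>

text \<open>
  \<open>relocate Q\<close> simulates \<open>Q\<close> with register \<open>r\<close> moved to \<open>20 + r\<close>, and puts the last printed number
  into register 1. Registers 3 and 18 must hold 0 and 20, and register 19 is used for addresses.
\<close>

fun relocate :: "com \<Rightarrow> com" where
  "relocate Skip = Skip"
| "relocate (Const r x) = Const (20 + r) x"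
| "relocate (Add r i j) = Add (20 + r) (20 + i) (20 + j)"
| "relocate (Sub r i j) = Sub (20 + r) (20 + i) (20 + j)"
| "relocate (Load r i) = Seq (Add 19 (20 + i) 18) (Load (20 + r) 19)"
| "relocate (Store r i) = Seq (Add 19 (20 + r) 18) (Store 19 (20 + i))"
| "relocate (Print i) = Add 1 (20 + i) 3"
| "relocate (Seq P Q) = Seq (relocate P) (relocate Q)"
| "relocate (Cond i P Q) = Cond (20 + i) (relocate P) (relocate Q)"
| "relocate (While i P) = While (20 + i) (relocate P)"

lemma wp_WhileTrue:
  assumes "M i \<noteq> 0" "wp P (\<lambda>s xs M'. wp (While i P) (\<lambda>t ys M''. Q (1 + s + t) (xs @ ys) M'') M') M"
  shows "wp (While i P) Q M"
  using assms unfolding wp_def by (blast intro: steps.WhileTrue)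

lemma wp_WhileFalse: "M i = 0 \<Longrightarrow> Q 1 [] M \<Longrightarrow> wp (While i P) Q M"
  unfolding wp_def by (blast intro: steps.WhileFalse)

definition simulates :: "memory \<Rightarrow> memory \<Rightarrow> bool" where
  "simulates M N \<longleftrightarrow> (\<forall>r. N (20 + r) = M r) \<and> N 3 = 0 \<and> N 18 = 20"

lemma simulates_upd: "simulates M N \<Longrightarrow> simulates (M(r := x)) (N(20 + r := x))"
  unfolding simulates_def by auto

lemma simulates_low: "simulates M N \<Longrightarrow> r < 20 \<Longrightarrow> r \<notin> {3, 18} \<Longrightarrow> simulates M (N(r := x))"
  unfolding simulates_def by auto

lemma last_Cons_append: "last (x # xs @ ys) = last (last (x # xs) # ys)"
  by (cases ys) auto

text \<open>Every instruction costs at least 1 and becomes at most two instructions, whence the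
  factor 2. If nothing is printed, register 1 keeps its value, as \<open>last (N 1 # xs)\<close>
  expresses.\<close>

lemma wp_relocate:
  "exec P M t xs M' \<Longrightarrow> simulates M N \<Longrightarrow>
    wp (relocate P) (\<lambda>s ys N'. s \<le> 2 * t \<and> ys = [] \<and> simulates M' N' \<and> N' 1 = last (N 1 # xs) \<and> N' 0 = N 0) N"
proof (induction arbitrary: N rule: exec.induct)
  case (Load r i M)
  then have "N (20 + i) = M i" "N 18 = 20" "N (M i + 20) = M (M i)"
    unfolding simulates_def by (simp_all add: add.commute[of "M i"])
  then show ?case
    using simulates_upd[OF simulates_low[OF Load, of 19 "M i + 20"], of r "M (M i)"]
    by (simp del: fun_upd_apply add: fun_upd_same fun_upd_other)
next
  case (Store r i M)
  then have *: "N (20 + i) = M i" "N (20 + r) = M r" "N 18 = 20"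
    unfolding simulates_def by simp_all
  then show ?case
    using simulates_upd[OF simulates_low[OF Store, of 19 "M r + 20"], of "M r" "M i"]
    by (simp del: fun_upd_apply add: fun_upd_same fun_upd_other add.commute[of "M r"])
next
  case (Print i M)
  then have *: "N (20 + i) = M i" "N 3 = 0" unfolding simulates_def by simp_all
  then show ?case using simulates_low[OF Print, of 1 "M i"] by simp
next
  case (Seq P M s xs M' Q t ys M'')
  show ?case unfolding relocate.simps wp_Seq
  proof (rule wp_mono[OF Seq.IH(1)[OF Seq.prems]])
    fix u and zs :: "nat list" and N'
    assume 1: "u \<le> 2 * s \<and> zs = [] \<and> simulates M' N' \<and> N' 1 = last (N 1 # xs) \<and> N' 0 = N 0"
    then have sim: "simulates M' N'" by blast
    show "wp (relocate Q) (\<lambda>v ys' N''. u + v \<le> 2 * (s + t) \<and> zs @ ys' = [] \<and> simulates M'' N'' \<and>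
        N'' 1 = last (N 1 # xs @ ys) \<and> N'' 0 = N 0) N'"
      by (rule wp_mono[OF Seq.IH(2)[OF sim]]) (use 1 in \<open>simp add: last_Cons_append\<close>)
  qed
next
  case (CondTrue M i P t xs M' Q)
  have "N (20 + i) \<noteq> 0" using CondTrue unfolding simulates_def by simp
  moreover have "wp (relocate P) (\<lambda>s ys N'. Suc s \<le> 2 * (1 + digits (M i) + t) \<and> ys = [] \<and> simulates M' N' \<and>
      N' 1 = last (N 1 # xs) \<and> N' 0 = N 0) N"
    by (rule wp_mono[OF CondTrue.IH[OF CondTrue.prems]]) simp
  ultimately show ?case by simp
next
  case (CondFalse M i Q t xs M' P)
  have "N (20 + i) = 0" using CondFalse unfolding simulates_def by simp
  moreover have "wp (relocate Q) (\<lambda>s ys N'. Suc s \<le> 2 * (1 + t) \<and> ys = [] \<and> simulates M' N' \<and>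
      N' 1 = last (N 1 # xs) \<and> N' 0 = N 0) N"
    by (rule wp_mono[OF CondFalse.IH[OF CondFalse.prems]]) simp
  ultimately show ?case by simp
next
  case (WhileTrue M i P s xs M' t ys M'')
  have N: "N (20 + i) \<noteq> 0" using WhileTrue unfolding simulates_def by simp
  show ?case unfolding relocate.simps
  proof (rule wp_WhileTrue[where M = N and i = "20 + i", OF N], rule wp_mono[OF WhileTrue.IH(1)[OF WhileTrue.prems]])
    fix u and zs :: "nat list" and N'
    assume 1: "u \<le> 2 * s \<and> zs = [] \<and> simulates M' N' \<and> N' 1 = last (N 1 # xs) \<and> N' 0 = N 0"
    then have sim: "simulates M' N'" by blast
    show "wp (While (20 + i) (relocate P)) (\<lambda>v ys' N''. 1 + u + v \<le> 2 * (1 + digits (M i) + s + t) \<and> zs @ ys' = [] \<and>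
        simulates M'' N'' \<and> N'' 1 = last (N 1 # xs @ ys) \<and> N'' 0 = N 0) N'"
      by (rule wp_mono[OF WhileTrue.IH(2)[OF sim, unfolded relocate.simps]]) (use 1 in \<open>simp add: last_Cons_append\<close>)
  qed
next
  case (WhileFalse M i P)
  then have "N (20 + i) = 0" unfolding simulates_def by simp
  then show ?case unfolding relocate.simps using WhileFalse by (intro wp_WhileFalse) simp_all
next
  case (Const r x M)
  then show ?case using simulates_upd[OF Const]
    by (simp del: fun_upd_apply add: fun_upd_same fun_upd_other)
next
  case (Add r i j M)
  then have "N (20 + i) = M i" "N (20 + j) = M j" unfolding simulates_def by simp_all
  then show ?case using simulates_upd[OF Add]
    by (simp del: fun_upd_apply add: fun_upd_same fun_upd_other)
next
  case (Sub r i j M)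
  then have "N (20 + i) = M i" "N (20 + j) = M j" unfolding simulates_def by simp_all
  then show ?case using simulates_upd[OF Sub]
    by (simp del: fun_upd_apply add: fun_upd_same fun_upd_other)
qed simp

section \<open>Computing the length\<close>

definition repeat :: "nat \<Rightarrow> nat \<Rightarrow> com \<Rightarrow> com" where
  "repeat c y P = Seq (Add c y 3) (While c (Seq P (Sub c c 2)))"

text \<open>The invariant counts completed rounds and must be insensitive to the counter register,
  which is the assumption \<open>upd\<close>. The counter is a copy of register \<open>y\<close>, so
  that the loop need not destroy its bound.\<close>

lemma wp_repeat:
  assumes init: "I 0 M" "M 3 = 0" "M y = m"
    and body: "\<And>l N. l < m \<Longrightarrow> I l N \<Longrightarrow>
      wp P (\<lambda>s xs N'. s \<le> B \<and> xs = [] \<and> (I (Suc l) N' \<and> N' c = N c)) N"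
    and upd: "\<And>l N v. I l N \<Longrightarrow> I l (N(c := v))"
    and one: "\<And>l N. I l N \<Longrightarrow> N 2 = 1"
  shows "wp (repeat c y P) (\<lambda>s xs N'. s \<le> m * (B + 2) + 2 \<and> xs = [] \<and> I m N') M"
proof -
  let ?J = "\<lambda>l N. l \<le> m \<and> N c = l \<and> I (m - l) N"
  have "?J m (M(c := m))" using upd[OF init(1)] by simp
  note J0 = this
  have loop: "wp (While c (Seq P (Sub c c 2))) (\<lambda>s xs N'. s \<le> m * ((B + 1) + 1) + 1 \<and> xs = [] \<and> ?J 0 N') (M(c := m))"
  proof (rule wp_loop[where I = ?J, OF _ _ J0])
    fix l N assume J: "?J (Suc l) N"
    define h where "h = m - Suc l"
    have h: "m - Suc l = h" "m - l = Suc h" "h < m" "l \<le> m" using J unfolding h_def by auto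
    have N: "I h N" "N c = Suc l" using J unfolding h(1) by auto
    have "wp (Seq P (Sub c c 2)) (\<lambda>s xs N'. s \<le> B + 1 \<and> xs = [] \<and> ?J l N') N"
    proof (rule wp_seq[OF body[OF h(3) N(1)]])
      fix N' assume N': "I (Suc h) N' \<and> N' c = N c"
      then have "N' 2 = 1" using one by blast
      moreover have "I (Suc h) (N'(c := l))" using upd N' by blast
      ultimately show "wp (Sub c c 2) (\<lambda>s xs N'. s \<le> 1 \<and> xs = [] \<and> ?J l N') N'"
        using N' N(2) h(4) unfolding h(2) by simp
    qed simp
    moreover have "N c \<noteq> 0" using N by simp
    ultimately show "N c \<noteq> 0 \<and> wp (Seq P (Sub c c 2)) (\<lambda>s xs N'. s \<le> B + 1 \<and> xs = [] \<and> ?J l N') N"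
      by blast
  qed simp
  show ?thesis unfolding repeat_def
  proof (rule wp_seq[where a = 1 and R = "\<lambda>M'. M' = M(c := m)"])
    show "wp (Add c y 3) (\<lambda>s xs M'. s \<le> 1 \<and> xs = [] \<and> M' = M(c := m)) M" using init by simp
    fix N assume "N = M(c := m)"
    show "wp (While c (Seq P (Sub c c 2))) (\<lambda>s xs N'. s \<le> m * (B + 2) + 1 \<and> xs = [] \<and> I m N') N"
      unfolding \<open>N = M(c := m)\<close> by (rule wp_mono[OF loop]) simp
  qed simp
qed

text \<open>Time is linear in the multiplier in register \<open>y\<close>, while the multiplicand in
  \<open>x\<close> may be huge. All uses keep factorials and large powers in \<open>x\<close> and a
  number of size \<open>2 ^ O(k)\<close> in \<open>y\<close>.\<close>

definition mul :: "nat \<Rightarrow> nat \<Rightarrow> com" where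
  "mul x y = Seq (seqs [Add 10 x 3, Const x 0]) (repeat 11 y (Add x x 10))"

lemma wp_mul:
  assumes "M 2 = 1" "M 3 = 0" "x \<notin> {2, 3, 10, 11}" "y \<notin> {10, 11}" "x \<noteq> y"
  shows "wp (mul x y) (\<lambda>s xs M'. s \<le> M y * 3 + 4 \<and> xs = [] \<and>
    (M' x = M x * M y \<and> (\<forall>r. r \<notin> {x, 10, 11} \<longrightarrow> M' r = M r))) M"
proof -
  let ?M = "M(10 := M x, x := 0)"
  let ?I = "\<lambda>l N. N x = M x * l \<and> N 10 = M x \<and> (\<forall>r. r \<notin> {x, 10, 11} \<longrightarrow> N r = M r)"
  show ?thesis unfolding mul_def
  proof (rule wp_seq[where a = 2 and R = "\<lambda>N. N = ?M"])
    show "wp (seqs [Add 10 x 3, Const x 0]) (\<lambda>s xs N. s \<le> 2 \<and> xs = [] \<and> N = ?M) M" using assms by simp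
    fix N assume N: "N = ?M"
    have "wp (repeat 11 y (Add x x 10)) (\<lambda>s xs N'. s \<le> M y * (1 + 2) + 2 \<and> xs = [] \<and> ?I (M y) N') N"
    proof (rule wp_repeat[where I = ?I])
      fix l K assume "?I l K"
      then show "wp (Add x x 10) (\<lambda>s xs N'. s \<le> 1 \<and> xs = [] \<and> (?I (Suc l) N' \<and> N' 11 = K 11)) K"
        using assms by simp
    qed (use assms in \<open>auto simp: N\<close>)
    then show "wp (repeat 11 y (Add x x 10)) (\<lambda>s xs M'. s \<le> M y * 3 + 2 \<and> xs = [] \<and>
      (M' x = M x * M y \<and> (\<forall>r. r \<notin> {x, 10, 11} \<longrightarrow> M' r = M r))) N"
      by (rule wp_mono) simp
  qed simp
qed

definition mul_power2 :: "nat \<Rightarrow> nat \<Rightarrow> nat \<Rightarrow> com" where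
  "mul_power2 z x y = repeat 8 x (repeat 9 y (Add z z z))"

lemma wp_mul_power2:
  assumes "M 2 = 1" "M 3 = 0" "z \<notin> {2, 3, 8, 9}" "x \<notin> {8, 9, z}" "y \<notin> {8, 9, z}"
  shows "wp (mul_power2 z x y) (\<lambda>s xs M'. s \<le> M x * (M y * 3 + 2 + 2) + 2 \<and> xs = [] \<and>
    (M' z = M z * 2 ^ (M x * M y) \<and> (\<forall>r. r \<notin> {z, 8, 9} \<longrightarrow> M' r = M r))) M"
proof -
  let ?I = "\<lambda>l N. N z = M z * 2 ^ (l * M y) \<and> (\<forall>r. r \<notin> {z, 8, 9} \<longrightarrow> N r = M r)"
  have "wp (mul_power2 z x y) (\<lambda>s xs M'. s \<le> M x * ((M y * 3 + 2) + 2) + 2 \<and> xs = [] \<and> ?I (M x) M') M"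
    unfolding mul_power2_def
  proof (rule wp_repeat[where I = ?I])
    fix l N assume I: "?I l N"
    let ?K = "\<lambda>j K. K z = N z * 2 ^ j \<and> (\<forall>r. r \<notin> {z, 9} \<longrightarrow> K r = N r)"
    have N: "N 2 = 1" "N 3 = 0" "N y = M y" using I assms by auto
    have "wp (repeat 9 y (Add z z z)) (\<lambda>s xs N'. s \<le> M y * (1 + 2) + 2 \<and> xs = [] \<and> ?K (M y) N') N"
    proof (rule wp_repeat[where I = ?K])
      fix j K assume "?K j K"
      then show "wp (Add z z z) (\<lambda>s xs N'. s \<le> 1 \<and> xs = [] \<and> (?K (Suc j) N' \<and> N' 9 = K 9)) K"
        using assms by simp
    qed (use assms N in auto)
    then show "wp (repeat 9 y (Add z z z)) (\<lambda>s xs N'. s \<le> M y * 3 + 2 \<and> xs = [] \<and> (?I (Suc l) N' \<and> N' 8 = N 8)) N"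
      by (rule wp_mono) (use I assms in \<open>auto simp: power_add\<close>)
  qed (use assms in auto)
  then show ?thesis by (rule wp_mono) blast
qed

definition mul_power :: "nat \<Rightarrow> nat \<Rightarrow> nat \<Rightarrow> com" where
  "mul_power z x y = repeat 8 x (mul z y)"

lemma wp_mul_power:
  assumes "M 2 = 1" "M 3 = 0" "z \<notin> {2, 3, 8, 10, 11}" "x \<notin> {8, 10, 11, z}" "y \<notin> {8, 10, 11, z}"
  shows "wp (mul_power z x y) (\<lambda>s xs M'. s \<le> M x * (M y * 3 + 4 + 2) + 2 \<and> xs = [] \<and>
    (M' z = M z * M y ^ M x \<and> (\<forall>r. r \<notin> {z, 8, 10, 11} \<longrightarrow> M' r = M r))) M"
proof -
  let ?I = "\<lambda>l N. N z = M z * M y ^ l \<and> (\<forall>r. r \<notin> {z, 8, 10, 11} \<longrightarrow> N r = M r)"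
  have "wp (mul_power z x y) (\<lambda>s xs M'. s \<le> M x * ((M y * 3 + 4) + 2) + 2 \<and> xs = [] \<and> ?I (M x) M') M"
    unfolding mul_power_def
  proof (rule wp_repeat[where I = ?I])
    fix l N assume I: "?I l N"
    have N: "N 2 = 1" "N 3 = 0" "N y = M y" using I assms by auto
    have "wp (mul z y) (\<lambda>s xs M'. s \<le> N y * 3 + 4 \<and> xs = [] \<and>
      (M' z = N z * N y \<and> (\<forall>r. r \<notin> {z, 10, 11} \<longrightarrow> M' r = N r))) N"
      using assms N by (intro wp_mul) auto
    then show "wp (mul z y) (\<lambda>s xs N'. s \<le> M y * 3 + 4 \<and> xs = [] \<and> (?I (Suc l) N' \<and> N' 8 = N 8)) N"
      by (rule wp_mono) (use I N assms in auto)
  qed (use assms in auto)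
  then show ?thesis by (rule wp_mono) blast
qed

text \<open>The partial sum up to \<open>J\<close> of the series of \<open>exp d\<close>, multiplied
  by \<open>fact J\<close>; the common denominator keeps the computation within the
  integers.\<close>

fun exp_num :: "nat \<Rightarrow> nat \<Rightarrow> nat" where
  "exp_num d 0 = 1"
| "exp_num d (Suc J) = Suc J * exp_num d J + d ^ Suc J"

lemma exp_num: "real (exp_num d J) = fact J * (\<Sum>i\<le>J. real d ^ i / fact i)"
proof (induction J)
  case (Suc J)
  have "fact (Suc J) * (\<Sum>i\<le>Suc J. real d ^ i / fact i) =
      real (Suc J) * (fact J * (\<Sum>i\<le>J. real d ^ i / fact i)) + real d ^ Suc J"
    by (simp add: distrib_left del: power_Suc of_nat_Suc)
  also have "\<dots> = real (exp_num d (Suc J))"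
    unfolding Suc.IH[symmetric] by (simp add: algebra_simps)
  finally show ?case by simp
qed simp

text \<open>Registers 5, 6, 7 and 12 hold \<open>fact j\<close>, \<open>exp_num d j\<close>, \<open>d ^ j\<close> and \<open>j\<close>.\<close>

definition exp_step :: com where
  "exp_step = Seq (Add 12 12 2) (Seq (mul 5 12) (Seq (mul 6 12) (Seq (mul 7 18) (Add 6 6 7))))"

lemma wp_exp_step:
  assumes M: "M 2 = 1" "M 3 = 0" "M 5 = fact j" "M 6 = exp_num d j" "M 7 = d ^ j" "M 12 = j" "M 18 = d"
    and j: "j < J"
  shows "wp exp_step (\<lambda>s xs M'. s \<le> J * 6 + d * 3 + 14 \<and> xs = [] \<and>
    (M' 5 = fact (Suc j) \<and> M' 6 = exp_num d (Suc j) \<and> M' 7 = d ^ Suc j \<and> M' 12 = Suc j \<and>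
     (\<forall>r. r \<notin> {5, 6, 7, 10, 11, 12} \<longrightarrow> M' r = M r))) M"
proof -
  let ?Q = "\<lambda>M'. M' 5 = fact (Suc j) \<and> M' 6 = exp_num d (Suc j) \<and> M' 7 = d ^ Suc j \<and> M' 12 = Suc j \<and>
     (\<forall>r. r \<notin> {5, 6, 7, 10, 11, 12} \<longrightarrow> M' r = M r)"
  let ?R = "\<lambda>a b c N. N 5 = a \<and> N 6 = b \<and> N 7 = c \<and> N 12 = Suc j \<and>
     (\<forall>r. r \<notin> {5, 6, 7, 10, 11, 12} \<longrightarrow> N r = M r)"
  let ?e = "exp_num d j"
  have fr: "N 2 = 1" "N 3 = 0" "N 18 = d" if "?R a b c N" for a b c N using that M by simp_all
  show ?thesis unfolding exp_step_def
  proof (rule wp_seq[where a = 1 and b = "J * 6 + d * 3 + 13" and R = "?R (fact j) ?e (d ^ j)"])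
    show "wp (Add 12 12 2) (\<lambda>s xs N. s \<le> 1 \<and> xs = [] \<and> ?R (fact j) ?e (d ^ j) N) M" using M by simp
    fix N1 assume R1: "?R (fact j) ?e (d ^ j) N1"
    show "wp (Seq (mul 5 12) (Seq (mul 6 12) (Seq (mul 7 18) (Add 6 6 7))))
      (\<lambda>s xs M'. s \<le> J * 6 + d * 3 + 13 \<and> xs = [] \<and> ?Q M') N1"
    proof (rule wp_seq[where a = "J * 3 + 4" and b = "J * 3 + d * 3 + 9" and R = "?R (fact j * Suc j) ?e (d ^ j)"])
      show "wp (mul 5 12) (\<lambda>s xs N. s \<le> J * 3 + 4 \<and> xs = [] \<and> ?R (fact j * Suc j) ?e (d ^ j) N) N1"
        by (rule wp_mono[OF wp_mul[of N1 5 12]]) (use R1 fr[OF R1] j in simp_all)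
      fix N2 assume R2: "?R (fact j * Suc j) ?e (d ^ j) N2"
      show "wp (Seq (mul 6 12) (Seq (mul 7 18) (Add 6 6 7)))
        (\<lambda>s xs M'. s \<le> J * 3 + d * 3 + 9 \<and> xs = [] \<and> ?Q M') N2"
      proof (rule wp_seq[where a = "J * 3 + 4" and b = "d * 3 + 5" and R = "?R (fact j * Suc j) (?e * Suc j) (d ^ j)"])
        show "wp (mul 6 12) (\<lambda>s xs N. s \<le> J * 3 + 4 \<and> xs = [] \<and> ?R (fact j * Suc j) (?e * Suc j) (d ^ j) N) N2"
          by (rule wp_mono[OF wp_mul[of N2 6 12]]) (use R2 fr[OF R2] j in simp_all)
        fix N3 assume R3: "?R (fact j * Suc j) (?e * Suc j) (d ^ j) N3"
        show "wp (Seq (mul 7 18) (Add 6 6 7)) (\<lambda>s xs M'. s \<le> d * 3 + 5 \<and> xs = [] \<and> ?Q M') N3"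
        proof (rule wp_seq[where a = "d * 3 + 4" and b = 1 and R = "?R (fact j * Suc j) (?e * Suc j) (d ^ j * d)"])
          show "wp (mul 7 18) (\<lambda>s xs N. s \<le> d * 3 + 4 \<and> xs = [] \<and> ?R (fact j * Suc j) (?e * Suc j) (d ^ j * d) N) N3"
            by (rule wp_mono[OF wp_mul[of N3 7 18]]) (use R3 fr[OF R3] in simp_all)
          fix N4 assume "?R (fact j * Suc j) (?e * Suc j) (d ^ j * d) N4"
          then show "wp (Add 6 6 7) (\<lambda>s xs M'. s \<le> 1 \<and> xs = [] \<and> ?Q M') N4"
            by (simp add: mult.commute)
        qed simp
      qed simp
    qed simp
  qed simp
qed

text \<open>Tests whether one more than register 15 still fits. Register 17 becomes 1 minus a
  truncated difference, hence 1 exactly when the left side is at most the content of register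
  13.\<close>

definition trial :: com where
  "trial = Seq (seqs [Add 16 14 3, Add 12 15 2]) (Seq (mul_power 16 18 12) (seqs [Sub 17 16 13, Sub 17 2 17]))"

lemma wp_trial:
  assumes M: "M 2 = 1" "M 3 = 0" "M 13 = G" "M 14 = U" "M 15 = n" "M 18 = d" and n: "n \<le> N"
  shows "wp trial (\<lambda>s xs M'. s \<le> d * (N * 3 + 9) + 6 \<and> xs = [] \<and>
    (M' 17 = (if U * Suc n ^ d \<le> G then 1 else 0) \<and> (\<forall>r. r \<notin> {8, 10, 11, 12, 16, 17} \<longrightarrow> M' r = M r))) M"
proof -
  let ?Q = "\<lambda>M'. M' 17 = (if U * Suc n ^ d \<le> G then 1 else 0) \<and> (\<forall>r. r \<notin> {8, 10, 11, 12, 16, 17} \<longrightarrow> M' r = M r)"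
  let ?M = "M(16 := U, 12 := Suc n)"
  show ?thesis unfolding trial_def
  proof (rule wp_seq[where a = 2 and R = "\<lambda>N. N = ?M"])
    show "wp (seqs [Add 16 14 3, Add 12 15 2]) (\<lambda>s xs N. s \<le> 2 \<and> xs = [] \<and> N = ?M) M"
      using M by simp
    fix K assume K: "K = ?M"
    have K': "K 2 = 1" "K 3 = 0" "K 18 = d" "K 12 = Suc n" "K 16 = U" unfolding K using M by simp_all
    show "wp (Seq (mul_power 16 18 12) (seqs [Sub 17 16 13, Sub 17 2 17]))
      (\<lambda>s xs M'. s \<le> d * (N * 3 + 9) + 4 \<and> xs = [] \<and> ?Q M') K"
    proof (rule wp_seq[where a = "d * (N * 3 + 9) + 2" and b = 2
          and R = "\<lambda>L. L 16 = U * Suc n ^ d \<and> (\<forall>r. r \<notin> {8, 10, 11, 12, 16} \<longrightarrow> L r = M r)"])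
      show "wp (mul_power 16 18 12) (\<lambda>s xs L. s \<le> d * (N * 3 + 9) + 2 \<and> xs = [] \<and>
        (L 16 = U * Suc n ^ d \<and> (\<forall>r. r \<notin> {8, 10, 11, 12, 16} \<longrightarrow> L r = M r))) K"
      proof (rule wp_mono[OF wp_mul_power[of K 16 18 12]])
        fix s and xs :: "nat list" and L
        assume *: "s \<le> K 18 * (K 12 * 3 + 4 + 2) + 2 \<and> xs = [] \<and>
          L 16 = K 16 * K 12 ^ K 18 \<and> (\<forall>r. r \<notin> {16, 8, 10, 11} \<longrightarrow> L r = K r)"
        have "d * (Suc n * 3 + 4 + 2) \<le> d * (N * 3 + 9)" using n by (intro mult_le_mono2) simp
        then have "s \<le> d * (N * 3 + 9) + 2" using * unfolding K' by linarith
        moreover have "L r = M r" if "r \<notin> {8, 10, 11, 12, 16}" for r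
        proof -
          have "L r = K r" using * that by blast
          then show ?thesis unfolding K using that by simp
        qed
        ultimately show "s \<le> d * (N * 3 + 9) + 2 \<and> xs = [] \<and>
          (L 16 = U * Suc n ^ d \<and> (\<forall>r. r \<notin> {8, 10, 11, 12, 16} \<longrightarrow> L r = M r))"
          using * unfolding K' by blast
      qed (use K' in simp_all)
      fix L :: memory assume L: "L 16 = U * Suc n ^ d \<and> (\<forall>r. r \<notin> {8, 10, 11, 12, 16} \<longrightarrow> L r = M r)"
      obtain w where w: "w = U * Suc n ^ d" by blast
      have "L 13 = G" "L 2 = 1" "L 16 = w" using L M w by simp_all
      moreover have "L r = M r" if "r \<notin> {8, 10, 11, 12, 16, 17}" for r using L that by blast
      ultimately show "wp (seqs [Sub 17 16 13, Sub 17 2 17]) (\<lambda>s xs M'. s \<le> 2 \<and> xs = [] \<and> ?Q M') L"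
        unfolding w[symmetric] by simp
    qed simp
  qed simp
qed

definition count_loop :: com where
  "count_loop = While 17 (Seq (Add 15 15 2) trial)"

lemma wp_count_loop:
  assumes M: "M 2 = 1" "M 3 = 0" "M 13 = G" "M 14 = U" "M 15 = 0" "M 18 = d" "M 17 = (if U * 1 ^ d \<le> G then 1 else 0)"
    and N: "\<And>m. m \<in> {1..N} \<Longrightarrow> U * m ^ d \<le> G" "\<not> U * Suc N ^ d \<le> G"
  shows "wp count_loop (\<lambda>s xs M'. s \<le> N * (d * (N * 3 + 9) + 8) + 1 \<and> xs = [] \<and> M' 15 = N) M"
proof -
  let ?I = "\<lambda>l K. l \<le> N \<and> K 15 = N - l \<and> K 17 = (if l = 0 then 0 else 1) \<and>
    (\<forall>r\<in>{2, 3, 13, 14, 18}. K r = M r)"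
  have "wp count_loop (\<lambda>s xs M'. s \<le> N * ((d * (N * 3 + 9) + 7) + 1) + 1 \<and> xs = [] \<and> ?I 0 M') M"
    unfolding count_loop_def
  proof (rule wp_loop[where I = ?I])
    fix l K assume I: "?I (Suc l) K"
    define h where "h = N - Suc l"
    have h: "N - Suc l = h" "N - l = Suc h" "l \<le> N" "Suc h \<le> N" "l = 0 \<longleftrightarrow> Suc h = N"
      using I unfolding h_def by auto
    let ?K = "K(15 := Suc h)"
    have K15: "K 15 = h" using I unfolding h(1) by blast
    have K: "?K 2 = 1" "?K 3 = 0" "?K 13 = G" "?K 14 = U" "?K 15 = Suc h" "?K 18 = d" "K 2 = 1"
      using I M by simp_all
    have T: "U * Suc (Suc h) ^ d \<le> G \<longleftrightarrow> l \<noteq> 0"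
    proof (cases "l = 0")
      case True
      then have "Suc h = N" using h(5) by simp
      then show ?thesis using True N(2) by simp
    next
      case False
      then have "Suc (Suc h) \<in> {1..N}" using h(4,5) by simp
      then show ?thesis using False N(1) by blast
    qed
    have "wp (Seq (Add 15 15 2) trial) (\<lambda>s xs M'. s \<le> d * (N * 3 + 9) + 7 \<and> xs = [] \<and> ?I l M') K"
    proof (rule wp_seq[where a = 1 and R = "\<lambda>L. L = ?K"])
      show "wp (Add 15 15 2) (\<lambda>s xs L. s \<le> 1 \<and> xs = [] \<and> L = ?K) K" using K15 K(7) by simp
      fix L :: memory assume "L = ?K"
      show "wp trial (\<lambda>s xs M'. s \<le> d * (N * 3 + 9) + 6 \<and> xs = [] \<and> ?I l M') L"
        unfolding \<open>L = ?K\<close>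
      proof (rule wp_mono[OF wp_trial[OF K(1-6) h(4)]])
        fix s and xs :: "nat list" and M'
        assume *: "s \<le> d * (N * 3 + 9) + 6 \<and> xs = [] \<and>
          (M' 17 = (if U * Suc (Suc h) ^ d \<le> G then 1 else 0) \<and> (\<forall>r. r \<notin> {8, 10, 11, 12, 16, 17} \<longrightarrow> M' r = ?K r))"
        have "M' 17 = (if l = 0 then 0 else 1)" using * unfolding T by simp
        moreover have "M' 15 = Suc h" "\<forall>r\<in>{2, 3, 13, 14, 18}. M' r = M r" using * I by simp_all
        ultimately show "s \<le> d * (N * 3 + 9) + 6 \<and> xs = [] \<and> ?I l M'" using * h(3) unfolding h(2) by blast
      qed
    qed simp
    moreover have "K 17 \<noteq> 0" using I by simp
    ultimately show "K 17 \<noteq> 0 \<and>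
      wp (Seq (Add 15 15 2) trial) (\<lambda>s xs M'. s \<le> d * (N * 3 + 9) + 7 \<and> xs = [] \<and> ?I l M') K" by blast
  next
    have "U * 1 ^ d \<le> G \<longleftrightarrow> N \<noteq> 0" using N(1)[of 1] N(2) by (cases N) auto
    then show "?I N M" using M by simp
  qed simp
  then show ?thesis by (rule wp_mono) (simp add: algebra_simps)
qed

text \<open>The series is summed up to the index \<open>C * 2 ^ (d * k)\<close>, because every
  factor \<open>q = (k * m) ^ d\<close> occurring in a comparison is at most
  \<open>2 ^ (d * k)\<close>.\<close>

definition exp_phase :: "nat \<Rightarrow> nat \<Rightarrow> nat \<Rightarrow> com" where
  "exp_phase C d g = Seq (seqs [Const 2 1, Sub 1 0 2, Const 4 C, Const 18 d, Const 19 g, Const 5 1, Const 6 1, Const 7 1, Const 12 0])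
     (Seq (mul_power2 4 18 0) (repeat 8 4 exp_step))"

lemma wp_exp_phase:
  fixes C d g k :: nat
  defines "J \<equiv> C * 2 ^ (d * k)"
  assumes M: "M = (\<lambda>_. 0)(0 := k)"
  shows "wp (exp_phase C d g) (\<lambda>s xs N. s \<le> d * (k * 3 + 4) + J * (J * 6 + d * 3 + 16) + 13 \<and> xs = [] \<and>
    (N 0 = k \<and> N 1 = k - 1 \<and> N 2 = 1 \<and> N 3 = 0 \<and> N 18 = d \<and> N 19 = g \<and> N 5 = fact J \<and> N 6 = exp_num d J)) M"
proof -
  let ?M = "M(2 := 1, 1 := k - 1, 4 := C, 18 := d, 19 := g, 5 := 1, 6 := 1, 7 := 1, 12 := 0)"
  let ?R = "\<lambda>N. N 0 = k \<and> N 1 = k - 1 \<and> N 2 = 1 \<and> N 3 = 0 \<and> N 18 = d \<and> N 19 = g"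
  let ?I = "\<lambda>j N. ?R N \<and> N 5 = fact j \<and> N 6 = exp_num d j \<and> N 7 = d ^ j \<and> N 12 = j"
  show ?thesis unfolding exp_phase_def
  proof (rule wp_seq[where a = 9 and R = "\<lambda>N. N = ?M"])
    show "wp (seqs [Const 2 1, Sub 1 0 2, Const 4 C, Const 18 d, Const 19 g, Const 5 1, Const 6 1, Const 7 1, Const 12 0])
      (\<lambda>s xs N. s \<le> 9 \<and> xs = [] \<and> N = ?M) M" unfolding M by simp
    fix N1 :: memory assume N1: "N1 = ?M"
    show "wp (Seq (mul_power2 4 18 0) (repeat 8 4 exp_step))
      (\<lambda>s xs N. s \<le> d * (k * 3 + 4) + J * (J * 6 + d * 3 + 16) + 4 \<and> xs = [] \<and>
      (N 0 = k \<and> N 1 = k - 1 \<and> N 2 = 1 \<and> N 3 = 0 \<and> N 18 = d \<and> N 19 = g \<and> N 5 = fact J \<and> N 6 = exp_num d J)) N1"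
    proof (rule wp_seq[where a = "d * (k * 3 + 4) + 2" and R = "\<lambda>N. ?I 0 N \<and> N 4 = J"])
      have N1': "N1 2 = 1" "N1 3 = 0" "N1 18 = d" "N1 0 = k" "N1 4 = C" unfolding N1 M by simp_all
      show "wp (mul_power2 4 18 0) (\<lambda>s xs N. s \<le> d * (k * 3 + 4) + 2 \<and> xs = [] \<and> (?I 0 N \<and> N 4 = J)) N1"
      proof (rule wp_mono[OF wp_mul_power2[of N1 4 18 0]])
        fix s and xs :: "nat list" and N
        assume *: "s \<le> N1 18 * (N1 0 * 3 + 2 + 2) + 2 \<and> xs = [] \<and>
          N 4 = N1 4 * 2 ^ (N1 18 * N1 0) \<and> (\<forall>r. r \<notin> {4, 8, 9} \<longrightarrow> N r = N1 r)"
        then have "s \<le> d * (k * 3 + 4) + 2 \<and> xs = [] \<and> N 4 = J" unfolding N1' J_def by (simp add: algebra_simps)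
        moreover have "?I 0 N" using * unfolding N1 M by simp
        ultimately show "s \<le> d * (k * 3 + 4) + 2 \<and> xs = [] \<and> (?I 0 N \<and> N 4 = J)" by blast
      qed (use N1' in simp_all)
      fix N2 :: memory assume N2: "?I 0 N2 \<and> N2 4 = J"
      have "wp (repeat 8 4 exp_step) (\<lambda>s xs N. s \<le> J * ((J * 6 + d * 3 + 14) + 2) + 2 \<and> xs = [] \<and> ?I J N) N2"
      proof (rule wp_repeat[where I = ?I])
        fix j and N :: memory assume j: "j < J" and I: "?I j N"
        from I have I': "N 2 = 1" "N 3 = 0" "N 5 = fact j" "N 6 = exp_num d j" "N 7 = d ^ j" "N 12 = j" "N 18 = d"
          by blast+
        show "wp exp_step (\<lambda>s xs N'. s \<le> J * 6 + d * 3 + 14 \<and> xs = [] \<and> (?I (Suc j) N' \<and> N' 8 = N 8)) N"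
          by (rule wp_mono[OF wp_exp_step[OF I' j]]) (use I in simp)
      qed (use N2 in simp_all)
      then show "wp (repeat 8 4 exp_step) (\<lambda>s xs N. s \<le> J * (J * 6 + d * 3 + 16) + 2 \<and> xs = [] \<and>
        (N 0 = k \<and> N 1 = k - 1 \<and> N 2 = 1 \<and> N 3 = 0 \<and> N 18 = d \<and> N 19 = g \<and> N 5 = fact J \<and> N 6 = exp_num d J)) N2"
        by (rule wp_mono) (simp add: algebra_simps)
    qed simp
  qed simp
qed

text \<open>Register 13 receives the right side of the comparison and register 14 the part of the
  left side that does not depend on \<open>m\<close>, both multiplied by \<open>fact J\<close>. The
  length is then found by counting upwards.\<close>

definition length_prog :: "nat \<Rightarrow> nat \<Rightarrow> nat \<Rightarrow> com" where
  "length_prog C d g = Seq (exp_phase C d g) (Seq (Add 13 5 3) (Seq (mul_power2 13 19 1)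
     (Seq (Add 14 6 3) (Seq (mul_power 14 18 0) (Seq (Const 15 0) (Seq trial (Seq count_loop (Print 15))))))))"

definition length_steps :: "nat \<Rightarrow> nat \<Rightarrow> nat \<Rightarrow> nat \<Rightarrow> nat \<Rightarrow> nat" where
  "length_steps J d g k N = d * (k * 3 + 4) + J * (J * 6 + d * 3 + 16) + g * (k * 3 + 4) + d * (k * 3 + 6) +
     (N + 1) * (d * (N * 3 + 9) + 8) + 22"

lemma wp_length_prog:
  fixes C d g k :: nat
  defines "J \<equiv> C * 2 ^ (d * k)"
  defines "G \<equiv> fact J * 2 ^ (g * (k - 1))"
  assumes M: "M = (\<lambda>_. 0)(0 := k)"
    and N: "\<And>m. m \<in> {1..N} \<Longrightarrow> exp_num d J * k ^ d * m ^ d \<le> G" "\<not> exp_num d J * k ^ d * Suc N ^ d \<le> G"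
  shows "wp (length_prog C d g) (\<lambda>s xs M'. s \<le> length_steps J d g k N \<and> xs = [N] \<and> True) M"
proof -
  let ?U = "exp_num d J * k ^ d"
  let ?R = "\<lambda>N. N 0 = k \<and> N 1 = k - 1 \<and> N 2 = 1 \<and> N 3 = 0 \<and> N 18 = d \<and> N 19 = g"
  let ?out = "\<lambda>b s xs M'. s \<le> b \<and> xs = [N] \<and> True"
  let ?p8 = "Seq count_loop (Print 15)"
  let ?p7 = "Seq trial ?p8"
  let ?p6 = "Seq (Const 15 0) ?p7"
  let ?p5 = "Seq (mul_power 14 18 0) ?p6"
  let ?p4 = "Seq (Add 14 6 3) ?p5"
  let ?p3 = "Seq (mul_power2 13 19 1) ?p4"
  let ?p2 = "Seq (Add 13 5 3) ?p3"
  let ?c8 = "N * (d * (N * 3 + 9) + 8) + 2"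
  let ?c7 = "?c8 + (d * (N * 3 + 9) + 6)"
  let ?c6 = "?c7 + 1"
  let ?c5 = "?c6 + (d * (k * 3 + 6) + 2)"
  let ?c4 = "?c5 + 1"
  let ?c3 = "?c4 + (g * (k * 3 + 4) + 2)"
  let ?c2 = "?c3 + 1"
  have s8: "wp ?p8 (?out ?c8) K"
    if K: "?R K" "K 13 = G" "K 14 = ?U" "K 15 = 0" "K 17 = (if ?U * 1 ^ d \<le> G then 1 else 0)" for K
  proof (rule wp_seq[OF wp_count_loop[of K G ?U d N]])
    fix L :: memory assume "L 15 = N"
    then show "wp (Print 15) (?out 1) L" by simp
  qed (use K N in simp_all)
  have s7: "wp ?p7 (?out ?c7) K"
    if K: "?R K" "K 13 = G" "K 14 = ?U" "K 15 = 0" for K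
  proof (rule wp_seq[OF wp_trial[of K G ?U 0 d N]])
    fix L :: memory assume L: "L 17 = (if ?U * Suc 0 ^ d \<le> G then 1 else 0) \<and> (\<forall>r. r \<notin> {8, 10, 11, 12, 16, 17} \<longrightarrow> L r = K r)"
    have "?R L" "L 13 = G" "L 14 = ?U" "L 15 = 0" using L K by simp_all
    then show "wp ?p8 (?out ?c8) L" using L by (intro s8) (simp_all only: One_nat_def)
  qed (use K in simp_all)
  have s6: "wp ?p6 (?out ?c6) K"
    if K: "?R K" "K 13 = G" "K 14 = ?U" for K
  proof (rule wp_seq[where a = 1 and R = "\<lambda>L. L = K(15 := 0)"])
    fix L :: memory assume "L = K(15 := 0)"
    then show "wp ?p7 (?out ?c7) L" using K by (intro s7) simp_all
  qed simp_all
  have s5: "wp ?p5 (?out ?c5) K"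
    if K: "?R K" "K 13 = G" "K 14 = exp_num d J" for K
  proof (rule wp_seq[OF wp_mul_power[of K 14 18 0]])
    fix L :: memory assume L: "L 14 = K 14 * K 0 ^ K 18 \<and> (\<forall>r. r \<notin> {14, 8, 10, 11} \<longrightarrow> L r = K r)"
    show "wp ?p6 (?out ?c6) L"
      by (rule s6) (use L K in simp_all)
  qed (use K in simp_all)
  have s4: "wp ?p4 (?out ?c4) K"
    if K: "?R K" "K 13 = G" "K 6 = exp_num d J" for K
  proof (rule wp_seq[where a = 1 and R = "\<lambda>L. L = K(14 := exp_num d J)"])
    fix L :: memory assume "L = K(14 := exp_num d J)"
    then show "wp ?p5 (?out ?c5) L"
      using K by (intro s5) simp_all
  qed (use K in simp_all)
  have s3: "wp ?p3 (?out ?c3) K"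
    if K: "?R K" "K 13 = fact J" "K 6 = exp_num d J" for K
  proof (rule wp_seq[OF wp_mul_power2[of K 13 19 1]])
    fix L :: memory assume L: "L 13 = K 13 * 2 ^ (K 19 * K 1) \<and> (\<forall>r. r \<notin> {13, 8, 9} \<longrightarrow> L r = K r)"
    show "wp ?p4 (?out ?c4) L"
      by (rule s4) (use L K in \<open>simp_all add: G_def\<close>)
  next
    have "g * ((k - 1) * 3 + 2 + 2) \<le> g * (k * 3 + 4)" by (intro mult_le_mono2) simp
    then show "K 19 * (K 1 * 3 + 2 + 2) + 2 + ?c4 \<le> ?c3" using K by simp
  qed (use K in simp_all)
  have s2: "wp ?p2 (?out ?c2) K"
    if K: "?R K" "K 5 = fact J" "K 6 = exp_num d J" for K
  proof (rule wp_seq[where a = 1 and R = "\<lambda>L. L = K(13 := fact J)"])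
    fix L :: memory assume "L = K(13 := fact J)"
    then show "wp ?p3 (?out ?c3) L"
      using K by (intro s3) simp_all
  qed (use K in simp_all)
  show ?thesis unfolding length_prog_def
  proof (rule wp_seq[OF wp_exp_phase[OF M, of C d g, folded J_def]])
    fix K :: memory assume K: "K 0 = k \<and> K 1 = k - 1 \<and> K 2 = 1 \<and> K 3 = 0 \<and> K 18 = d \<and> K 19 = g \<and> K 5 = fact J \<and> K 6 = exp_num d J"
    show "wp ?p2 (?out ?c2) K"
      by (rule s2) (use K in simp_all)
  qed (unfold length_steps_def, simp)
qed

section \<open>Exponential time bounds and the theorem\<close>

text \<open>For \<open>0 < \<epsilon> < 1\<close> the function \<open>vdW_bound \<epsilon>\<close>
  itself grows exponentially, so polynomial time in it means time \<open>2 ^ O(k)\<close>. Since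
  \<open>k >= 1\<close>, constant factors can be absorbed into the exponent
  \<open>c * k\<close>.\<close>

definition exp_bounded :: "(nat \<Rightarrow> nat) \<Rightarrow> bool" where
  "exp_bounded f \<longleftrightarrow> (\<exists>c. \<forall>k\<ge>1. f k \<le> 2 ^ (c * k))"

lemma exp_bounded_power: "exp_bounded (\<lambda>k. 2 ^ (c * k))"
  unfolding exp_bounded_def by blast

lemma exp_bounded_mono: "exp_bounded g \<Longrightarrow> (\<And>k. k \<ge> 1 \<Longrightarrow> f k \<le> g k) \<Longrightarrow> exp_bounded f"
  unfolding exp_bounded_def by (meson order_trans)

lemma exp_bounded_const: "exp_bounded (\<lambda>k. a)"
proof (rule exp_bounded_mono[OF exp_bounded_power])
  fix k :: nat assume k: "k \<ge> 1"
  have "a \<le> 2 ^ a" by (rule less_imp_le[OF less_exp])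
  also have "\<dots> \<le> 2 ^ (a * k)" using k by (intro power_increasing) auto
  finally show "a \<le> 2 ^ (a * k)" .
qed

lemma exp_bounded_id: "exp_bounded (\<lambda>k. k)"
proof (rule exp_bounded_mono[OF exp_bounded_power])
  show "k \<le> 2 ^ (1 * k)" for k :: nat using less_exp[of k] by simp
qed

lemma exp_bounded_mult: "exp_bounded f \<Longrightarrow> exp_bounded g \<Longrightarrow> exp_bounded (\<lambda>k. f k * g k)"
proof -
  assume "exp_bounded f" "exp_bounded g"
  then obtain c d where cd: "\<And>k. k \<ge> 1 \<Longrightarrow> f k \<le> 2 ^ (c * k)" "\<And>k. k \<ge> 1 \<Longrightarrow> g k \<le> 2 ^ (d * k)"
    unfolding exp_bounded_def by blast
  show ?thesis
  proof (rule exp_bounded_mono[OF exp_bounded_power[of "c + d"]])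
    fix k :: nat assume "k \<ge> 1"
    then have "f k * g k \<le> 2 ^ (c * k) * 2 ^ (d * k)" using cd by (intro mult_le_mono) auto
    then show "f k * g k \<le> 2 ^ ((c + d) * k)" by (simp only: power_add[symmetric] add_mult_distrib)
  qed
qed

lemma exp_bounded_add: "exp_bounded f \<Longrightarrow> exp_bounded g \<Longrightarrow> exp_bounded (\<lambda>k. f k + g k)"
proof -
  assume fg: "exp_bounded f" "exp_bounded g"
  have "exp_bounded (\<lambda>k. (f k + 1) * (g k + 1))"
  proof -
    have *: "exp_bounded (\<lambda>k. h k + 1)" if "exp_bounded h" for h
    proof -
      obtain c where c: "\<And>k. k \<ge> 1 \<Longrightarrow> h k \<le> 2 ^ (c * k)" using \<open>exp_bounded h\<close> unfolding exp_bounded_def by blast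
      show ?thesis
      proof (rule exp_bounded_mono[OF exp_bounded_power[of "c + 1"]])
        fix k :: nat assume k: "k \<ge> 1"
        have "h k + 1 \<le> 2 ^ (c * k) + 2 ^ (c * k)" using c[OF k] by (intro add_mono) auto
        also have "\<dots> = 2 ^ (c * k + 1)" by simp
        also have "\<dots> \<le> 2 ^ ((c + 1) * k)" using k by (intro power_increasing) auto
        finally show "h k + 1 \<le> 2 ^ ((c + 1) * k)" .
      qed
    qed
    show ?thesis by (intro exp_bounded_mult * fg)
  qed
  then show ?thesis by (rule exp_bounded_mono) simp
qed

lemmas exp_bounded_intros = exp_bounded_add exp_bounded_mult exp_bounded_const exp_bounded_id exp_bounded_power

text \<open>Half of the exponent \<open>k * (1 - \<epsilon>)\<close> pays for the factor
  \<open>k\<close> in the denominator of \<open>vdW_bound\<close>; the other half, raised to the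
  power \<open>j\<close>, gives \<open>2 ^ k\<close>.\<close>

lemma power2_le_bound:
  assumes e: "0 < \<epsilon>" "\<epsilon> < 1"
  shows "\<exists>a j. \<forall>k\<ge>1. (2::real) ^ k \<le> (a * vdW_bound \<epsilon> k) ^ j"
proof -
  define \<delta> where "\<delta> = 1 - \<epsilon>"
  have d: "0 < \<delta>" using e unfolding \<delta>_def by auto
  define A where "A = 2 / (\<delta> * ln 2)"
  have A: "A > 0" unfolding A_def using d by simp
  define a where "a = exp 1 * A * 2 powr \<delta>"
  obtain j :: nat where j: "2 / \<delta> \<le> real j" using real_arch_simple by blast
  show ?thesis
  proof (intro exI[of _ a] exI[of _ j] allI impI)
    fix k :: nat assume k: "k \<ge> 1"
    let ?y = "2 powr (real k * \<delta> / 2)"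
    have "real k * \<delta> / 2 * ln 2 \<le> exp (real k * \<delta> / 2 * ln 2)"
      using exp_ge_add_one_self[of "real k * \<delta> / 2 * ln 2"] by linarith
    also have "\<dots> = ?y" by (simp add: powr_def)
    finally have "real k \<le> A * ?y" unfolding A_def using d by (simp add: field_simps)
    then have "?y * real k \<le> ?y * (A * ?y)" by (intro mult_left_mono) auto
    also have "\<dots> = A * (?y * ?y)" by (simp only: mult_ac)
    also have "?y * ?y = 2 powr (real k * \<delta>)" by (simp add: mult.commute flip: powr_add)
    also have "2 powr (real k * \<delta>) = 2 powr \<delta> * 2 powr ((real k - 1) * \<delta>)"
      by (simp add: algebra_simps flip: powr_add)
    also have "A * (2 powr \<delta> * 2 powr ((real k - 1) * \<delta>)) = a * vdW_bound \<epsilon> k * real k"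
      using k unfolding vdW_bound_def a_def \<delta>_def by (simp add: field_simps)
    finally have y: "?y \<le> a * vdW_bound \<epsilon> k" using k by simp
    have "real k = real k * \<delta> / 2 * (2 / \<delta>)" using d by simp
    also have "\<dots> \<le> real k * \<delta> / 2 * real j" using j d by (intro mult_left_mono) auto
    finally have "2 powr real k \<le> 2 powr (real k * \<delta> / 2 * real j)" by simp
    also have "\<dots> = ?y ^ j" by (simp add: powr_realpow[symmetric] powr_powr)
    also have "\<dots> \<le> (a * vdW_bound \<epsilon> k) ^ j" using y by (intro power_mono) auto
    finally show "(2::real) ^ k \<le> (a * vdW_bound \<epsilon> k) ^ j" by (simp add: powr_realpow)
  qed
qed

lemma exp_bounded_poly:
  assumes e: "0 < \<epsilon>" "\<epsilon> < 1" and f: "exp_bounded f"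
  shows "\<exists>p. \<forall>k\<ge>1. real (f k) \<le> poly p (vdW_bound \<epsilon> k)"
proof -
  obtain c where c: "\<And>k. k \<ge> 1 \<Longrightarrow> f k \<le> 2 ^ (c * k)" using f unfolding exp_bounded_def by blast
  obtain a j where aj: "\<And>k. k \<ge> 1 \<Longrightarrow> (2::real) ^ k \<le> (a * vdW_bound \<epsilon> k) ^ j"
    using power2_le_bound[OF e] by blast
  show ?thesis
  proof (intro exI[of _ "Polynomial.monom (a ^ (j * c)) (j * c)"] allI impI)
    fix k :: nat assume k: "k \<ge> 1"
    have "real (f k) \<le> real (2 ^ (c * k))" using c[OF k] by (simp only: of_nat_le_iff)
    also have "\<dots> = (2 ^ k) ^ c" by (simp add: power_mult[symmetric] mult.commute)
    also have "\<dots> \<le> ((a * vdW_bound \<epsilon> k) ^ j) ^ c" using aj[OF k] by (intro power_mono) auto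
    also have "\<dots> = poly (Polynomial.monom (a ^ (j * c)) (j * c)) (vdW_bound \<epsilon> k)"
      by (simp add: poly_monom power_mult_distrib flip: power_mult)
    finally show "real (f k) \<le> poly (Polynomial.monom (a ^ (j * c)) (j * c)) (vdW_bound \<epsilon> k)" .
  qed
qed

lemma vdW_bound_le_power2:
  assumes "\<epsilon> > 0" "k \<ge> 1"
  shows "0 \<le> vdW_bound \<epsilon> k" "vdW_bound \<epsilon> k \<le> 2 ^ (k - 1)"
proof -
  show "0 \<le> vdW_bound \<epsilon> k" unfolding vdW_bound_def by simp
  have "vdW_bound \<epsilon> k \<le> 2 powr ((real k - 1) * (1 - \<epsilon>))" using assms by (intro vdW_bound_le)
  also have "\<dots> \<le> 2 powr real (k - 1)" using assms by (intro powr_mono) (auto simp: algebra_simps)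
  finally show "vdW_bound \<epsilon> k \<le> 2 ^ (k - 1)" by (simp add: powr_realpow)
qed

lemma vdW_length_le_power2:
  assumes "\<epsilon> > 0" "k \<ge> 1"
  shows "vdW_length \<epsilon> k \<le> 2 ^ (k - 1)"
proof -
  have "real (vdW_length \<epsilon> k) \<le> 2 ^ (k - 1)"
    using vdW_length_le_bound[OF assms(2), of \<epsilon>] vdW_bound_le_power2[OF assms] by linarith
  also have "\<dots> = real (2 ^ (k - 1))" by simp
  finally have "real (vdW_length \<epsilon> k) \<le> real (2 ^ (k - 1))" .
  then show ?thesis unfolding of_nat_le_iff .
qed

text \<open>The converse translation: the time bound of a given length program, polynomial in
  \<open>vdW_bound\<close>, becomes \<open>2 ^ O(k)\<close> and can be added to the time of the
  coloring program.\<close>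

lemma poly_exp_bounded:
  assumes e: "0 < \<epsilon>"
  shows "\<exists>f. exp_bounded f \<and> (\<forall>k\<ge>1. poly p (vdW_bound \<epsilon> k) \<le> real (f k))"
proof -
  let ?d = "Polynomial.degree p"
  define S where "S = nat \<lceil>\<Sum>i\<le>?d. \<bar>Polynomial.coeff p i\<bar>\<rceil>"
  have "exp_bounded (\<lambda>k. S * 2 ^ (?d * k))" by (intro exp_bounded_intros)
  moreover have "poly p (vdW_bound \<epsilon> k) \<le> real (S * 2 ^ (?d * k))" if k: "k \<ge> 1" for k
  proof -
    have "(2::real) ^ (k - 1) \<le> 2 ^ k" by (intro power_increasing) auto
    then have x: "0 \<le> vdW_bound \<epsilon> k" "vdW_bound \<epsilon> k \<le> 2 ^ k"
      using vdW_bound_le_power2[OF e k] by linarith+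
    have "poly p (vdW_bound \<epsilon> k) \<le> (\<Sum>i\<le>?d. \<bar>Polynomial.coeff p i\<bar> * 2 ^ (?d * k))"
      unfolding poly_altdef
    proof (rule sum_mono)
      fix i assume i: "i \<in> {..?d}"
      have "vdW_bound \<epsilon> k ^ i \<le> (2 ^ k) ^ i" using x by (intro power_mono) auto
      also have "\<dots> \<le> (2 ^ k) ^ ?d" using i by (intro power_increasing) auto
      also have "\<dots> = 2 ^ (?d * k)" by (simp add: mult.commute flip: power_mult)
      finally show "Polynomial.coeff p i * vdW_bound \<epsilon> k ^ i \<le> \<bar>Polynomial.coeff p i\<bar> * 2 ^ (?d * k)"
        using x by (intro mult_mono) auto
    qed
    also have "\<dots> = (\<Sum>i\<le>?d. \<bar>Polynomial.coeff p i\<bar>) * 2 ^ (?d * k)" by (simp add: sum_distrib_right)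
    also have "\<dots> \<le> real S * 2 ^ (?d * k)"
      unfolding S_def by (intro mult_right_mono real_nat_ceiling_ge) auto
    finally show ?thesis by simp
  qed
  ultimately show ?thesis by blast
qed

lemma wp_runs:
  assumes "wp P (\<lambda>s xs M'. s \<le> S \<and> R xs) ((\<lambda>_. 0)(0 := k))" "literals_le D P"
  shows "\<exists>xs t. runs P k xs t \<and> R xs \<and> t \<le> S * (2 * (D + k + S) + 1)"
proof -
  let ?M = "(\<lambda>_. 0)(0 := k)"
  obtain s xs M' where s: "steps P ?M s xs M'" "s \<le> S" "R xs" using assms(1) unfolding wp_def by blast
  have "digits (?M r) \<le> D + k" for r
  proof -
    have "digits (?M r) \<le> k" using floorlog_leI[of k 2 k] less_exp[of k]
      by (cases "r = 0") (simp_all add: floorlog_def[of 2 0])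
    then show ?thesis by simp
  qed
  moreover have "literals_le (D + k) P" using assms(2) by (rule literals_le_mono) simp
  ultimately obtain t where t: "t \<le> s * (2 * (D + k + s) + 1)" "exec P ?M t xs M'"
    using steps_exec[OF s(1), of "D + k"] by blast
  have "s * (2 * (D + k + s) + 1) \<le> S * (2 * (D + k + S) + 1)" using s(2) by (intro mult_le_mono) auto
  then show ?thesis using t s(3) unfolding runs_def by (meson order_trans)
qed

lemma wp_runs_exp_bounded:
  assumes f: "exp_bounded f"
    and wp: "\<And>k. k \<ge> 1 \<Longrightarrow> wp P (\<lambda>s xs M'. s \<le> f k \<and> R k xs) ((\<lambda>_. 0)(0 := k))"
  shows "\<exists>h. exp_bounded h \<and> (\<forall>k\<ge>1. \<exists>xs t. runs P k xs t \<and> R k xs \<and> t \<le> h k)"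
proof -
  obtain D where D: "literals_le D P" using literals_le_exists by blast
  have "exp_bounded (\<lambda>k. f k * (2 * (D + k + f k) + 1))" by (intro exp_bounded_intros f)
  then show ?thesis using wp_runs[OF wp D] by blast
qed

lemma solves_in_poly_timeI:
  assumes e: "0 < \<epsilon>" "\<epsilon> < 1" and f: "exp_bounded f"
    and wp: "\<And>k. k \<ge> 1 \<Longrightarrow> wp P (\<lambda>s xs M'. s \<le> f k \<and> R k xs) ((\<lambda>_. 0)(0 := k))"
  shows "solves_in_poly_time P (vdW_bound \<epsilon>) R"
proof -
  obtain h where h: "exp_bounded h" "\<And>k. k \<ge> 1 \<Longrightarrow> \<exists>xs t. runs P k xs t \<and> R k xs \<and> t \<le> h k"
    using wp_runs_exp_bounded[OF f wp] by blast
  obtain p where p: "\<And>k. k \<ge> 1 \<Longrightarrow> real (h k) \<le> poly p (vdW_bound \<epsilon> k)"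
    using exp_bounded_poly[OF e h(1)] by blast
  show ?thesis unfolding solves_in_poly_time_def
  proof (rule exI[of _ p], intro allI impI)
    fix k :: nat assume k: "k \<ge> 1"
    obtain xs t where xs: "runs P k xs t" "R k xs" "t \<le> h k" using h(2)[OF k] by blast
    have "real t \<le> poly p (vdW_bound \<epsilon> k)" using xs(3) p[OF k] by linarith
    then show "\<exists>xs t. runs P k xs t \<and> R k xs \<and> real t \<le> poly p (vdW_bound \<epsilon> k)" using xs by blast
  qed
qed

text \<open>Register 20 is the relocated register 0 and receives the input; register 18 holds the
  offset for relocated addresses. Register 0 keeps \<open>k\<close> for
  \<open>color_main\<close>.\<close>

definition color_prog :: "com \<Rightarrow> com" where
  "color_prog Q = Seq (seqs [Const 18 20, Add 20 0 3]) (Seq (relocate Q) color_main)"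

lemma wp_color_prog:
  assumes k: "k \<ge> 1" and Q: "runs Q k [n] t" and z: "proper_coloring k n (recseq (seed z))"
  shows "wp (color_prog Q) (\<lambda>s xs M'. s \<le> 2 * t + (z + 1) * (step_bound k n z + 1) + n * 5 + 14 \<and>
    outputs_proper_coloring k n xs) ((\<lambda>_. 0)(0 := k))"
proof -
  let ?M = "(\<lambda>_. 0)(0 := k)"
  let ?N = "?M(18 := 20, 20 := k)"
  obtain M' where M': "exec Q ?M t [n] M'" using Q unfolding runs_def by blast
  have sim: "simulates ?M ?N" unfolding simulates_def by auto
  have 1: "wp (seqs [Const 18 20, Add 20 0 3]) (\<lambda>s xs N. s = 2 \<and> xs = [] \<and> N = ?N) ?M" by simp
  have 2: "wp (relocate Q) (\<lambda>s xs N. s \<le> 2 * t \<and> xs = [] \<and> N 1 = n \<and> N 0 = k) ?N"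
    by (rule wp_mono[OF wp_relocate[OF M' sim]]) simp
  show ?thesis unfolding color_prog_def wp_Seq
  proof (rule wp_mono[OF 1])
    fix s :: nat and xs :: "nat list" and N :: memory
    assume N: "s = 2 \<and> xs = [] \<and> N = ?N"
    then have "N = ?N" by blast
    show "wp (relocate Q) (\<lambda>s' xs' M'. wp color_main (\<lambda>s'' xs'' M''.
      s + (s' + s'') \<le> 2 * t + (z + 1) * (step_bound k n z + 1) + n * 5 + 14 \<and>
      outputs_proper_coloring k n (xs @ xs' @ xs'')) M') N"
      unfolding \<open>N = ?N\<close>
    proof (rule wp_mono[OF 2])
      fix s' :: nat and xs' :: "nat list" and N' :: memory
      assume N': "s' \<le> 2 * t \<and> xs' = [] \<and> N' 1 = n \<and> N' 0 = k"
      then have "N' 0 = k" "N' 1 = n" by auto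
      from color_main[OF this k z]
      show "wp color_main (\<lambda>s'' xs'' M''.
        s + (s' + s'') \<le> 2 * t + (z + 1) * (step_bound k n z + 1) + n * 5 + 14 \<and>
        outputs_proper_coloring k n (xs @ xs' @ xs'')) N'"
      proof (rule wp_mono)
        fix s'' :: nat and xs'' :: "nat list" and M''
        assume *: "s'' \<le> (z + 1) * (step_bound k n z + 1) + n * 5 + 12 \<and> outputs_proper_coloring k n xs''"
        then have "s + (s' + s'') \<le> 2 * t + (z + 1) * (step_bound k n z + 1) + n * 5 + 14"
          using N N' by linarith
        moreover have "xs @ xs' @ xs'' = xs''" using N N' by simp
        ultimately show "s + (s' + s'') \<le> 2 * t + (z + 1) * (step_bound k n z + 1) + n * 5 + 14 \<and>
          outputs_proper_coloring k n (xs @ xs' @ xs'')" using * by simp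
      qed
    qed
  qed
qed

lemma color_prog_exp_bounded:
  assumes e: "0 < \<epsilon>" "\<epsilon> < 1" and h: "exp_bounded h"
    and Q: "\<And>k. k \<ge> 1 \<Longrightarrow> \<exists>t \<le> h k. runs Q k [vdW_length \<epsilon> k] t"
  shows "\<exists>f. exp_bounded f \<and> (\<forall>k\<ge>1. wp (color_prog Q) (\<lambda>s xs M'. s \<le> f k \<and>
    outputs_proper_coloring k (vdW_length \<epsilon> k) xs) ((\<lambda>_. 0)(0 := k)))"
proof -
  obtain c where c: "\<And>k. k \<ge> 1 \<Longrightarrow> \<exists>z < 2 ^ (c * k). proper_coloring k (vdW_length \<epsilon> k) (recseq (seed z))"
    using seed_exists[OF e] by blast
  \<comment> \<open>\<open>1 * k\<close> is written so that \<open>exp_bounded_power\<close>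
    matches.\<close>
  define f where "f k = 2 * h k + (2 ^ (c * k) + 1) * (step_bound k (2 ^ (1 * k)) (2 ^ (c * k)) + 1) + 2 ^ (1 * k) * 5 + 14" for k
  have "exp_bounded f" unfolding f_def step_bound_def by (intro exp_bounded_intros h)
  moreover have "wp (color_prog Q) (\<lambda>s xs M'. s \<le> f k \<and>
    outputs_proper_coloring k (vdW_length \<epsilon> k) xs) ((\<lambda>_. 0)(0 := k))" if k: "k \<ge> 1" for k
  proof -
    let ?n = "vdW_length \<epsilon> k"
    obtain z where z: "z < 2 ^ (c * k)" "proper_coloring k ?n (recseq (seed z))" using c[OF k] by blast
    obtain t where t: "t \<le> h k" "runs Q k [?n] t" using Q[OF k] by blast
    have "(2::nat) ^ (k - 1) \<le> 2 ^ (1 * k)" by (intro power_increasing) auto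
    then have n: "?n \<le> 2 ^ (1 * k)" using vdW_length_le_power2[OF e(1) k] by linarith
    have "(z + 1) * (step_bound k ?n z + 1) \<le> (2 ^ (c * k) + 1) * (step_bound k (2 ^ (1 * k)) (2 ^ (c * k)) + 1)"
      using n z(1) unfolding step_bound_def by (intro mult_le_mono add_le_mono order_refl) auto
    then have "2 * t + (z + 1) * (step_bound k ?n z + 1) + ?n * 5 + 14 \<le> f k"
      using t(1) n unfolding f_def by linarith
    note le = this
    show ?thesis
    proof (rule wp_mono[OF wp_color_prog[OF k t(2) z(2)]])
      fix s and xs :: "nat list"
      assume "s \<le> 2 * t + (z + 1) * (step_bound k ?n z + 1) + ?n * 5 + 14 \<and> outputs_proper_coloring k ?n xs"
      then show "s \<le> f k \<and> outputs_proper_coloring k ?n xs" using le order_trans by blast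
    qed
  qed
  ultimately show ?thesis by blast
qed

text \<open>The program tests \<open>m \<le> vdW_bound \<epsilon> k\<close> after raising both sides to the power \<open>d\<close>, where
  \<open>1 - \<epsilon> = g / d\<close>.\<close>

lemma le_vdW_bound_iff:
  assumes d: "d \<ge> 1" and e: "1 - \<epsilon> = real g / real d" and k: "k \<ge> 1" and m: "m \<ge> 1"
    and C: "\<And>q p J. q \<ge> 1 \<Longrightarrow> J \<ge> C * q \<Longrightarrow> real q * exp (real d) \<le> real p \<longleftrightarrow>
      real q * (\<Sum>i\<le>J. real d ^ i / fact i) \<le> real p"
    and J: "J = C * 2 ^ (d * k)" and small: "k * m \<le> 2 ^ k"
  shows "exp_num d J * k ^ d * m ^ d \<le> fact J * 2 ^ (g * (k - 1)) \<longleftrightarrow> real m \<le> vdW_bound \<epsilon> k"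
proof -
  let ?q = "(k * m) ^ d"
  let ?S = "\<Sum>i\<le>J. real d ^ i / fact i"
  have q1: "?q \<ge> 1" using k m by simp
  \<comment> \<open>Here the cutoff \<open>J\<close> becomes sufficient for all candidates at once:
    \<open>q\<close> is bounded independently of \<open>m\<close>.\<close>
  have "?q \<le> (2 ^ k) ^ d" using small by (rule power_mono) simp
  also have "\<dots> = 2 ^ (d * k)" by (simp add: mult.commute flip: power_mult)
  finally have J': "C * ?q \<le> J" unfolding J by (rule mult_le_mono2)
  have "exp_num d J * k ^ d * m ^ d \<le> fact J * 2 ^ (g * (k - 1)) \<longleftrightarrow>
      real (exp_num d J * k ^ d * m ^ d) \<le> real (fact J * 2 ^ (g * (k - 1)))" by (simp only: of_nat_le_iff)
  also have "\<dots> \<longleftrightarrow> fact J * (real ?q * ?S) \<le> fact J * real (2 ^ (g * (k - 1)))"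
    by (simp add: exp_num power_mult_distrib mult_ac)
  also have "\<dots> \<longleftrightarrow> real ?q * ?S \<le> real (2 ^ (g * (k - 1)))" by (simp add: mult_le_cancel_left)
  also have "\<dots> \<longleftrightarrow> real ?q * exp (real d) \<le> real (2 ^ (g * (k - 1)))"
    by (rule C[OF q1 J', symmetric])
  also have "real ?q * exp (real d) = (real (k * m) * exp 1) ^ d"
    by (simp add: power_mult_distrib flip: exp_of_nat_mult)
  also have "real (2 ^ (g * (k - 1))) = (2 powr ((real k - 1) * (1 - \<epsilon>))) ^ d"
  proof -
    have "(2 powr ((real k - 1) * (1 - \<epsilon>))) ^ d = 2 powr ((real k - 1) * (1 - \<epsilon>) * real d)"
      by (simp add: powr_powr flip: powr_realpow)
    also have "(real k - 1) * (1 - \<epsilon>) * real d = real (g * (k - 1))"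
      unfolding e using d k by (simp add: of_nat_diff)
    also have "2 powr real (g * (k - 1)) = 2 ^ (g * (k - 1))" by (rule powr_realpow) simp
    finally show ?thesis by (simp only: of_nat_power of_nat_numeral)
  qed
  also have "(real (k * m) * exp 1) ^ d \<le> (2 powr ((real k - 1) * (1 - \<epsilon>))) ^ d \<longleftrightarrow>
      real (k * m) * exp 1 \<le> 2 powr ((real k - 1) * (1 - \<epsilon>))"
    using d by (intro power_mono_iff) auto
  also have "\<dots> \<longleftrightarrow> real m \<le> vdW_bound \<epsilon> k"
    unfolding vdW_bound_def using k by (simp add: le_divide_eq mult_ac)
  finally show ?thesis .
qed

lemma length_prog_rational:
  assumes e: "0 < \<epsilon>" "\<epsilon> < 1" "\<epsilon> \<in> \<rat>"
  shows "\<exists>Q h. exp_bounded h \<and> (\<forall>k\<ge>1. \<exists>t \<le> h k. runs Q k [vdW_length \<epsilon> k] t)"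
proof -
  have "1 - \<epsilon> \<in> \<rat>" using e(3) by simp
  then obtain g d :: nat where gd: "d \<noteq> 0" "\<bar>1 - \<epsilon>\<bar> = real g / real d"
    by (elim Rats_abs_nat_div_natE)
  have d: "d \<ge> 1" "1 - \<epsilon> = real g / real d" using gd e by auto
  obtain C where C: "\<And>q p J. q \<ge> 1 \<Longrightarrow> J \<ge> C * q \<Longrightarrow> real q * exp (real d) \<le> real p \<longleftrightarrow>
      real q * (\<Sum>i\<le>J. real d ^ i / fact i) \<le> real p"
    using exp_comparison[OF d(1)] by blast
  define f where "f k = length_steps (C * 2 ^ (d * k)) d g k (2 ^ (1 * k))" for k
  have f: "exp_bounded f" unfolding f_def length_steps_def by (intro exp_bounded_intros)
  have wp: "wp (length_prog C d g) (\<lambda>s xs M'. s \<le> f k \<and> xs = [vdW_length \<epsilon> k]) ((\<lambda>_. 0)(0 := k))"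
    if k: "k \<ge> 1" for k
  proof -
    let ?N = "vdW_length \<epsilon> k"
    have b0: "0 \<le> vdW_bound \<epsilon> k" using vdW_bound_le_power2[OF e(1) k] by simp
    have N: "real m \<le> vdW_bound \<epsilon> k \<longleftrightarrow> m \<le> ?N" for m
      unfolding vdW_length_def using b0 by (simp add: le_nat_iff le_floor_iff)
    have kN: "k * ?N \<le> 2 ^ (k - 1)"
    proof -
      have "real k * real ?N \<le> real k * vdW_bound \<epsilon> k" using N[of ?N] by (intro mult_left_mono) auto
      also have "\<dots> = 2 powr ((real k - 1) * (1 - \<epsilon>)) / exp 1" unfolding vdW_bound_def using k by simp
      also have "\<dots> \<le> 2 powr ((real k - 1) * (1 - \<epsilon>)) / 1" by (intro divide_left_mono) auto
      also have "\<dots> \<le> 2 powr real (k - 1)" using e k by (simp add: algebra_simps)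
      also have "\<dots> = real (2 ^ (k - 1))" by (simp add: powr_realpow)
      finally have "real (k * ?N) \<le> real (2 ^ (k - 1))" by simp
      then show ?thesis unfolding of_nat_le_iff .
    qed
    have p2: "(2::nat) ^ k = 2 * 2 ^ (k - 1)" using k by (cases k) auto
    \<comment> \<open>The comparison must also be right for the first failing candidate
      \<open>?N + 1\<close>; the factor 2 between \<open>2 ^ (k - 1)\<close> and
      \<open>2 ^ k\<close> covers \<open>?N + 1 <= 2 * ?N\<close>.\<close>
    have small: "k * m \<le> 2 ^ k" if "m \<le> Suc ?N" for m
    proof (cases "?N = 0")
      case True
      then have "k * m \<le> k * 1" using that by (intro mult_le_mono2) simp
      then show ?thesis using less_exp[of k] by linarith
    next
      case False
      then have "m \<le> 2 * ?N" using that by simp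
      then have "k * m \<le> k * (2 * ?N)" by (rule mult_le_mono2)
      then show ?thesis using kN p2 by linarith
    qed
    let ?J = "C * 2 ^ (d * k)"
    have iff: "exp_num d ?J * k ^ d * m ^ d \<le> fact ?J * 2 ^ (g * (k - 1)) \<longleftrightarrow> m \<le> ?N"
      if "m \<ge> 1" "m \<le> Suc ?N" for m
      using le_vdW_bound_iff[OF d k that(1) C refl small[OF that(2)]] unfolding N .
    have "wp (length_prog C d g) (\<lambda>s xs M'. s \<le> length_steps ?J d g k ?N \<and> xs = [?N] \<and> True) ((\<lambda>_. 0)(0 := k))"
    proof (rule wp_length_prog[OF refl])
      show "exp_num d ?J * k ^ d * m ^ d \<le> fact ?J * 2 ^ (g * (k - 1))" if "m \<in> {1..?N}" for m
        using iff[of m] that by simp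
      show "\<not> exp_num d ?J * k ^ d * Suc ?N ^ d \<le> fact ?J * 2 ^ (g * (k - 1))"
        using iff[of "Suc ?N"] by simp
    qed
    moreover have "?N \<le> 2 ^ (1 * k)" using vdW_length_le_power2[OF e(1) k] p2 by simp
    then have "length_steps ?J d g k ?N \<le> f k"
      unfolding f_def length_steps_def by (intro add_le_mono mult_le_mono order_refl) auto
    ultimately show ?thesis by (elim wp_mono) auto
  qed
  from wp_runs_exp_bounded[OF f wp] show ?thesis by blast
qed

lemma length_poly_time_exp_bounded:
  assumes "0 < \<epsilon>" "length_poly_time \<epsilon>"
  shows "\<exists>Q h. exp_bounded h \<and> (\<forall>k\<ge>1. \<exists>t \<le> h k. runs Q k [vdW_length \<epsilon> k] t)"
proof -
  obtain Q p where Q: "\<And>k. k \<ge> 1 \<Longrightarrow> \<exists>xs t. runs Q k xs t \<and> xs = [vdW_length \<epsilon> k] \<and> real t \<le> poly p (vdW_bound \<epsilon> k)"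
    using assms(2) unfolding length_poly_time_def solves_in_poly_time_def by blast
  obtain h where h: "exp_bounded h" "\<And>k. k \<ge> 1 \<Longrightarrow> poly p (vdW_bound \<epsilon> k) \<le> real (h k)"
    using poly_exp_bounded[OF assms(1), of p] by blast
  have "\<exists>t \<le> h k. runs Q k [vdW_length \<epsilon> k] t" if k: "k \<ge> 1" for k
  proof -
    obtain t where t: "runs Q k [vdW_length \<epsilon> k] t" "real t \<le> poly p (vdW_bound \<epsilon> k)" using Q[OF k] by blast
    have "real t \<le> real (h k)" using t(2) h(2)[OF k] by linarith
    then show ?thesis using t(1) by auto
  qed
  then show ?thesis using h(1) by blast
qed

lemma vdW_length_eq_0:
  assumes "\<epsilon> \<ge> 1" "k \<ge> 1"
  shows "vdW_length \<epsilon> k = 0"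
proof -
  have "2 powr ((real k - 1) * (1 - \<epsilon>)) \<le> 2 powr 0"
    using assms by (intro powr_mono) (auto simp: mult_nonneg_nonpos)
  moreover have "1 * 1 < exp 1 * real k" using assms(2) by (intro mult_less_le_imp_less) auto
  ultimately have "vdW_bound \<epsilon> k < 1" unfolding vdW_bound_def by simp
  then show ?thesis unfolding vdW_length_def by simp
qed

lemma Skip_solves:
  assumes "\<And>k. k \<ge> 1 \<Longrightarrow> R k []"
  shows "solves_in_poly_time Skip N R"
  unfolding solves_in_poly_time_def runs_def
  by (rule exI[of _ "[:1:]"]) (use assms in \<open>auto intro!: exI[of _ 1] exec.Skip exI[of _ "[]"]\<close>)

theorem theorem7p1:
  fixes \<epsilon> :: real
  assumes "0 < \<epsilon>"
  shows "(\<epsilon> \<in> \<rat> \<or> length_poly_time \<epsilon> \<longrightarrow>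
           (\<exists>P. solves_in_poly_time P (vdW_bound \<epsilon>)
                  (\<lambda>k xs. outputs_proper_coloring k (vdW_length \<epsilon> k) xs))) \<and>
         (\<exists>P. solves_in_poly_time P (vdW_bound \<epsilon>)
                (\<lambda>k xs. \<exists>m \<ge> vdW_length \<epsilon> k. outputs_proper_coloring k m xs)) \<and>
         (\<forall>k\<ge>1. vdW_bound \<epsilon> k \<le> real (vdW k))"
proof (intro conjI impI allI)
  fix k :: nat assume k: "k \<ge> 1"
  obtain c where "proper_coloring k (vdW_length \<epsilon> k) c" using proper_coloring_vdW_length[OF assms k] by blast
  then have "vdW_length \<epsilon> k < vdW k" by (rule proper_coloring_less_vdW[OF k])
  \<comment> \<open>The bound is less than \<open>vdW_length \<epsilon> k + 1\<close>, hence the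
    inequality holds before rounding down.\<close>
  then show "vdW_bound \<epsilon> k \<le> real (vdW k)" unfolding vdW_length_def by linarith
next
  \<comment> \<open>For \<epsilon> >= 1 the length is 0 and the bound does not grow with
    \<open>k\<close>, so a constant-cost program with empty output is the answer.\<close>
  have empty: "outputs_proper_coloring k (vdW_length \<epsilon> k) []" if "\<epsilon> \<ge> 1" "k \<ge> 1" for k
    unfolding vdW_length_eq_0[OF that] outputs_proper_coloring_def
    using proper_coloring_0[OF that(2)] by auto
  show "\<exists>P. solves_in_poly_time P (vdW_bound \<epsilon>) (\<lambda>k xs. outputs_proper_coloring k (vdW_length \<epsilon> k) xs)"
    if len: "\<epsilon> \<in> \<rat> \<or> length_poly_time \<epsilon>"
  proof (cases "\<epsilon> < 1")
    case True
    obtain Q h where Q: "exp_bounded h" "\<And>k. k \<ge> 1 \<Longrightarrow> \<exists>t \<le> h k. runs Q k [vdW_length \<epsilon> k] t"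
      using len length_prog_rational[OF assms True] length_poly_time_exp_bounded[OF assms] by blast
    obtain f where f: "exp_bounded f" "\<And>k. k \<ge> 1 \<Longrightarrow> wp (color_prog Q) (\<lambda>s xs M'. s \<le> f k \<and>
        outputs_proper_coloring k (vdW_length \<epsilon> k) xs) ((\<lambda>_. 0)(0 := k))"
      using color_prog_exp_bounded[OF assms True Q] by blast
    show ?thesis by (rule exI, rule solves_in_poly_timeI[OF assms True f])
  next
    case False
    then show ?thesis using Skip_solves empty by (metis not_less)
  qed
  show "\<exists>P. solves_in_poly_time P (vdW_bound \<epsilon>) (\<lambda>k xs. \<exists>m \<ge> vdW_length \<epsilon> k. outputs_proper_coloring k m xs)"
  proof (cases "\<epsilon> < 1")
    case True
    \<comment> \<open>A smaller rational parameter makes the length computable and at least as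
      large; the cost \<open>2 ^ O(k)\<close> is polynomial in the bound for \<epsilon> as
      well.\<close>
    obtain \<epsilon>' where e': "\<epsilon>' \<in> \<rat>" "0 < \<epsilon>'" "\<epsilon>' < \<epsilon>" using Rats_dense_in_real[OF assms] by blast
    then have e1: "\<epsilon>' < 1" using True by simp
    obtain Q h where Q: "exp_bounded h" "\<And>k. k \<ge> 1 \<Longrightarrow> \<exists>t \<le> h k. runs Q k [vdW_length \<epsilon>' k] t"
      using length_prog_rational[OF e'(2) e1 e'(1)] by blast
    obtain f where f: "exp_bounded f" "\<And>k. k \<ge> 1 \<Longrightarrow> wp (color_prog Q) (\<lambda>s xs M'. s \<le> f k \<and>
        outputs_proper_coloring k (vdW_length \<epsilon>' k) xs) ((\<lambda>_. 0)(0 := k))"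
      using color_prog_exp_bounded[OF e'(2) e1 Q] by blast
    have len: "vdW_length \<epsilon> k \<le> vdW_length \<epsilon>' k" if "k \<ge> 1" for k
    proof -
      have "(2::real) powr ((real k - 1) * (1 - \<epsilon>)) \<le> 2 powr ((real k - 1) * (1 - \<epsilon>'))"
        using that e'(3) by (intro powr_mono mult_left_mono) auto
      then have "vdW_bound \<epsilon> k \<le> vdW_bound \<epsilon>' k" unfolding vdW_bound_def by (simp add: divide_right_mono)
      then show ?thesis unfolding vdW_length_def by (intro nat_mono floor_mono)
    qed
    have "wp (color_prog Q) (\<lambda>s xs M'. s \<le> f k \<and> (\<exists>m \<ge> vdW_length \<epsilon> k. outputs_proper_coloring k m xs))
        ((\<lambda>_. 0)(0 := k))" if "k \<ge> 1" for k
      by (rule wp_mono[OF f(2)[OF that]]) (use len[OF that] in blast)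
    from solves_in_poly_timeI[OF assms True f(1) this] show ?thesis by blast
  next
    case False
    then have "\<exists>m \<ge> vdW_length \<epsilon> k. outputs_proper_coloring k m []" if "k \<ge> 1" for k
      using empty[OF _ that] by auto
    then show ?thesis using Skip_solves[of "\<lambda>k xs. \<exists>m \<ge> vdW_length \<epsilon> k. outputs_proper_coloring k m xs"] by blast
  qed
qed

end
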